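(* Let $G$ be a (connected, simple) graph and $e\in E(G)$. Then $$\frac13\,\delta(G/e)\le \delta(G)\le \frac{16}{3}\,\delta(G/e)+1 .$$
   Context: Graphs $G=(V,E)$ are connected, nonempty, possibly infinite, simple (no loops or multiple edges), and every edge has length $1$. $G$ is regarded as a geodesic metric space: each edge is identified isometrically with $[0,1]$, points of $G$ are the vertices together with all interior points of edges, and $d_G$ is the shortest-path distance. Hyperbolicity constant: a geodesic triangle $T=\{x_1,x_2,x_3\}$ in a geodesic metric space $X$ is the union of three geodesics $[x_1x_2],[x_2x_3],[x_3x_1]$ (the vertices may be arbitrary points of $X$, possibly coinciding). $T$ is $\delta$-thin if each side is contained in the $\delta$-neighborhood of the union of the other two sides; $\delta(T):=\inf\{\delta\ge 0: T \text{ is } \delta\text{-thin}\}$, and $\delta(X):=\sup\{\delta(T): T \text{ a geodesic triangle in } X\}\in[0,\infty]$. $X$ is hyperbolic iff $\delta(X)<\infty$. Edge contraction (simple graphs): for $e=[A,B]\in E(G)$, $G/e$ is the simple graph obtained by removing $e$ and merging $A$ and $B$ into a single vertex $V_e$; if both $[v,A]$ and $[v,B]$ are edges of $G$ for some vertex $v$, they are replaced by a single edge $[v,V_e]$ of $G/e$. *)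

theory Defs
  imports "HOL-Analysis.Analysis"
begin

section \<open>Simple graphs and edge contraction\<close>

record 'a ugraph =
  verts :: "'a set"
  edges :: "'a set set"

definition simple_graph :: "'a ugraph \<Rightarrow> bool" where
  "simple_graph G \<longleftrightarrow> verts G \<noteq> {} \<and> (\<forall>a\<in>edges G. a \<subseteq> verts G \<and> card a = 2)"

definition connected_graph :: "'a ugraph \<Rightarrow> bool" where
  "connected_graph G \<longleftrightarrow>
     (\<forall>u\<in>verts G. \<forall>v\<in>verts G. (u, v) \<in> {(p, q). {p, q} \<in> edges G}\<^sup>*)"

text \<open>In the contraction, the merged vertex is \<^term>\<open>None\<close>; every other vertex \<open>v\<close> becomes
  \<^term>\<open>Some v\<close>.\<close>

definition contract_vertex :: "'a set \<Rightarrow> 'a \<Rightarrow> 'a option" where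
  "contract_vertex e v = (if v \<in> e then None else Some v)"

text \<open>As edges form a set of vertex sets, parallel edges created by merging the ends of \<open>e\<close>
  are automatically identified.\<close>

definition contract :: "'a ugraph \<Rightarrow> 'a set \<Rightarrow> 'a option ugraph" where
  "contract G e =
     \<lparr> verts = contract_vertex e ` verts G,
       edges = (\<lambda>a. contract_vertex e ` a) ` (edges G - {e}) \<rparr>"


section \<open>The metric space of a graph with edges of length one\<close>

text \<open>Points are given by barycentric coordinates: a vertex is its indicator function, and the
  point at distance \<open>t \<in> [0,1]\<close> from \<open>u\<close> on the edge \<open>{u,v}\<close> has coordinate \<open>1 - t\<close> at \<open>u\<close> and
  \<open>t\<close> at \<open>v\<close>. Thus \<open>t = 0\<close> and \<open>t = 1\<close> give the vertices \<open>u\<close> and \<open>v\<close>, and the two orientations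
  of an edge describe the same points.\<close>

definition vertex_point :: "'a \<Rightarrow> 'a \<Rightarrow> real" where
  "vertex_point v = (\<lambda>_. 0)(v := 1)"

definition edge_point :: "'a \<Rightarrow> 'a \<Rightarrow> real \<Rightarrow> 'a \<Rightarrow> real" where
  "edge_point u v t = (\<lambda>_. 0)(u := 1 - t, v := t)"

definition graph_points :: "'a ugraph \<Rightarrow> ('a \<Rightarrow> real) set" where
  "graph_points G =
     vertex_point ` verts G \<union> {edge_point u v t | u v t. {u, v} \<in> edges G \<and> t \<in> {0..1}}"

text \<open>\<open>path_length G x y l\<close>: there is a path of length \<open>l\<close> from \<open>x\<close> to \<open>y\<close> consisting of finitely
  many segments, each contained in an edge.\<close>

inductive path_length ::
    "'a ugraph \<Rightarrow> ('a \<Rightarrow> real) \<Rightarrow> ('a \<Rightarrow> real) \<Rightarrow> real \<Rightarrow> bool" for G where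
  trivial: "x \<in> graph_points G \<Longrightarrow> path_length G x x 0"
| segment: "\<lbrakk> {u, v} \<in> edges G; s \<in> {0..1}; t \<in> {0..1}; path_length G (edge_point u v t) y l \<rbrakk>
    \<Longrightarrow> path_length G (edge_point u v s) y (\<bar>s - t\<bar> + l)"

definition graph_dist :: "'a ugraph \<Rightarrow> ('a \<Rightarrow> real) \<Rightarrow> ('a \<Rightarrow> real) \<Rightarrow> real" where
  "graph_dist G x y = Inf {l. path_length G x y l}"


section \<open>Hyperbolicity constant of a metric space with carrier \<open>M\<close> and distance \<open>d\<close>\<close>

definition geodesic :: "'p set \<Rightarrow> ('p \<Rightarrow> 'p \<Rightarrow> real) \<Rightarrow> 'p \<Rightarrow> 'p \<Rightarrow> 'p set \<Rightarrow> bool" where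
  "geodesic M d x y S \<longleftrightarrow>
     (\<exists>L\<ge>0. \<exists>\<gamma>. \<gamma> ` {0..L} = S \<and> S \<subseteq> M \<and> \<gamma> 0 = x \<and> \<gamma> L = y \<and>
        (\<forall>s\<in>{0..L}. \<forall>t\<in>{0..L}. d (\<gamma> s) (\<gamma> t) = \<bar>s - t\<bar>))"

text \<open>A geodesic triangle is represented by its three sides \<open>A = [x y]\<close>, \<open>B = [y z]\<close>, \<open>C = [z x]\<close>.\<close>

definition geodesic_triangle ::
    "'p set \<Rightarrow> ('p \<Rightarrow> 'p \<Rightarrow> real) \<Rightarrow> 'p set \<Rightarrow> 'p set \<Rightarrow> 'p set \<Rightarrow> bool" where
  "geodesic_triangle M d A B C \<longleftrightarrow>
     (\<exists>x y z. geodesic M d x y A \<and> geodesic M d y z B \<and> geodesic M d z x C)"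

text \<open>Closed neighborhood; using \<open><\<close> or the distance to \<open>S\<close> as an infimum would not change the
  infimum over \<open>r\<close> taken below.\<close>

definition neighborhood :: "'p set \<Rightarrow> ('p \<Rightarrow> 'p \<Rightarrow> real) \<Rightarrow> real \<Rightarrow> 'p set \<Rightarrow> 'p set" where
  "neighborhood M d r S = {p \<in> M. \<exists>q\<in>S. d p q \<le> r}"

definition thin_triangle ::
    "'p set \<Rightarrow> ('p \<Rightarrow> 'p \<Rightarrow> real) \<Rightarrow> real \<Rightarrow> 'p set \<Rightarrow> 'p set \<Rightarrow> 'p set \<Rightarrow> bool" where
  "thin_triangle M d r A B C \<longleftrightarrow>
     A \<subseteq> neighborhood M d r (B \<union> C) \<and>
     B \<subseteq> neighborhood M d r (C \<union> A) \<and>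
     C \<subseteq> neighborhood M d r (A \<union> B)"

definition triangle_delta ::
    "'p set \<Rightarrow> ('p \<Rightarrow> 'p \<Rightarrow> real) \<Rightarrow> 'p set \<Rightarrow> 'p set \<Rightarrow> 'p set \<Rightarrow> ennreal" where
  "triangle_delta M d A B C = Inf {ennreal r | r. 0 \<le> r \<and> thin_triangle M d r A B C}"

definition hyperbolicity_constant :: "'p set \<Rightarrow> ('p \<Rightarrow> 'p \<Rightarrow> real) \<Rightarrow> ennreal" where
  "hyperbolicity_constant M d =
     Sup {triangle_delta M d A B C | A B C. geodesic_triangle M d A B C}"

definition graph_delta :: "'a ugraph \<Rightarrow> ennreal" where
  "graph_delta G = hyperbolicity_constant (graph_points G) (graph_dist G)"

end

theory Submission
  imports Defs
begin

text \<open>Let \<open>A\<close>, \<open>B\<close> be the ends of \<open>e\<close> and \<open>V\<close> the vertex of \<open>G/e\<close> they are merged into. The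
  projection \<open>G \<rightarrow> G/e\<close> is 1-Lipschitz, and a distance can only drop because a path through \<open>V\<close> saves
  the edge \<open>e\<close>, or because two edges \<open>[v,A]\<close>, \<open>[v,B]\<close> are identified.

  Lower bound: a geodesic of \<open>G/e\<close> avoiding \<open>V\<close> lifts to a geodesic of \<open>G\<close>, and one through \<open>V\<close> lifts
  to two geodesics that meet at the midpoint of \<open>e\<close>. Thinness of the triangle they span with a
  geodesic of \<open>G\<close> keeps that geodesic close to the lift, and this costs at most \<open>2 \<delta>(G)\<close> for the only
  side that needs it.

  Upper bound: the projection of a geodesic of \<open>G\<close> is, away from \<open>e\<close>, a union of two geodesics of
  \<open>G/e\<close>, hence within \<open>2r + 1/2\<close> of a geodesic of \<open>G/e\<close> with the same ends if triangles of \<open>G/e\<close> are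
  \<open>r\<close>-thin for some \<open>r \<ge> 1/2\<close>. This gives \<open>\<delta>(G) \<le> 4 \<delta>(G/e) + 3/2\<close>, which suffices when
  \<open>\<delta>(G/e) \<ge> 1/2\<close>. If \<open>\<delta>(G/e) < 1/2\<close>, then every interior point of an edge separates \<open>G/e\<close>. So the part
  of a side of a triangle in \<open>G\<close> that is missed by the other two sides lies in the union of \<open>e\<close> and the
  triangles containing \<open>e\<close>. This set has diameter at most \<open>2\<close>, whence \<open>\<delta>(G) \<le> 1\<close>.\<close>

section \<open>Thin triangles in geodesic spaces\<close>

text \<open>Two obstacles shape the proof. A geodesic of \<open>G/e\<close> may avoid
  \<open>V\<close> while another shortest path between two of its points passes through
  \<open>V\<close>, so the distances of lifted points cannot be read off at once. Nearby points at
  positive distance from \<open>V\<close> admit no such detour, and lifting is therefore proved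
  locally and then summed up. The other obstacle is pairs of points inside two identified edges, the
  \<open>twins\<close>: their images may be close or equal while they are up to 3/2 apart in
  \<open>G\<close>. Lifts avoid them by always preferring the edge at \<open>A\<close>; for
  geodesics of \<open>G\<close> they are treated separately. The factor 3 below is 2 + 1: from a
  side of the triangle in \<open>G/e\<close> to the lifted triangle, then thinness in
  \<open>G\<close>. The factor 4 above is 2 + 1 + 1: to a side of the triangle in
  \<open>G/e\<close>, thinness there, and back. Suprema along geodesics need not be attained, so the
  estimates assume thinness for \<open>r0\<close> and conclude with some \<open>r > r0\<close>; the
  slack disappears at the end.\<close>

definition geodesic_path :: "'p set \<Rightarrow> ('p \<Rightarrow> 'p \<Rightarrow> real) \<Rightarrow> (real \<Rightarrow> 'p) \<Rightarrow> real \<Rightarrow> real \<Rightarrow> bool" where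
  "geodesic_path M d \<gamma> a b \<longleftrightarrow> a \<le> b \<and> \<gamma> ` {a..b} \<subseteq> M \<and>
     (\<forall>s\<in>{a..b}. \<forall>t\<in>{a..b}. d (\<gamma> s) (\<gamma> t) = \<bar>s - t\<bar>)"

lemma geodesic_pathD:
  assumes "geodesic_path M d \<gamma> a b"
  shows "a \<le> b" "\<And>s. a \<le> s \<Longrightarrow> s \<le> b \<Longrightarrow> \<gamma> s \<in> M"
    "\<And>s t. a \<le> s \<Longrightarrow> s \<le> b \<Longrightarrow> a \<le> t \<Longrightarrow> t \<le> b \<Longrightarrow> d (\<gamma> s) (\<gamma> t) = \<bar>s - t\<bar>"
  using assms unfolding geodesic_path_def by auto

text \<open>This is why \<open>geodesic_path\<close> allows any parameter interval: pieces of a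
  geodesic are restrictions of one function, and cutting needs no reparametrization. The form
  starting at 0 that \<open>geodesic\<close> demands is recovered by a shift.\<close>

lemma geodesic_path_subset:
  "geodesic_path M d \<gamma> a b \<Longrightarrow> a \<le> a' \<Longrightarrow> a' \<le> b' \<Longrightarrow> b' \<le> b \<Longrightarrow> geodesic_path M d \<gamma> a' b'"
  unfolding geodesic_path_def by auto

lemma geodesic_path_shift:
  "geodesic_path M d (\<lambda>t. \<gamma> (t + c)) a b \<longleftrightarrow> geodesic_path M d \<gamma> (a + c) (b + c)"
proof -
  have *: "(\<lambda>t. \<gamma> (t + c)) ` {a..b} = \<gamma> ` {a + c..b + c}"
    by (metis image_image image_add_atLeastAtMost' add.commute)
  have "(\<forall>s\<in>{a + c..b + c}. \<forall>t\<in>{a + c..b + c}. d (\<gamma> s) (\<gamma> t) = \<bar>s - t\<bar>)"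
    if "\<forall>s\<in>{a..b}. \<forall>t\<in>{a..b}. d (\<gamma> (s + c)) (\<gamma> (t + c)) = \<bar>s - t\<bar>"
  proof (intro ballI)
    fix s t assume "s \<in> {a + c..b + c}" "t \<in> {a + c..b + c}"
    then show "d (\<gamma> s) (\<gamma> t) = \<bar>s - t\<bar>"
      using that[rule_format, of "s - c" "t - c"] by auto
  qed
  then show ?thesis unfolding geodesic_path_def * by auto
qed

lemma geodesic_path_reverse:
  "geodesic_path M d \<gamma> a b \<Longrightarrow> geodesic_path M d (\<lambda>t. \<gamma> (c - t)) (c - b) (c - a)"
  unfolding geodesic_path_def by (auto simp: image_subset_iff)

lemma geodesic_iff:
  "geodesic M d x y S \<longleftrightarrow>
     (\<exists>\<gamma> L. geodesic_path M d \<gamma> 0 L \<and> \<gamma> 0 = x \<and> \<gamma> L = y \<and> S = \<gamma> ` {0..L})"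
  unfolding geodesic_def geodesic_path_def by auto

lemma geodesicE:
  assumes "geodesic M d x y S"
  obtains \<gamma> L where "geodesic_path M d \<gamma> 0 L" "\<gamma> 0 = x" "\<gamma> L = y" "S = \<gamma> ` {0..L}" "d x y = L"
proof -
  obtain \<gamma> L where *: "geodesic_path M d \<gamma> 0 L" "\<gamma> 0 = x" "\<gamma> L = y" "S = \<gamma> ` {0..L}"
    using assms unfolding geodesic_iff by blast
  moreover have "d x y = L"
    using geodesic_pathD(3)[OF *(1), of 0 L] geodesic_pathD(1)[OF *(1)] * by auto
  ultimately show thesis using that by blast
qed

lemma geodesic_path_geodesic:
  assumes "geodesic_path M d \<gamma> a b"
  shows "geodesic M d (\<gamma> a) (\<gamma> b) (\<gamma> ` {a..b})"
proof -
  have "geodesic_path M d (\<lambda>t. \<gamma> (t + a)) 0 (b - a)"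
    using assms geodesic_path_shift[of M d \<gamma> a 0 "b - a"] by simp
  moreover have "\<gamma> ` {a..b} = (\<lambda>t. \<gamma> (t + a)) ` {0..b - a}"
    unfolding image_image[of \<gamma> "\<lambda>t. t + a", symmetric] image_add_atLeastAtMost' by simp
  ultimately show ?thesis
    unfolding geodesic_iff by (intro exI[of _ "\<lambda>t. \<gamma> (t + a)"] exI[of _ "b - a"]) simp
qed

lemma geodesic_commute: "geodesic M d x y S \<longleftrightarrow> geodesic M d y x S"
proof -
  have "geodesic M d y x S" if S: "geodesic M d x y S" for x y
  proof -
    obtain \<gamma> L where *: "geodesic_path M d \<gamma> 0 L" "\<gamma> 0 = x" "\<gamma> L = y" "S = \<gamma> ` {0..L}"
      using S unfolding geodesic_iff by blast
    have "geodesic_path M d (\<lambda>t. \<gamma> (L - t)) 0 L"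
      using geodesic_path_reverse[OF *(1), of L] by simp
    moreover have "(\<lambda>t. \<gamma> (L - t)) ` {0..L} = S"
      unfolding *(4) image_image[of \<gamma> "\<lambda>t. L - t", symmetric] image_diff_atLeastAtMost by simp
    ultimately show ?thesis
      using *(2,3) unfolding geodesic_iff by (intro exI[of _ "\<lambda>t. \<gamma> (L - t)"] exI[of _ L]) auto
  qed
  then show ?thesis by blast
qed

section \<open>Uniform thinness and the hyperbolicity constant\<close>

definition thin_space :: "'p set \<Rightarrow> ('p \<Rightarrow> 'p \<Rightarrow> real) \<Rightarrow> real \<Rightarrow> bool" where
  "thin_space M d r \<longleftrightarrow> (\<forall>A B C. geodesic_triangle M d A B C \<longrightarrow> thin_triangle M d r A B C)"

text \<open>Examining one side suffices: the corners are arbitrary, so a cyclic relabelling makes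
  any side of a triangle the first one.\<close>

lemma thin_spaceI:
  assumes "\<And>x y z A B C p. \<lbrakk>geodesic M d x y A; geodesic M d y z B; geodesic M d z x C; p \<in> A\<rbrakk>
    \<Longrightarrow> \<exists>q\<in>B \<union> C. d p q \<le> r"
  shows "thin_space M d r"
proof -
  have *: "A \<subseteq> neighborhood M d r (B \<union> C)"
    if "geodesic M d x y A" "geodesic M d y z B" "geodesic M d z x C" for x y z A B C
    using assms[OF that] that(1) by (auto simp: neighborhood_def geodesic_def subset_iff)
  show ?thesis
    unfolding thin_space_def thin_triangle_def geodesic_triangle_def by (metis *)
qed

lemma thin_spaceD:
  assumes "thin_space M d r" "geodesic M d x y A" "geodesic M d y z B" "geodesic M d z x C" "p \<in> A"
  obtains q where "q \<in> B \<union> C" "d p q \<le> r"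
proof -
  have "thin_triangle M d r A B C"
    using assms unfolding thin_space_def geodesic_triangle_def by blast
  then show thesis
    using assms(5) that unfolding thin_triangle_def neighborhood_def by blast
qed

lemma hyperbolicity_constant_le:
  assumes "thin_space M d r" "0 \<le> r"
  shows "hyperbolicity_constant M d \<le> ennreal r"
  unfolding hyperbolicity_constant_def triangle_delta_def
  using assms by (auto intro!: Sup_least Inf_lower simp: thin_space_def)

lemma thin_triangle_mono: "thin_triangle M d r A B C \<Longrightarrow> r \<le> r' \<Longrightarrow> thin_triangle M d r' A B C"
proof -
  assume "r \<le> r'"
  then have "neighborhood M d r S \<subseteq> neighborhood M d r' S" for S
    unfolding neighborhood_def by force
  then show "thin_triangle M d r A B C \<Longrightarrow> thin_triangle M d r' A B C"
    unfolding thin_triangle_def by (meson subset_trans)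
qed

lemma thin_space_mono: "thin_space M d r \<Longrightarrow> r \<le> r' \<Longrightarrow> thin_space M d r'"
  unfolding thin_space_def using thin_triangle_mono by blast

text \<open>The infimum in \<open>triangle_delta\<close> need not be attained; a value strictly
  below \<open>r\<close> guarantees an admissible constant below \<open>r\<close>. Hence the final
  estimates start from constants slightly above delta.\<close>

lemma thin_space_if_hyperbolicity_less:
  assumes "hyperbolicity_constant M d < ennreal r"
  shows "thin_space M d r"
  unfolding thin_space_def
proof (intro allI impI)
  fix A B C assume "geodesic_triangle M d A B C"
  then have "triangle_delta M d A B C \<le> hyperbolicity_constant M d"
    unfolding hyperbolicity_constant_def by (auto intro!: Sup_upper)
  then have "triangle_delta M d A B C < ennreal r" using assms by simp
  then obtain r' where "0 \<le> r'" "thin_triangle M d r' A B C" "ennreal r' < ennreal r"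
    unfolding triangle_delta_def Inf_less_iff by auto
  moreover from this have "r' \<le> r" by (simp add: ennreal_less_iff)
  ultimately show "thin_triangle M d r A B C" using thin_triangle_mono by blast
qed

text \<open>The carrier is explicit because the points of a graph are only some of the functions of
  their type. Symmetry carries no membership condition, as \<open>graph_dist\<close> is symmetric on
  all functions.\<close>

locale carrier_metric =
  fixes M :: "'p set" and d :: "'p \<Rightarrow> 'p \<Rightarrow> real"
  assumes d_nonneg: "x \<in> M \<Longrightarrow> y \<in> M \<Longrightarrow> 0 \<le> d x y"
    and d_refl [simp]: "x \<in> M \<Longrightarrow> d x x = 0"
    and d_zero: "x \<in> M \<Longrightarrow> y \<in> M \<Longrightarrow> d x y = 0 \<Longrightarrow> x = y"
    and d_sym: "d x y = d y x"
    and d_triangle: "x \<in> M \<Longrightarrow> y \<in> M \<Longrightarrow> z \<in> M \<Longrightarrow> d x z \<le> d x y + d y z"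
begin

lemma geodesic_in: "geodesic M d x y S \<Longrightarrow> S \<subseteq> M" "geodesic M d x y S \<Longrightarrow> x \<in> S"
  "geodesic M d x y S \<Longrightarrow> y \<in> S"
  unfolding geodesic_def by auto

lemma geodesic_ends: "geodesic M d x y S \<Longrightarrow> x \<in> M" "geodesic M d x y S \<Longrightarrow> y \<in> M"
  using geodesic_in by blast+

lemma geodesic_singleton: "x \<in> M \<Longrightarrow> geodesic M d x x {x}"
  using geodesic_path_geodesic[of M d "\<lambda>_. x" 0 0] by (simp add: geodesic_path_def)

lemma geodesic_dist_add:
  assumes "geodesic M d x y S" "p \<in> S"
  shows "d x p + d p y = d x y"
proof -
  obtain \<gamma> L where *: "geodesic_path M d \<gamma> 0 L" "\<gamma> 0 = x" "\<gamma> L = y" "S = \<gamma> ` {0..L}" "d x y = L"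
    by (rule geodesicE[OF assms(1)], rule that)
  obtain t where t: "p = \<gamma> t" "0 \<le> t" "t \<le> L" using assms(2) *(4) by auto
  show ?thesis
    using geodesic_pathD(3)[OF *(1), of 0 t] geodesic_pathD(3)[OF *(1), of t L] * t by auto
qed

lemma geodesic_near_ends:
  assumes "geodesic M d x y S" "p \<in> S"
  shows "d p x \<le> d x y / 2 \<or> d p y \<le> d x y / 2"
  using geodesic_dist_add[OF assms] d_sym[of p x] by linarith

text \<open>A shortcut between points of different pieces, completed by the outer parts of the
  pieces, would bring the two ends closer than \<open>c - a\<close>.\<close>

lemma geodesic_path_concat:
  assumes "geodesic_path M d \<gamma> a b" "geodesic_path M d \<gamma> b c" "d (\<gamma> a) (\<gamma> c) = c - a"
  shows "geodesic_path M d \<gamma> a c"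
proof -
  note g1 = geodesic_pathD[OF assms(1)] and g2 = geodesic_pathD[OF assms(2)]
  have mixed: "d (\<gamma> s) (\<gamma> t) = t - s" if "a \<le> s" "s \<le> b" "b \<le> t" "t \<le> c" for s t
  proof -
    have M: "\<gamma> a \<in> M" "\<gamma> s \<in> M" "\<gamma> b \<in> M" "\<gamma> t \<in> M" "\<gamma> c \<in> M"
      using that g1 g2 by auto
    have "d (\<gamma> s) (\<gamma> t) \<le> t - s"
      using d_triangle[of "\<gamma> s" "\<gamma> b" "\<gamma> t"] M g1(3)[of s b] g2(3)[of b t] that g1(1) g2(1) by simp
    moreover have "c - a \<le> d (\<gamma> s) (\<gamma> t) + (s - a) + (c - t)"
      using d_triangle[of "\<gamma> a" "\<gamma> s" "\<gamma> c"] d_triangle[of "\<gamma> s" "\<gamma> t" "\<gamma> c"] M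
        g1(3)[of a s] g2(3)[of t c] that g1(1) g2(1) assms(3) by simp
    ultimately show ?thesis by linarith
  qed
  have "d (\<gamma> s) (\<gamma> t) = \<bar>s - t\<bar>" if "a \<le> s" "s \<le> c" "a \<le> t" "t \<le> c" for s t
    using that g1(3)[of s t] g2(3)[of s t] mixed[of s t] mixed[of t s] d_sym[of "\<gamma> s" "\<gamma> t"]
    by (cases "s \<le> b"; cases "t \<le> b") auto
  moreover have "\<gamma> s \<in> M" if "a \<le> s" "s \<le> c" for s
    using that g1(2)[of s] g2(2)[of s] by (cases "s \<le> b") auto
  ultimately show ?thesis unfolding geodesic_path_def using g1(1) g2(1) by auto
qed

lemma geodesic_concat:
  assumes "geodesic M d x y S" "geodesic M d y z T" "d x z = d x y + d y z"
  shows "geodesic M d x z (S \<union> T)"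
proof -
  obtain \<gamma> L where g: "geodesic_path M d \<gamma> 0 L" "\<gamma> 0 = x" "\<gamma> L = y" "S = \<gamma> ` {0..L}" "d x y = L"
    by (rule geodesicE[OF assms(1)], rule that)
  obtain \<eta> K where h: "geodesic_path M d \<eta> 0 K" "\<eta> 0 = y" "\<eta> K = z" "T = \<eta> ` {0..K}" "d y z = K"
    by (rule geodesicE[OF assms(2)], rule that)
  have L: "0 \<le> L" and K: "0 \<le> K" using geodesic_pathD(1)[OF g(1)] geodesic_pathD(1)[OF h(1)] by auto
  define \<kappa> where "\<kappa> = (\<lambda>t. if t \<le> L then \<gamma> t else \<eta> (t - L))"
  have k1: "\<kappa> t = \<gamma> t" if "t \<le> L" for t using that by (simp add: \<kappa>_def)
  have k2: "\<kappa> t = \<eta> (t - L)" if "L \<le> t" for t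
    using that g(3) h(2) by (cases "t = L") (simp_all add: \<kappa>_def)
  have p1: "geodesic_path M d \<kappa> 0 L"
    using g(1) unfolding geodesic_path_def by (simp add: image_subset_iff k1)
  have p2: "geodesic_path M d \<kappa> L (L + K)"
  proof -
    have "geodesic_path M d (\<lambda>t. \<eta> (t + - L)) L (L + K)"
      unfolding geodesic_path_shift using h(1) by simp
    then show ?thesis unfolding geodesic_path_def by (simp add: image_subset_iff k2)
  qed
  have ends: "\<kappa> 0 = x" "\<kappa> (L + K) = z" using k1[of 0] k2[of "L + K"] g(2) h(3) L K by simp_all
  have "d (\<kappa> 0) (\<kappa> (L + K)) = L + K - 0"
    unfolding ends assms(3) g(5) h(5) by simp
  then have "geodesic_path M d \<kappa> 0 (L + K)" by (rule geodesic_path_concat[OF p1 p2])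
  moreover have "\<kappa> ` {0..L + K} = S \<union> T"
  proof -
    have "{0..L + K} = {0..L} \<union> {L..L + K}"
      using L K by (simp add: ivl_disj_un_two_touch)
    then have "\<kappa> ` {0..L + K} = \<kappa> ` {0..L} \<union> \<kappa> ` {L..L + K}" by (simp only: image_Un)
    moreover have "\<kappa> ` {0..L} = S" unfolding g(4) by (rule image_cong) (auto simp: k1)
    moreover have "\<kappa> ` {L..L + K} = T"
    proof -
      have "\<kappa> ` {L..L + K} = (\<lambda>t. \<eta> (t - L)) ` {L..L + K}"
        by (rule image_cong) (auto simp: k2)
      also have "\<dots> = \<eta> ` (\<lambda>t. t - L) ` {L..L + K}" by (simp only: image_image)
      also have "(\<lambda>t. t - L) ` {L..L + K} = {0..K}" by (simp add: image_minus_const_atLeastAtMost')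
      finally show ?thesis using h(4) by simp
    qed
    ultimately show ?thesis by simp
  qed
  ultimately show ?thesis
    unfolding geodesic_iff using ends by (intro exI[of _ \<kappa>] exI[of _ "L + K"]) simp
qed

end

section \<open>Consequences of thinness for pairs of geodesics and broken geodesics\<close>

locale geodesic_metric = carrier_metric +
  assumes ex_geodesic: "x \<in> M \<Longrightarrow> y \<in> M \<Longrightarrow> \<exists>S. geodesic M d x y S"
begin

text \<open>The third side joins \<open>a\<close> to \<open>u\<close> and has length at most
  \<open>r\<close>, so its points are within \<open>r\<close> of \<open>u\<close>, which lies on
  \<open>S\<close>. Thinness contributes the other \<open>r\<close>.\<close>

lemma thin_corner:
  assumes thin: "thin_space M d r" and P: "geodesic M d x a P" and S: "geodesic M d x u S"
    and "d a u \<le> r" and "p \<in> P"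
  shows "\<exists>q\<in>S. d p q \<le> 2 * r"
proof -
  have M: "a \<in> M" "u \<in> M" using geodesic_ends P S by auto
  obtain T where T: "geodesic M d a u T" using ex_geodesic M by blast
  obtain q where q: "q \<in> T \<union> S" "d p q \<le> r"
    using thin_spaceD[OF thin P T _ \<open>p \<in> P\<close>] S geodesic_commute by metis
  have qM: "q \<in> M" "p \<in> M" using q(1) geodesic_in(1)[OF T] geodesic_in(1)[OF S]
      geodesic_in(1)[OF P] assms(5) by auto
  have "0 \<le> r" using q(2) d_nonneg[of p q] qM by simp
  show ?thesis
  proof (cases "q \<in> S")
    case True then show ?thesis using q(2) \<open>0 \<le> r\<close> by (intro bexI[of _ q]) auto
  next
    case False
    then have "q \<in> T" using q(1) by simp
    then have "d q u \<le> r"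
      using geodesic_dist_add[OF T, of q] d_nonneg[of a q] M qM \<open>d a u \<le> r\<close> by linarith
    then have "d p u \<le> 2 * r" using d_triangle[of p q u] qM M q(2) by linarith
    then show ?thesis using geodesic_in(3)[OF S] by blast
  qed
qed

text \<open>The pieces and \<open>S\<close> form a triangle, so every point of \<open>S\<close> is
  near one of the pieces, and at the transition some point \<open>u\<close> is near both. The part
  of each piece up to its point near \<open>u\<close> and the matching part of \<open>S\<close>
  issue from a common corner, where \<open>thin_corner\<close> applies.\<close>

lemma two_piece:
  assumes thin: "thin_space M d r0" and r: "r0 < r"
    and g1: "geodesic_path M d \<gamma> a c" and g2: "geodesic_path M d \<eta> c' b" and "\<gamma> c = \<eta> c'"
    and S: "geodesic M d (\<gamma> a) (\<eta> b) S"
  obtains u s t where "u \<in> S" "s \<in> {a..c}" "t \<in> {c'..b}" "d u (\<gamma> s) \<le> r" "d u (\<eta> t) \<le> r"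
    "\<And>s'. s' \<in> {a..s} \<Longrightarrow> \<exists>q\<in>S. d (\<gamma> s') q \<le> 2 * r"
    "\<And>t'. t' \<in> {t..b} \<Longrightarrow> \<exists>q\<in>S. d (\<eta> t') q \<le> 2 * r"
proof -
  obtain \<sigma> L where \<sigma>: "geodesic_path M d \<sigma> 0 L" "\<sigma> 0 = \<gamma> a" "\<sigma> L = \<eta> b" "S = \<sigma> ` {0..L}"
    by (rule geodesicE[OF S], rule that)
  have L: "0 \<le> L" using geodesic_pathD(1)[OF \<sigma>(1)] .
  have ab: "a \<le> c" "c' \<le> b" using geodesic_pathD(1)[OF g1] geodesic_pathD(1)[OF g2] by auto
  have near: "(\<exists>s\<in>{a..c}. d (\<sigma> t) (\<gamma> s) \<le> r0) \<or> (\<exists>s\<in>{c'..b}. d (\<sigma> t) (\<eta> s) \<le> r0)"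
    if t: "t \<in> {0..L}" for t
  proof -
    have "geodesic M d (\<eta> b) (\<eta> c') (\<eta> ` {c'..b})" "geodesic M d (\<gamma> c) (\<gamma> a) (\<gamma> ` {a..c})"
      using geodesic_path_geodesic[OF g1] geodesic_path_geodesic[OF g2]
      by (blast dest: geodesic_commute[THEN iffD1])+
    then obtain q where "q \<in> \<eta> ` {c'..b} \<union> \<gamma> ` {a..c}" "d (\<sigma> t) q \<le> r0"
      using thin_spaceD[OF thin S, of "\<eta> c'" _ _ "\<sigma> t"] t unfolding \<sigma>(4) \<open>\<gamma> c = \<eta> c'\<close> by blast
    then show ?thesis by auto
  qed
  have \<sigma>M: "\<sigma> t \<in> M" if "t \<in> {0..L}" for t using that geodesic_pathD(2)[OF \<sigma>(1)] by auto
  have \<gamma>M: "\<gamma> t \<in> M" if "t \<in> {a..c}" for t using that geodesic_pathD(2)[OF g1] by auto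
  have \<eta>M: "\<eta> t \<in> M" if "t \<in> {c'..b}" for t using that geodesic_pathD(2)[OF g2] by auto
  have "0 \<le> r0"
  proof -
    have 0: "0 \<in> {0..L}" using L by simp
    obtain z where "z \<in> M" "d (\<sigma> 0) z \<le> r0" using near[OF 0] \<gamma>M \<eta>M by blast
    then show ?thesis using d_nonneg[of "\<sigma> 0" z] \<sigma>M[OF 0] by linarith
  qed
  \<comment> \<open>\<open>w\<close> bounds the parameters at which \<open>S\<close> is near the
    first piece. The supremum need not be shown to belong to \<open>T\<close>: the slack
    \<open>r - r0\<close> pays for moving to a parameter in \<open>T\<close> just before
    \<open>w\<close> and to one outside \<open>T\<close> just after it.\<close>
  define T where "T = {t\<in>{0..L}. \<exists>s\<in>{a..c}. d (\<sigma> t) (\<gamma> s) \<le> r0}"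
  define w where "w = Sup T"
  have T0: "0 \<in> T" unfolding T_def using L \<open>0 \<le> r0\<close> \<sigma>(2) \<gamma>M[of a] ab by force
  have bdd: "bdd_above T" unfolding T_def by (auto intro!: bdd_aboveI[of _ L])
  have w: "0 \<le> w" "w \<le> L"
    using cSup_upper[OF T0 bdd] T0 unfolding w_def T_def by (auto intro!: cSup_least)
  have move: "d (\<sigma> w) z \<le> r" if "t \<in> {0..L}" "\<bar>w - t\<bar> \<le> r - r0" "d (\<sigma> t) z \<le> r0" "z \<in> M" for t z
    using d_triangle[of "\<sigma> w" "\<sigma> t" z] geodesic_pathD(3)[OF \<sigma>(1), of w t] \<sigma>M[of w] \<sigma>M[of t]
      that w by auto
  obtain t1 where t1: "t1 \<in> T" "w - (r - r0) < t1"
    using less_cSup_iff[of T "w - (r - r0)"] T0 bdd r unfolding w_def by auto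
  moreover have "t1 \<le> w" using cSup_upper[OF t1(1) bdd] by (simp add: w_def)
  ultimately obtain s where s: "s \<in> {a..c}" "d (\<sigma> w) (\<gamma> s) \<le> r"
    using move[of t1] \<gamma>M unfolding T_def by auto
  obtain t where t: "t \<in> {c'..b}" "d (\<sigma> w) (\<eta> t) \<le> r"
  proof (cases "w = L")
    case True
    then have "d (\<sigma> w) (\<eta> b) \<le> r" using \<sigma>(3) \<eta>M[of b] ab \<open>0 \<le> r0\<close> r by simp
    then show ?thesis using that ab by auto
  next
    case False
    define t2 where "t2 = min L (w + (r - r0))"
    have "w < t2" using False w r by (auto simp: t2_def)
    then have "t2 \<notin> T" using cSup_upper[OF _ bdd, of t2] unfolding w_def by auto
    moreover have t2L: "t2 \<in> {0..L}" using \<open>w < t2\<close> w by (auto simp: t2_def)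
    ultimately obtain t where "t \<in> {c'..b}" "d (\<sigma> t2) (\<eta> t) \<le> r0"
      using near[of t2] unfolding T_def by blast
    then show ?thesis using that move[OF t2L] \<open>w < t2\<close> \<eta>M by (auto simp: t2_def)
  qed
  have thin': "thin_space M d r" using thin_space_mono[OF thin] r by simp
  have wS: "\<sigma> w \<in> S" using w \<sigma>(4) by auto
  have 1: "\<exists>q\<in>S. d (\<gamma> s') q \<le> 2 * r" if "s' \<in> {a..s}" for s'
  proof -
    have "geodesic M d (\<gamma> a) (\<gamma> s) (\<gamma> ` {a..s})"
      by (intro geodesic_path_geodesic geodesic_path_subset[OF g1]) (use s in auto)
    moreover have "geodesic M d (\<gamma> a) (\<sigma> w) (\<sigma> ` {0..w})"
      unfolding \<sigma>(2)[symmetric]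
      by (intro geodesic_path_geodesic geodesic_path_subset[OF \<sigma>(1)]) (use w in auto)
    ultimately have "\<exists>q\<in>\<sigma> ` {0..w}. d (\<gamma> s') q \<le> 2 * r"
      using s(2) d_sym[of "\<gamma> s"] that by (intro thin_corner[OF thin', of "\<gamma> a" "\<gamma> s" _ "\<sigma> w"]) auto
    then show ?thesis using \<sigma>(4) w by auto
  qed
  have 2: "\<exists>q\<in>S. d (\<eta> t') q \<le> 2 * r" if "t' \<in> {t..b}" for t'
  proof -
    have "geodesic M d (\<eta> b) (\<eta> t) (\<eta> ` {t..b})"
      by (subst geodesic_commute, intro geodesic_path_geodesic geodesic_path_subset[OF g2]) (use t in auto)
    moreover have "geodesic M d (\<eta> b) (\<sigma> w) (\<sigma> ` {w..L})"
      unfolding \<sigma>(3)[symmetric]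
      by (subst geodesic_commute, intro geodesic_path_geodesic geodesic_path_subset[OF \<sigma>(1)]) (use w in auto)
    ultimately have "\<exists>q\<in>\<sigma> ` {w..L}. d (\<eta> t') q \<le> 2 * r"
      using t(2) d_sym[of "\<eta> t"] that by (intro thin_corner[OF thin', of "\<eta> b" "\<eta> t" _ "\<sigma> w"]) auto
    then show ?thesis using \<sigma>(4) w by auto
  qed
  show thesis using that[OF wS s(1) t(1) s(2) t(2) 1 2] .
qed

text \<open>Outside the gap between \<open>s1\<close> and \<open>t1\<close>,
  \<open>two_piece\<close> gives \<open>2 * r\<close>. The ends of the gap are within
  \<open>r\<close> of \<open>u\<close>, hence at most \<open>2 * r\<close> apart, and
  \<open>quasi\<close> bounds the length of the gap by \<open>2 * r + 1\<close>. So each of its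
  points is within \<open>r + 1/2\<close> of one end and within \<open>2 * r + 1/2\<close> of
  \<open>u\<close>. The hypothesis \<open>quasi\<close> has the shape of
  \<open>gdist_le_contracted\<close>: contraction loses at most 1, except that twins may be 3/2
  apart.\<close>

lemma broken_geodesic_near_geodesic:
  assumes thin: "thin_space M d r0" and r: "r0 < r" and r2: "1/2 \<le> r"
    and g1: "geodesic_path M d f a c" and g2: "geodesic_path M d f c b"
    and quasi: "\<And>s t. s \<in> {a..c} \<Longrightarrow> t \<in> {c..b} \<Longrightarrow> t - s \<le> max (d (f s) (f t) + 1) (3/2)"
    and S: "geodesic M d (f a) (f b) S"
  shows "p \<in> S \<Longrightarrow> \<exists>s\<in>{a..b}. d p (f s) \<le> r"
    and "s \<in> {a..b} \<Longrightarrow> \<exists>q\<in>S. d (f s) q \<le> 2 * r + 1/2"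
proof -
  have ab: "a \<le> c" "c \<le> b" using geodesic_pathD(1)[OF g1] geodesic_pathD(1)[OF g2] by auto
  show "\<exists>s\<in>{a..b}. d p (f s) \<le> r" if p: "p \<in> S"
  proof -
    have "geodesic M d (f b) (f c) (f ` {c..b})" "geodesic M d (f c) (f a) (f ` {a..c})"
      using geodesic_path_geodesic[OF g1] geodesic_path_geodesic[OF g2]
      by (blast dest: geodesic_commute[THEN iffD1])+
    then obtain q where "q \<in> f ` {c..b} \<union> f ` {a..c}" "d p q \<le> r0"
      using thin_spaceD[OF thin S _ _ p] by blast
    then obtain s where "s \<in> {a..c} \<union> {c..b}" "d p (f s) \<le> r0" by blast
    then show ?thesis using r ab by (intro bexI[of _ s]) auto
  qed
  show "\<exists>q\<in>S. d (f s) q \<le> 2 * r + 1/2" if s: "s \<in> {a..b}"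
  proof -
    obtain u s1 t1 where u: "u \<in> S" "s1 \<in> {a..c}" "t1 \<in> {c..b}" "d u (f s1) \<le> r" "d u (f t1) \<le> r"
      and 1: "\<And>s'. s' \<in> {a..s1} \<Longrightarrow> \<exists>q\<in>S. d (f s') q \<le> 2 * r"
      and 2: "\<And>t'. t' \<in> {t1..b} \<Longrightarrow> \<exists>q\<in>S. d (f t') q \<le> 2 * r"
      using two_piece[OF thin r g1 g2 refl S] by blast
    have fM: "f t \<in> M" if "t \<in> {a..b}" for t
      using that geodesic_pathD(2)[OF g1, of t] geodesic_pathD(2)[OF g2, of t] by (cases "t \<le> c") auto
    have uM: "u \<in> M" using u(1) geodesic_in(1)[OF S] by auto
    have lip: "d (f s) (f t) \<le> t - s" if "s \<in> {a..b}" "t \<in> {a..b}" "s \<le> t" for s t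
    proof -
      consider "t \<le> c" | "c \<le> s" | "s \<le> c" "c \<le> t" by linarith
      then show ?thesis
      proof cases
        case 3
        then have "d (f s) (f c) = c - s" "d (f c) (f t) = t - c"
          using that geodesic_pathD(3)[OF g1, of s c] geodesic_pathD(3)[OF g2, of c t] ab by auto
        then show ?thesis using d_triangle[of "f s" "f c" "f t"] fM[of s] fM[of t] fM[of c] that ab by auto
      qed (use that geodesic_pathD(3)[OF g1, of s t] geodesic_pathD(3)[OF g2, of s t] ab in auto)
    qed
    consider "s \<le> s1" | "t1 \<le> s" | "s1 \<le> s" "s \<le> t1" by linarith
    then show ?thesis
    proof cases
      case 3
      have M: "f s \<in> M" "f s1 \<in> M" "f t1 \<in> M" using fM u s ab by auto
      have "d (f s1) (f t1) \<le> 2 * r"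
        using d_triangle[of "f s1" u "f t1"] u(4,5) d_sym[of u "f s1"] M uM by auto
      then have "t1 - s1 \<le> 2 * r + 1" using quasi[OF u(2,3)] r2 by linarith
      then consider "s - s1 \<le> r + 1/2" | "t1 - s \<le> r + 1/2" by linarith
      then have "d (f s) u \<le> 2 * r + 1/2"
      proof cases
        case 1
        then show ?thesis
          using lip[of s1 s] 3 s u ab d_triangle[of "f s" "f s1" u] M uM
            d_sym[of u "f s1"] d_sym[of "f s1" "f s"] by auto
      next
        case 2
        then show ?thesis
          using lip[of s t1] 3 s u ab d_triangle[of "f s" "f t1" u] M uM
            d_sym[of u "f t1"] by auto
      qed
      then show ?thesis using u(1) by auto
    qed (use 1[of s] 2[of s] s in force)+
  qed
qed

end

section \<open>The path metric of a graph\<close>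

lemma edge_point_apply:
  "edge_point u v t w = (if w = v then t else if w = u then 1 - t else 0)"
  by (simp add: edge_point_def)

lemma vertex_point_apply: "vertex_point v w = (if w = v then 1 else 0)"
  by (simp add: vertex_point_def)

lemma edge_point_0: "u \<noteq> v \<Longrightarrow> edge_point u v 0 = vertex_point u"
  by (auto simp: edge_point_apply vertex_point_apply)

lemma edge_point_1: "edge_point u v 1 = vertex_point v"
  by (auto simp: edge_point_apply vertex_point_apply)

lemma edge_point_swap: "u \<noteq> v \<Longrightarrow> edge_point u v t = edge_point v u (1 - t)"
  by (auto simp: edge_point_apply)

lemma vertex_point_inject [simp]: "vertex_point u = vertex_point v \<longleftrightarrow> u = v"
  by (metis vertex_point_apply zero_neq_one)

lemma edge_point_eq_vertex_point:
  assumes "edge_point u v s = vertex_point w" "u \<noteq> v"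
  shows "w = u \<and> s = 0 \<or> w = v \<and> s = 1"
  using fun_cong[OF assms(1), of u] fun_cong[OF assms(1), of v] assms(2)
  by (auto simp: edge_point_apply vertex_point_apply split: if_splits)

lemma edge_point_eq_edge_point:
  assumes "edge_point u v s = edge_point u' v' s'" "u \<noteq> v" "u' \<noteq> v'" "0 < s" "s < 1"
  shows "u' = u \<and> v' = v \<and> s' = s \<or> u' = v \<and> v' = u \<and> s' = 1 - s"
  using fun_cong[OF assms(1), of u] fun_cong[OF assms(1), of v] assms(2-)
  by (auto simp: edge_point_apply split: if_splits)

locale graph =
  fixes G :: "'a ugraph"
  assumes simple: "simple_graph G" and connected: "connected_graph G"
begin

abbreviation "E \<equiv> edges G"
abbreviation "X \<equiv> graph_points G"
abbreviation "gdist \<equiv> graph_dist G"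
abbreviation "gpath \<equiv> path_length G"

lemma edgeD:
  assumes "{u, v} \<in> E"
  shows "u \<noteq> v" "u \<in> verts G" "v \<in> verts G" "{v, u} \<in> E"
  using assms simple by (auto simp: simple_graph_def insert_commute card_2_iff)

lemma edge_point_in: "{u, v} \<in> E \<Longrightarrow> 0 \<le> t \<Longrightarrow> t \<le> 1 \<Longrightarrow> edge_point u v t \<in> X"
  unfolding graph_points_def by auto

lemma vertex_point_in: "v \<in> verts G \<Longrightarrow> vertex_point v \<in> X"
  unfolding graph_points_def by auto

lemma point_cases:
  assumes "x \<in> X"
  obtains (vertex) v where "v \<in> verts G" "x = vertex_point v"
    | (edge) u v t where "{u, v} \<in> E" "0 < t" "t < 1" "x = edge_point u v t"
proof -
  consider v where "v \<in> verts G" "x = vertex_point v"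
    | u v t where "{u, v} \<in> E" "0 \<le> t" "t \<le> 1" "x = edge_point u v t"
    using assms unfolding graph_points_def by auto
  then show thesis
  proof cases
    case (2 u v t)
    then consider "t = 0" | "t = 1" | "0 < t" "t < 1" by linarith
    then show thesis
      using 2 edgeD[OF 2(1)] vertex edge edge_point_0[of u v] edge_point_1[of u v] by cases auto
  qed (rule vertex)
qed

lemma path_in: "gpath x y l \<Longrightarrow> x \<in> X \<and> y \<in> X \<and> 0 \<le> l"
  by (induction rule: path_length.induct) (auto intro: edge_point_in)

lemma path_trans: "gpath x y l \<Longrightarrow> gpath y z k \<Longrightarrow> gpath x z (l + k)"
proof (induction rule: path_length.induct)
  case (segment u v s t y l)
  then show ?case using path_length.segment[of u v G s t z "l + k"] by (simp add: add.assoc)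
qed simp

lemma path_edge:
  assumes "{u, v} \<in> E" "0 \<le> s" "s \<le> 1" "0 \<le> t" "t \<le> 1"
  shows "gpath (edge_point u v s) (edge_point u v t) \<bar>s - t\<bar>"
  using path_length.segment[of u v G s t "edge_point u v t" 0] assms
    path_length.trivial[OF edge_point_in[of u v t]] by simp

lemma path_sym: "gpath x y l \<Longrightarrow> gpath y x l"
proof (induction rule: path_length.induct)
  case (segment u v s t y l)
  then have "gpath (edge_point u v t) (edge_point u v s) \<bar>t - s\<bar>" by (auto intro: path_edge)
  from path_trans[OF segment.IH this] show ?case by (simp add: add.commute abs_minus_commute)
qed (rule path_length.trivial)

abbreviation "adj \<equiv> {(p, q). {p, q} \<in> E}"

lemma walk_path: "(u, w) \<in> adj ^^ n \<Longrightarrow> u \<in> verts G \<Longrightarrow> gpath (vertex_point u) (vertex_point w) (real n)"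
proof (induction n arbitrary: w)
  case 0
  then show ?case by (simp add: path_length.trivial vertex_point_in)
next
  case (Suc n)
  then obtain v where v: "(u, v) \<in> adj ^^ n" "{v, w} \<in> E" by auto
  have "gpath (vertex_point v) (vertex_point w) 1"
    using path_edge[OF v(2), of 0 1] edgeD(1)[OF v(2)] by (simp add: edge_point_0 edge_point_1)
  from path_trans[OF Suc.IH[OF v(1) Suc.prems(2)] this] show ?case by (simp add: add.commute)
qed

lemma near_vertex:
  assumes "x \<in> X"
  shows "\<exists>v\<in>verts G. \<exists>l. gpath x (vertex_point v) l"
  using assms
proof (cases rule: point_cases)
  case (vertex v)
  then show ?thesis using path_length.trivial[OF vertex_point_in] by blast
next
  case (edge u v t)
  then show ?thesis using path_edge[of u v t 1] edgeD(3)[OF edge(1)] by (auto simp: edge_point_1)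
qed

lemma ex_path:
  assumes "x \<in> X" "y \<in> X"
  shows "\<exists>l. gpath x y l"
proof -
  obtain u k w l where u: "u \<in> verts G" "gpath x (vertex_point u) k"
    and w: "w \<in> verts G" "gpath y (vertex_point w) l"
    using near_vertex[OF assms(1)] near_vertex[OF assms(2)] by blast
  then obtain n where "(u, w) \<in> adj ^^ n"
    using connected unfolding connected_graph_def rtrancl_power by blast
  from path_trans[OF u(2) path_trans[OF walk_path[OF this u(1)] path_sym[OF w(2)]]]
  show ?thesis by blast
qed

lemma gdist_le: "gpath x y l \<Longrightarrow> gdist x y \<le> l"
  unfolding graph_dist_def by (auto intro!: cInf_lower bdd_belowI[of _ 0] dest: path_in)

lemma gdist_ge: "x \<in> X \<Longrightarrow> y \<in> X \<Longrightarrow> (\<And>l. gpath x y l \<Longrightarrow> c \<le> l) \<Longrightarrow> c \<le> gdist x y"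
  unfolding graph_dist_def using ex_path[of x y] by (auto intro!: cInf_greatest)

lemma gdist_sym: "gdist x y = gdist y x"
  unfolding graph_dist_def by (intro arg_cong[of _ _ Inf] Collect_cong) (auto intro: path_sym)

lemma gdist_nonneg: "x \<in> X \<Longrightarrow> y \<in> X \<Longrightarrow> 0 \<le> gdist x y"
  using path_in by (auto intro: gdist_ge)

lemma gdist_triangle:
  assumes "x \<in> X" "y \<in> X" "z \<in> X"
  shows "gdist x z \<le> gdist x y + gdist y z"
proof -
  have "gdist x z - k \<le> gdist y z" if "gpath x y k" for k
    using path_trans[OF that] gdist_le[of x z] by (intro gdist_ge assms) force
  then have "gdist x z - gdist y z \<le> gdist x y"
    by (intro gdist_ge assms) force
  then show ?thesis by simp
qed

text \<open>A segment changes each barycentric coordinate by at most its length. This gives the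
  lower bounds for distances within an edge and between vertices without following paths.\<close>

lemma coord_lipschitz:
  assumes "x \<in> X" "y \<in> X"
  shows "\<bar>x w - y w\<bar> \<le> gdist x y"
proof -
  have "\<bar>x w - y w\<bar> \<le> l" if "gpath x y l" for l
    using that
  proof (induction rule: path_length.induct)
    case (segment u v s t y l)
    have "\<bar>edge_point u v s w - edge_point u v t w\<bar> \<le> \<bar>s - t\<bar>" by (auto simp: edge_point_apply)
    then show ?case using segment.IH by linarith
  qed simp
  then show ?thesis using gdist_ge assms by blast
qed

lemma gdist_edge:
  assumes "{u, v} \<in> E" "0 \<le> s" "s \<le> 1" "0 \<le> t" "t \<le> 1"
  shows "gdist (edge_point u v s) (edge_point u v t) = \<bar>s - t\<bar>"
  using gdist_le[OF path_edge[OF assms]] coord_lipschitz[of "edge_point u v s" "edge_point u v t" v]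
    edge_point_in[OF assms(1)] assms by (auto simp: edge_point_apply)

lemma gdist_edge_ends:
  assumes "{u, v} \<in> E" "0 \<le> s" "s \<le> 1"
  shows "gdist (edge_point u v s) (vertex_point u) = s" "gdist (vertex_point u) (edge_point u v s) = s"
    "gdist (edge_point u v s) (vertex_point v) = 1 - s" "gdist (vertex_point v) (edge_point u v s) = 1 - s"
  using gdist_edge[OF assms, of 0] gdist_edge[OF assms, of 1] edgeD(1)[OF assms(1)] assms
  by (auto simp: edge_point_0 edge_point_1 gdist_sym)

lemma gdist_adjacent: "{u, v} \<in> E \<Longrightarrow> gdist (vertex_point u) (vertex_point v) = 1"
  using gdist_edge_ends(2)[of u v 1] by (simp add: edge_point_1)

lemma gdist_vertices_ge:
  assumes "u \<in> verts G" "v \<in> verts G" "u \<noteq> v"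
  shows "1 \<le> gdist (vertex_point u) (vertex_point v)"
  using coord_lipschitz[of "vertex_point u" "vertex_point v" u] assms
  by (simp add: vertex_point_in vertex_point_apply)

lemma path_leave_edge:
  assumes "gpath x y l" "{u, v} \<in> E" "0 \<le> s" "s \<le> 1" "x = edge_point u v s"
  shows "(\<exists>t. 0 \<le> t \<and> t \<le> 1 \<and> y = edge_point u v t) \<or>
    s + gdist (vertex_point u) y \<le> l \<or> 1 - s + gdist (vertex_point v) y \<le> l"
  using assms
proof (induction arbitrary: s rule: path_length.induct)
  case (trivial x)
  then show ?case by blast
next
  case (segment u' v' s' t' y l)
  note uv = edgeD(1)[OF segment.prems(1)] and uv' = edgeD(1)[OF segment.hyps(1)]
  have p: "gpath (edge_point u' v' s') y (\<bar>s' - t'\<bar> + l)"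
    by (rule path_length.segment[OF segment.hyps])
  consider "s = 0" | "s = 1" | "0 < s" "s < 1" using segment.prems by linarith
  then show ?case
  proof cases
    case 3
    then consider "u' = u" "v' = v" "s' = s" | "u' = v" "v' = u" "s' = 1 - s"
      using edge_point_eq_edge_point[of u v s u' v' s'] segment.prems(4) uv uv' by auto
    then obtain t where t: "edge_point u' v' t' = edge_point u v t" "0 \<le> t" "t \<le> 1" "\<bar>s' - t'\<bar> = \<bar>s - t\<bar>"
    proof cases
      case 1 then show ?thesis using that[of t'] segment.hyps by auto
    next
      case 2 then show ?thesis
        using that[of "1 - t'"] segment.hyps edge_point_swap[of u' v' t'] uv' by auto
    qed
    show ?thesis using segment.IH[OF segment.prems(1) t(2,3,1)] t(4)
      by (elim disjE) ((rule disjI1, assumption) | (rule disjI2, linarith))+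
  qed (use gdist_le[OF p] segment.prems uv in \<open>auto simp: edge_point_0 edge_point_1\<close>)
qed

lemma gdist_leave_edge:
  assumes "{u, v} \<in> E" "0 \<le> s" "s \<le> 1" "y \<in> X"
    and off: "\<And>t. 0 \<le> t \<Longrightarrow> t \<le> 1 \<Longrightarrow> y \<noteq> edge_point u v t"
  shows "gdist (edge_point u v s) y =
    min (s + gdist (vertex_point u) y) (1 - s + gdist (vertex_point v) y)"
proof (rule antisym)
  show "min (s + gdist (vertex_point u) y) (1 - s + gdist (vertex_point v) y) \<le> gdist (edge_point u v s) y"
    using path_leave_edge[OF _ assms(1-3) refl, of y] off
    by (intro gdist_ge edge_point_in assms) (auto simp: min_le_iff_disj)
  show "gdist (edge_point u v s) y \<le> min (s + gdist (vertex_point u) y) (1 - s + gdist (vertex_point v) y)"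
    using gdist_triangle[of "edge_point u v s" "vertex_point u" y]
      gdist_triangle[of "edge_point u v s" "vertex_point v" y] assms edgeD[OF assms(1)]
    by (auto simp: gdist_edge_ends edge_point_in vertex_point_in)
qed

lemma near_interior_point:
  assumes "{u, v} \<in> E" "0 < s" "s < 1" "y \<in> X" "gdist (edge_point u v s) y < min s (1 - s)"
  shows "y = edge_point u v (s + gdist (edge_point u v s) y) \<or>
    y = edge_point u v (s - gdist (edge_point u v s) y)"
proof -
  have "\<exists>t. 0 \<le> t \<and> t \<le> 1 \<and> y = edge_point u v t"
  proof (rule ccontr)
    assume "\<nexists>t. 0 \<le> t \<and> t \<le> 1 \<and> y = edge_point u v t"
    then have "gdist (edge_point u v s) y =
        min (s + gdist (vertex_point u) y) (1 - s + gdist (vertex_point v) y)"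
      using assms by (intro gdist_leave_edge) auto
    moreover have "0 \<le> gdist (vertex_point u) y" "0 \<le> gdist (vertex_point v) y"
      using edgeD[OF assms(1)] assms(4) by (auto intro: gdist_nonneg vertex_point_in)
    ultimately show False using assms(5) by (auto simp: min_def split: if_splits)
  qed
  then obtain t where t: "0 \<le> t" "t \<le> 1" "y = edge_point u v t" by blast
  then have "gdist (edge_point u v s) y = \<bar>s - t\<bar>" using gdist_edge assms by simp
  then have "t = s + gdist (edge_point u v s) y \<or> t = s - gdist (edge_point u v s) y" by linarith
  then show ?thesis using t(3) by metis
qed

section \<open>Existence of shortest paths and geodesics\<close>

lemma path_to_vertex:
  assumes "gpath x y l" "y = vertex_point w" "{u, v} \<in> E" "0 \<le> s" "s \<le> 1" "x = edge_point u v s"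
  shows "\<exists>n. (u, w) \<in> adj ^^ n \<and> s + real n \<le> l \<or> (v, w) \<in> adj ^^ n \<and> 1 - s + real n \<le> l"
  using assms
proof (induction arbitrary: u v s rule: path_length.induct)
  case (trivial x)
  then have "w = u \<and> s = 0 \<or> w = v \<and> s = 1"
    using edge_point_eq_vertex_point[of u v s w] edgeD(1) by metis
  then show ?case by (intro exI[of _ 0]) auto
next
  case (segment u' v' s' t' y l)
  \<comment> \<open>Paths are rounded to edge walks that are no longer. Here the first segment
    starts at an end \<open>p\<close> and runs to parameter \<open>t\<close>. If the rest returns
    through \<open>p\<close>, the excursion is dropped; if it continues through \<open>q\<close>,
    the parts \<open>t\<close> and \<open>1 - t\<close> together pay for one full edge.\<close>
  have from_end: "\<exists>n. (p, w) \<in> adj ^^ n \<and> real n \<le> \<bar>s' - t'\<bar> + l"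
    if pq: "{p, q} \<in> E" and t: "0 \<le> t" "t \<le> 1" "edge_point u' v' t' = edge_point p q t" "\<bar>s' - t'\<bar> = t"
    for p q t
  proof -
    obtain n where "(p, w) \<in> adj ^^ n \<and> t + real n \<le> l \<or> (q, w) \<in> adj ^^ n \<and> 1 - t + real n \<le> l"
      using segment.IH[OF segment.prems(1) pq t(1-3)] by blast
    then show ?thesis
    proof (elim disjE conjE)
      assume "(p, w) \<in> adj ^^ n" "t + real n \<le> l"
      then show ?thesis using t by (intro exI[of _ n]) auto
    next
      assume "(q, w) \<in> adj ^^ n" "1 - t + real n \<le> l"
      moreover from this have "(p, w) \<in> adj ^^ Suc n" using pq by (intro relpow_Suc_I2) auto
      ultimately show ?thesis using t by (intro exI[of _ "Suc n"]) auto
    qed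
  qed
  have at_vertex: "\<exists>n. (p, w) \<in> adj ^^ n \<and> real n \<le> \<bar>s' - t'\<bar> + l"
    if "edge_point u' v' s' = vertex_point p" for p
  proof -
    note uv' = segment.hyps edgeD(1,4)[OF segment.hyps(1)]
    have "p = u' \<and> s' = 0 \<or> p = v' \<and> s' = 1"
      using edge_point_eq_vertex_point that uv'(5) by metis
    then show ?thesis
      using from_end[of u' v' t'] from_end[of v' u' "1 - t'"] uv' edge_point_swap[OF uv'(5), of t'] by auto
  qed
  note uv = edgeD(1)[OF segment.prems(2)] and uv' = edgeD(1)[OF segment.hyps(1)]
  consider "s = 0" | "s = 1" | "0 < s" "s < 1" using segment.prems by linarith
  then show ?case
  proof cases
    case 1
    then show ?thesis using at_vertex[of u] segment.prems(5) uv by (auto simp: edge_point_0)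
  next
    case 2
    then show ?thesis using at_vertex[of v] segment.prems(5) uv by (auto simp: edge_point_1)
  next
    case 3
    then consider "u' = u" "v' = v" "s' = s" | "u' = v" "v' = u" "s' = 1 - s"
      using edge_point_eq_edge_point[of u v s u' v' s'] segment.prems(5) uv uv' by auto
    then obtain t where t: "edge_point u' v' t' = edge_point u v t" "0 \<le> t" "t \<le> 1" "\<bar>s' - t'\<bar> = \<bar>s - t\<bar>"
    proof cases
      case 1 then show ?thesis using that[of t'] segment.hyps by auto
    next
      case 2 then show ?thesis
        using that[of "1 - t'"] segment.hyps edge_point_swap[of u' v' t'] uv' by auto
    qed
    obtain n where "(u, w) \<in> adj ^^ n \<and> t + real n \<le> l \<or> (v, w) \<in> adj ^^ n \<and> 1 - t + real n \<le> l"
      using segment.IH[OF segment.prems(1,2) t(2,3,1)] by blast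
    then show ?thesis using t(4) by (intro exI[of _ n]) auto
  qed
qed

text \<open>Walk lengths are natural numbers, so there is a shortest walk, and by
  \<open>path_to_vertex\<close> no path is shorter. The infimum is thus attained even in graphs that
  are not locally finite.\<close>

lemma path_dist_vertices:
  assumes "u \<in> verts G" "w \<in> verts G"
  shows "gpath (vertex_point u) (vertex_point w) (gdist (vertex_point u) (vertex_point w))"
proof (cases "u = w")
  case True
  then have "gpath (vertex_point u) (vertex_point w) 0"
    using path_length.trivial[OF vertex_point_in[OF assms(1)]] by simp
  moreover from this have "gdist (vertex_point u) (vertex_point w) = 0"
    using gdist_le gdist_nonneg vertex_point_in assms by (metis antisym)
  ultimately show ?thesis by simp
next
  case False
  have walk: "\<exists>n. (u, w) \<in> adj ^^ n \<and> real n \<le> l" if p: "gpath (vertex_point u) (vertex_point w) l" for l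
    using p
  proof cases
    case trivial
    then show ?thesis using False by simp
  next
    case (segment p q s t k)
    note pq = edgeD(1,4)[OF segment(3)]
    from segment have "u = p \<and> s = 0 \<or> u = q \<and> s = 1"
      using edge_point_eq_vertex_point[of p q s u] pq by auto
    then obtain v where "{u, v} \<in> E" using segment(3) pq by auto
    then have "\<exists>n. (u, w) \<in> adj ^^ n \<and> 0 + real n \<le> l \<or> (v, w) \<in> adj ^^ n \<and> 1 - 0 + real n \<le> l"
      using path_to_vertex[OF p refl, of u v 0] edgeD(1) by (auto simp: edge_point_0)
    then obtain n where "(u, w) \<in> adj ^^ n \<and> real n \<le> l \<or> (v, w) \<in> adj ^^ n \<and> 1 + real n \<le> l" by auto
    then show ?thesis
    proof
      assume n: "(v, w) \<in> adj ^^ n \<and> 1 + real n \<le> l"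
      have "(u, w) \<in> adj ^^ Suc n" using n \<open>{u, v} \<in> E\<close> by (intro relpow_Suc_I2) auto
      then show ?thesis using n by (intro exI[of _ "Suc n"]) auto
    qed blast
  qed
  define n where "n = (LEAST n. (u, w) \<in> adj ^^ n)"
  obtain l where "gpath (vertex_point u) (vertex_point w) l"
    using ex_path vertex_point_in assms by blast
  then obtain m where "(u, w) \<in> adj ^^ m" using walk by blast
  then have n: "(u, w) \<in> adj ^^ n" unfolding n_def by (rule LeastI)
  have "real n \<le> gdist (vertex_point u) (vertex_point w)"
  proof (intro gdist_ge vertex_point_in assms)
    fix l assume "gpath (vertex_point u) (vertex_point w) l"
    then obtain m where "(u, w) \<in> adj ^^ m" "real m \<le> l" using walk by blast
    moreover from this have "n \<le> m" unfolding n_def by (intro Least_le)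
    ultimately show "real n \<le> l" by linarith
  qed
  then have "gdist (vertex_point u) (vertex_point w) = n"
    using gdist_le[OF walk_path[OF n assms(1)]] by simp
  then show ?thesis using walk_path[OF n assms(1)] by simp
qed

lemma path_dist_edge_point:
  assumes "{u, v} \<in> E" "0 \<le> s" "s \<le> 1" "y \<in> X"
    and "gpath (vertex_point u) y (gdist (vertex_point u) y)"
    and "gpath (vertex_point v) y (gdist (vertex_point v) y)"
  shows "gpath (edge_point u v s) y (gdist (edge_point u v s) y)"
proof (cases "\<exists>t. 0 \<le> t \<and> t \<le> 1 \<and> y = edge_point u v t")
  case True
  then show ?thesis using path_edge[OF assms(1-3)] gdist_edge[OF assms(1-3)] by auto
next
  case False
  then have "gdist (edge_point u v s) y = min (s + gdist (vertex_point u) y) (1 - s + gdist (vertex_point v) y)"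
    using assms by (intro gdist_leave_edge) auto
  moreover have "gpath (edge_point u v s) (vertex_point u) s" "gpath (edge_point u v s) (vertex_point v) (1 - s)"
    using path_edge[OF assms(1-3), of 0] path_edge[OF assms(1-3), of 1] assms edgeD(1)[OF assms(1)]
    by (auto simp: edge_point_0 edge_point_1)
  moreover from this have "gpath (edge_point u v s) y (s + gdist (vertex_point u) y)"
    "gpath (edge_point u v s) y (1 - s + gdist (vertex_point v) y)"
    using path_trans assms(5,6) by blast+
  ultimately show ?thesis by (simp add: min_def)
qed

text \<open>Attainment passes from vertices to all points: unless both points share an edge, the
  distance from a point of an edge is the smaller of the lengths of the two routes through its
  ends.\<close>

lemma path_dist:
  assumes "x \<in> X" "y \<in> X"
  shows "gpath x y (gdist x y)"
proof -
  have to_vertex: "gpath (vertex_point w) z (gdist (vertex_point w) z)" if z: "z \<in> X" and w: "w \<in> verts G" for z w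
    using z
  proof (cases rule: point_cases)
    case (edge u v t)
    then show ?thesis
      using path_dist_edge_point[of u v t "vertex_point w"] path_dist_vertices[OF _ w] edgeD[OF edge(1)]
        vertex_point_in w path_sym gdist_sym by (metis less_imp_le)
  qed (use path_dist_vertices w in auto)
  show ?thesis
    using assms(1)
  proof (cases rule: point_cases)
    case (edge u v t)
    then show ?thesis
      using path_dist_edge_point[of u v t y] to_vertex[OF assms(2)] edgeD[OF edge(1)] assms by auto
  qed (use to_vertex assms in auto)
qed

lemma path_zero: "gpath x y l \<Longrightarrow> l = 0 \<Longrightarrow> x = y"
proof (induction rule: path_length.induct)
  case (segment u v s t y l)
  then have "0 \<le> l" using path_in by blast
  then have "l = 0" "s = t" using segment.prems by linarith+
  then show ?case using segment.IH by simp
qed simp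

lemma geodesic_edge:
  assumes "{u, v} \<in> E" "0 \<le> s" "s \<le> t" "t \<le> 1"
  shows "geodesic_path X gdist (edge_point u v) s t"
  unfolding geodesic_path_def using assms by (auto intro: edge_point_in simp: gdist_edge)

lemma geodesic_edge':
  assumes "{u, v} \<in> E" "0 \<le> s" "s \<le> 1" "0 \<le> t" "t \<le> 1"
  shows "\<exists>S. geodesic X gdist (edge_point u v s) (edge_point u v t) S"
proof (cases "s \<le> t")
  case True
  then show ?thesis using geodesic_path_geodesic[OF geodesic_edge[of u v s t]] assms by blast
next
  case False
  then have "geodesic_path X gdist (edge_point u v) t s" using assms by (intro geodesic_edge) auto
  from geodesic_path_geodesic[OF this] show ?thesis
    by (subst geodesic_commute) (rule exI)
qed

end

sublocale graph \<subseteq> carrier_metric "graph_points G" "graph_dist G"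
proof
  fix x y
  show "gdist x x = 0" if "x \<in> X"
    using gdist_le[OF path_length.trivial[OF that]] gdist_nonneg[OF that that] by simp
  show "x = y" if "x \<in> X" "y \<in> X" "gdist x y = 0" using path_zero[OF path_dist] that by blast
qed (use gdist_nonneg gdist_sym gdist_triangle in auto)

context graph
begin

text \<open>The tail of a path that realizes the distance realizes the distance of its own ends,
  since otherwise the triangle inequality would shorten the whole. So the segments can be glued by
  \<open>geodesic_concat\<close>.\<close>

lemma path_geodesic: "gpath x y l \<Longrightarrow> l = gdist x y \<Longrightarrow> \<exists>S. geodesic X gdist x y S"
proof (induction rule: path_length.induct)
  case (trivial x)
  then show ?case using geodesic_singleton by blast
next
  case (segment u v s t y l)
  let ?x = "edge_point u v s" and ?x' = "edge_point u v t"
  have in_X: "?x \<in> X" "?x' \<in> X" "y \<in> X" and "gdist ?x' y \<le> l"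
    using segment path_in gdist_le by (auto intro: edge_point_in)
  moreover have "gdist ?x ?x' = \<bar>s - t\<bar>" using segment by (auto intro: gdist_edge)
  ultimately have l: "l = gdist ?x' y" using segment.prems gdist_triangle[OF in_X] by linarith
  then obtain S where "geodesic X gdist ?x' y S" using segment.IH by blast
  moreover obtain T where "geodesic X gdist ?x ?x' T"
    using geodesic_edge'[of u v s t] segment by auto
  ultimately show ?case
    using geodesic_concat segment.prems l \<open>gdist ?x ?x' = \<bar>s - t\<bar>\<close> by metis
qed

end

sublocale graph \<subseteq> geodesic_metric "graph_points G" "graph_dist G"
  by standard (use graph.path_geodesic[OF graph_axioms] graph.path_dist[OF graph_axioms] in blast)

section \<open>Contracting an edge\<close>

lemma contract_vertex_eq_iff:
  "contract_vertex e u = contract_vertex e v \<longleftrightarrow> u = v \<or> u \<in> e \<and> v \<in> e"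
  by (auto simp: contract_vertex_def)

lemma contract_vertex_None_iff [simp]: "contract_vertex e u = None \<longleftrightarrow> u \<in> e"
  "None = contract_vertex e u \<longleftrightarrow> u \<in> e"
  by (auto simp: contract_vertex_def)

locale contraction = graph G for G :: "'a ugraph" +
  fixes A B :: 'a
  assumes AB: "{A, B} \<in> E"
begin

abbreviation "H \<equiv> contract G {A, B}"
abbreviation "cv \<equiv> contract_vertex {A, B}"
abbreviation "V \<equiv> vertex_point (None :: 'a option)"

lemma verts_contract: "verts H = cv ` verts G"
  by (simp add: contract_def)

lemma A_neq_B: "A \<noteq> B" using edgeD(1)[OF AB] .

lemma contract_edge: "{u, v} \<in> E \<Longrightarrow> {u, v} \<noteq> {A, B} \<Longrightarrow> {cv u, cv v} \<in> edges H"
  unfolding contract_def by (auto intro!: image_eqI[of _ _ "{u, v}"])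

lemma contract_edge_inj:
  assumes "{u, v} \<in> E" "{u, v} \<noteq> {A, B}"
  shows "cv u \<noteq> cv v"
  using assms edgeD(1)[OF assms(1)] by (auto simp: contract_vertex_eq_iff)

lemma contract_edgeE:
  assumes "{p, q} \<in> edges H"
  obtains u v where "{u, v} \<in> E" "{u, v} \<noteq> {A, B}" "p = cv u" "q = cv v"
proof -
  obtain a where a: "a \<in> E" "a \<noteq> {A, B}" "cv ` a = {p, q}" using assms unfolding contract_def by auto
  then obtain u v where uv: "a = {u, v}" using simple unfolding simple_graph_def card_2_iff by metis
  then have "p = cv u \<and> q = cv v \<or> p = cv v \<and> q = cv u" using a(3) by (auto simp: doubleton_eq_iff)
  then show thesis using that[of u v] that[of v u] a uv by (auto simp: insert_commute)
qed

lemma simple_contract: "simple_graph H"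
proof -
  have "b \<subseteq> verts H \<and> card b = 2" if b: "b \<in> edges H" for b
  proof -
    obtain a where a: "a \<in> E" "a \<noteq> {A, B}" "b = cv ` a" using b unfolding contract_def by auto
    then obtain u v where uv: "a = {u, v}" using simple unfolding simple_graph_def card_2_iff by metis
    then show ?thesis
      using a edgeD[of u v] contract_edge_inj[of u v] by (auto simp: contract_def card_2_iff)
  qed
  moreover have "verts H \<noteq> {}" using simple unfolding simple_graph_def contract_def by simp
  ultimately show ?thesis unfolding simple_graph_def by blast
qed

lemma connected_contract: "connected_graph H"
  unfolding connected_graph_def
proof (intro ballI)
  fix p q assume "p \<in> verts H" "q \<in> verts H"
  then obtain u v where uv: "u \<in> verts G" "v \<in> verts G" "p = cv u" "q = cv v"
    unfolding contract_def by auto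
  have "(u, v) \<in> adj\<^sup>*" using connected uv unfolding connected_graph_def by blast
  then have "(cv u, cv v) \<in> {(p, q). {p, q} \<in> edges H}\<^sup>*"
  proof (induction rule: rtrancl_induct)
    case (step v w)
    show ?case
    proof (cases "{v, w} = {A, B}")
      case True
      then have "cv v = cv w" by (auto simp: contract_vertex_eq_iff)
      then show ?thesis using step.IH by simp
    next
      case False
      then have "{cv v, cv w} \<in> edges H" using step.hyps(2) contract_edge by auto
      then show ?thesis using step.IH by (auto intro: rtrancl_into_rtrancl)
    qed
  qed simp
  then show "(p, q) \<in> {(p, q). {p, q} \<in> edges H}\<^sup>*" using uv by simp
qed

end

sublocale contraction \<subseteq> H: graph "contract G {A, B}"
  by standard (use contraction.simple_contract[OF contraction_axioms]
      contraction.connected_contract[OF contraction_axioms] in auto)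

context contraction
begin

section \<open>The projection to the contracted graph\<close>

lemma V_in: "V \<in> H.X"
  using edgeD(2)[OF AB] by (intro H.vertex_point_in) (auto simp: verts_contract intro!: image_eqI[of _ _ A])

text \<open>The affine extension of \<open>contract_vertex\<close> in barycentric coordinates: the
  weights of \<open>A\<close> and \<open>B\<close> are added at the merged vertex.\<close>

definition proj :: "('a \<Rightarrow> real) \<Rightarrow> 'a option \<Rightarrow> real" where
  "proj x w = (case w of None \<Rightarrow> x A + x B | Some u \<Rightarrow> if u \<in> {A, B} then 0 else x u)"

lemma proj_vertex: "proj (vertex_point u) = vertex_point (cv u)"
  using A_neq_B
  by (auto simp: proj_def vertex_point_apply contract_vertex_def fun_eq_iff split: option.split)

lemma proj_edge:
  assumes "{u, v} \<in> E" "{u, v} \<noteq> {A, B}"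
  shows "proj (edge_point u v t) = edge_point (cv u) (cv v) t"
  using A_neq_B edgeD(1)[OF assms(1)] assms(2)
  by (auto simp: proj_def edge_point_apply contract_vertex_def fun_eq_iff insert_commute
      split: option.split)

lemma proj_contracted: "proj (edge_point A B t) = V"
  using A_neq_B
  by (auto simp: proj_def edge_point_apply vertex_point_apply fun_eq_iff split: option.split)

lemma edge_point_contracted:
  assumes "{u, v} = {A, B}"
  shows "edge_point u v t = edge_point A B t \<or> edge_point u v t = edge_point A B (1 - t)"
  using assms edge_point_swap[of B A t] A_neq_B by (auto simp: doubleton_eq_iff)

lemma proj_contracted':
  assumes "{u, v} = {A, B}"
  shows "proj (edge_point u v t) = V"
  using edge_point_contracted[OF assms, of t] by (auto simp: proj_contracted)

lemma proj_ends [simp]: "proj (vertex_point A) = V" "proj (vertex_point B) = V"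
  by (simp_all add: proj_vertex contract_vertex_def)

text \<open>Segments inside \<open>e\<close> collapse to \<open>V\<close> and cost nothing; every
  other segment keeps its length.\<close>

lemma proj_path: "gpath x y l \<Longrightarrow> \<exists>k\<le>l. H.gpath (proj x) (proj y) k"
proof (induction rule: path_length.induct)
  case (trivial x)
  then have "proj x \<in> H.X"
  proof (cases rule: point_cases)
    case (vertex v)
    then show ?thesis by (auto simp: proj_vertex verts_contract intro!: H.vertex_point_in)
  next
    case (edge u v t)
    show ?thesis
    proof (cases "{u, v} = {A, B}")
      case True
      then show ?thesis using edge(4) proj_contracted' V_in by simp
    next
      case False
      then show ?thesis using edge by (simp add: proj_edge contract_edge H.edge_point_in)
    qed
  qed
  then show ?case using path_length.trivial by blast
next
  case (segment u v s t y l)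
  then obtain k where k: "k \<le> l" "H.gpath (proj (edge_point u v t)) (proj y) k" by blast
  show ?case
  proof (cases "{u, v} = {A, B}")
    case True
    then show ?thesis using k segment.hyps(2,3) by (intro exI[of _ k]) (auto simp: proj_contracted')
  next
    case False
    note uv = segment.hyps(1) False
    have "H.gpath (proj (edge_point u v s)) (proj y) (\<bar>s - t\<bar> + k)"
      using k(2) unfolding proj_edge[OF uv]
      by (intro path_length.segment contract_edge uv segment.hyps)
    then show ?thesis using k(1) by (intro exI[of _ "\<bar>s - t\<bar> + k"]) auto
  qed
qed

lemma proj_in: "x \<in> X \<Longrightarrow> proj x \<in> H.X"
  using proj_path[OF path_length.trivial] H.path_in by blast

lemma proj_lipschitz:
  assumes "x \<in> X" "y \<in> X"
  shows "H.gdist (proj x) (proj y) \<le> gdist x y"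
  using proj_path[OF path_dist[OF assms]] H.gdist_le by (meson order_trans)

definition on_contracted :: "('a \<Rightarrow> real) \<Rightarrow> bool" where
  "on_contracted x \<longleftrightarrow> (\<exists>t. 0 \<le> t \<and> t \<le> 1 \<and> x = edge_point A B t)"

lemma on_contracted_ends [simp]: "on_contracted (vertex_point A)" "on_contracted (vertex_point B)"
  unfolding on_contracted_def
  using edge_point_0[OF A_neq_B] edge_point_1[of A B] by (metis order_refl zero_le_one)+

lemma proj_edge_eq_V:
  assumes "{u, v} \<in> E" "{u, v} \<noteq> {A, B}" "proj (edge_point u v t) = V"
  shows "t = 0 \<and> u \<in> {A, B} \<or> t = 1 \<and> v \<in> {A, B}"
  using assms edge_point_eq_vertex_point[of "cv u" "cv v" t None] contract_edge_inj[OF assms(1,2)]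
  by (auto simp: proj_edge)

lemma proj_eq_V_iff:
  assumes "x \<in> X"
  shows "proj x = V \<longleftrightarrow> on_contracted x"
proof
  assume V: "proj x = V"
  show "on_contracted x"
    using assms
  proof (cases rule: point_cases)
    case (vertex v)
    then show ?thesis using V by (auto simp: proj_vertex)
  next
    case (edge u v t)
    have "{u, v} = {A, B}" using proj_edge_eq_V[of u v t] edge V by auto
    then have "x = edge_point A B t \<or> x = edge_point A B (1 - t)"
      using edge_point_contracted edge(4) by simp
    then show ?thesis using edge(2,3) unfolding on_contracted_def
      by (elim disjE, intro exI[of _ t], simp, intro exI[of _ "1 - t"], simp)
  qed
qed (auto simp: on_contracted_def proj_contracted)

text \<open>An interior point of an edge of \<open>G\<close> determines that edge, while a vertex
  outside \<open>e\<close> lies on every edge above the given one. In both cases orientation and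
  parameter can be copied from \<open>H\<close>.\<close>

lemma lift_edge_point:
  assumes "x \<in> X" "proj x \<noteq> V" "{p, q} \<in> edges H" "proj x = edge_point p q s"
  obtains u v where "{u, v} \<in> E" "{u, v} \<noteq> {A, B}" "cv u = p" "cv v = q" "x = edge_point u v s"
proof -
  note pq = H.edgeD(1)[OF assms(3)]
  show thesis
    using assms(1)
  proof (cases rule: point_cases)
    case (vertex w)
    then have w: "w \<notin> {A, B}" using assms(2) by (auto simp: proj_vertex)
    obtain u v where uv: "{u, v} \<in> E" "{u, v} \<noteq> {A, B}" "p = cv u" "q = cv v"
      using contract_edgeE[OF assms(3)] .
    have "cv w = cv u \<and> s = 0 \<or> cv w = cv v \<and> s = 1"
      using assms(4) vertex(2) edge_point_eq_vertex_point[of p q s "cv w"] pq uv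
      by (auto simp: proj_vertex)
    then have "w = u \<and> s = 0 \<or> w = v \<and> s = 1" using w by (auto simp: contract_vertex_eq_iff)
    then show thesis
      using that[OF uv(1,2)] uv vertex(2) edgeD(1)[OF uv(1)] by (auto simp: edge_point_0 edge_point_1)
  next
    case (edge u v t)
    have ne: "{u, v} \<noteq> {A, B}"
    proof
      assume "{u, v} = {A, B}"
      then show False using assms(2) proj_contracted' edge(4) by auto
    qed
    have "edge_point (cv u) (cv v) t = edge_point p q s"
      using assms(4) edge proj_edge[OF edge(1) ne] by simp
    then consider "p = cv u" "q = cv v" "s = t" | "p = cv v" "q = cv u" "s = 1 - t"
      using edge_point_eq_edge_point[of "cv u" "cv v" t p q s] contract_edge_inj[OF edge(1) ne] pq edge
      by auto
    then show thesis
    proof cases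
      case 2
      then show thesis
        using that[of v u] edge edgeD(1,4)[OF edge(1)] ne edge_point_swap[of u v t]
        by (auto simp: insert_commute)
    qed (use that[of u v] edge ne in auto)
  qed
qed

section \<open>Comparison of distances before and after contraction\<close>

text \<open>The only pairs of points for which a shortest path of \<open>G/e\<close> between the images that avoids the
  vertex \<open>V\<close> need not lift to a path between the two points.\<close>

definition twins :: "('a \<Rightarrow> real) \<Rightarrow> ('a \<Rightarrow> real) \<Rightarrow> bool" where
  "twins x y \<longleftrightarrow> (\<exists>v C D a b. {C, D} = {A, B} \<and> {v, C} \<in> E \<and> {v, D} \<in> E \<and>
     0 < a \<and> a < 1 \<and> 0 < b \<and> b < 1 \<and> x = edge_point v C a \<and> y = edge_point v D b)"

text \<open>Measured in \<open>H\<close>, but equal to the distance in \<open>G\<close> from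
  \<open>x\<close> to the edge \<open>e\<close>: \<open>radius_lipschitz\<close> and
  \<open>gdist_end_le_radius\<close> yield the two inequalities.\<close>

definition radius :: "('a \<Rightarrow> real) \<Rightarrow> real" where
  "radius x = H.gdist (proj x) V"

lemma radius_nonneg: "x \<in> X \<Longrightarrow> 0 \<le> radius x"
  unfolding radius_def using H.gdist_nonneg proj_in V_in by auto

lemma radius_lipschitz:
  assumes "x \<in> X" "y \<in> X"
  shows "radius x \<le> gdist x y + radius y"
  using H.gdist_triangle[of "proj x" "proj y" V] proj_lipschitz[OF assms] proj_in assms V_in
  unfolding radius_def by fastforce

lemma radius_0_iff: "x \<in> X \<Longrightarrow> radius x = 0 \<longleftrightarrow> on_contracted x"
  unfolding radius_def using H.d_zero[OF proj_in V_in] H.d_refl[OF V_in] proj_eq_V_iff by metis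

text \<open>A shortest path to \<open>V\<close> is lifted segment by segment, each lift starting
  where the previous one stopped, until \<open>V\<close> is first met; the lift then stands at an
  end of \<open>e\<close>. Identified edges do no harm because it is not prescribed which end is
  reached.\<close>

lemma gdist_end_le_radius:
  assumes "x \<in> X" "\<not> on_contracted x"
  shows "\<exists>C\<in>{A, B}. gdist x (vertex_point C) \<le> radius x"
proof -
  have "\<exists>C\<in>{A, B}. gdist x (vertex_point C) \<le> l"
    if "H.gpath P Q l" "Q = V" "x \<in> X" "proj x = P" "P \<noteq> V" for P Q l x
    using that
  proof (induction arbitrary: x rule: path_length.induct)
    case (segment p q s t Q l)
    obtain u v where uv: "{u, v} \<in> E" "{u, v} \<noteq> {A, B}" "cv u = p" "cv v = q" "x = edge_point u v s"
      using lift_edge_point[OF segment.prems(2) _ segment.hyps(1)] segment.prems by metis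
    let ?x' = "edge_point u v t"
    have st: "0 \<le> s" "s \<le> 1" "0 \<le> t" "t \<le> 1" using segment.hyps by auto
    have x': "?x' \<in> X" "proj ?x' = edge_point p q t"
      using uv st by (auto simp: proj_edge intro: edge_point_in)
    have xx': "gdist x ?x' = \<bar>s - t\<bar>" using gdist_edge[OF uv(1) st] uv(5) by simp
    show ?case
    proof (cases "proj ?x' = V")
      case True
      then have "\<exists>C\<in>{A, B}. ?x' = vertex_point C"
        using proj_edge_eq_V[OF uv(1,2), of t] edgeD(1)[OF uv(1)] by (auto simp: edge_point_0 edge_point_1)
      moreover have "0 \<le> l" using H.path_in[OF segment.hyps(4)] by simp
      ultimately show ?thesis using xx' by auto
    next
      case False
      then obtain C where C: "C \<in> {A, B}" "gdist ?x' (vertex_point C) \<le> l"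
        using segment.IH[OF segment.prems(1) x'] x'(2) by auto
      moreover have "vertex_point C \<in> X" using C(1) edgeD(2,3)[OF AB] by (auto intro: vertex_point_in)
      ultimately show ?thesis
        using gdist_triangle[OF segment.prems(2) x'(1), of "vertex_point C"] xx' by (intro bexI[of _ C]) auto
    qed
  qed simp
  then show ?thesis
    using H.path_dist[OF proj_in[OF assms(1)] V_in] assms proj_eq_V_iff unfolding radius_def by blast
qed

lemma ends_in: "C \<in> {A, B} \<Longrightarrow> vertex_point C \<in> X"
  using edgeD(2,3)[OF AB] by (auto intro: vertex_point_in)

lemma gdist_contracted_end:
  assumes "on_contracted x" "C \<in> {A, B}"
  shows "gdist x (vertex_point C) \<le> 1"
  using assms gdist_edge_ends[OF AB] unfolding on_contracted_def by auto

lemma on_contracted_in: "on_contracted x \<Longrightarrow> x \<in> X"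
  unfolding on_contracted_def using edge_point_in[OF AB] by auto

lemma gdist_contracted_le:
  assumes "on_contracted x" "on_contracted y"
  shows "gdist x y \<le> 1"
  using assms gdist_edge[OF AB] unfolding on_contracted_def by force

text \<open>A point off \<open>e\<close> reaches some end of \<open>e\<close> within its radius; the
  summand 1 pays for moving along \<open>e\<close>.\<close>

lemma gdist_le_radius_add:
  assumes "x \<in> X" "y \<in> X"
  shows "gdist x y \<le> radius x + radius y + 1"
proof -
  have one: "gdist x y \<le> radius x + radius y + 1"
    if xy: "x \<in> X" "y \<in> X" "\<not> on_contracted y" for x y
  proof -
    obtain D where D: "D \<in> {A, B}" "gdist y (vertex_point D) \<le> radius y"
      using gdist_end_le_radius xy by blast
    obtain C where C: "C \<in> {A, B}" "gdist x (vertex_point D) \<le> radius x + 1"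
    proof (cases "on_contracted x")
      case True
      then show ?thesis using that D gdist_contracted_end[OF True D(1)] radius_nonneg[OF xy(1)] by force
    next
      case False
      then obtain C where C: "C \<in> {A, B}" "gdist x (vertex_point C) \<le> radius x"
        using gdist_end_le_radius xy by blast
      have "gdist (vertex_point C) (vertex_point D) \<le> 1"
        using C(1) D(1) by (intro gdist_contracted_le) auto
      then have "gdist x (vertex_point D) \<le> radius x + 1"
        using gdist_triangle[OF xy(1) ends_in[OF C(1)] ends_in[OF D(1)]] C(2) by simp
      then show ?thesis using that C by blast
    qed
    then show ?thesis
      using gdist_triangle[OF xy(1) ends_in[OF D(1)] xy(2)] D(2) gdist_sym[of y] by simp
  qed
  show ?thesis
  proof (cases "on_contracted x \<and> on_contracted y")
    case True
    then show ?thesis using gdist_contracted_le radius_nonneg assms by (smt (verit))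
  next
    case False
    then show ?thesis using one[OF assms] one[OF assms(2,1)] gdist_sym[of x y] by auto
  qed
qed

lemma twinsI:
  assumes "{C, D} = {A, B}" "{v, C} \<in> E" "{v, D} \<in> E" "0 < a" "a < 1" "0 < b" "b < 1"
  shows "twins (edge_point v C a) (edge_point v D b)"
  using assms unfolding twins_def by blast

text \<open>Off \<open>V\<close> the projection only identifies points on edges \<open>[v,A]\<close>
  and \<open>[v,B]\<close> with a common neighbour \<open>v\<close>, at equal parameters. This is a
  special case of \<open>twins\<close>, which also admits unequal parameters.\<close>

lemma same_proj:
  assumes "x \<in> X" "y \<in> X" "proj x = proj y" "proj x \<noteq> V"
  shows "x = y \<or> twins x y"
  using assms(2)
proof (cases rule: point_cases)
  case (vertex w)
  then have w: "w \<notin> {A, B}" "proj x = vertex_point (Some w)"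
    using assms by (auto simp: proj_vertex contract_vertex_def split: if_splits)
  show ?thesis
    using assms(1)
  proof (cases rule: point_cases)
    case v: (vertex v)
    then show ?thesis using w vertex by (auto simp: proj_vertex contract_vertex_def split: if_splits)
  next
    case (edge u v t)
    then have "{u, v} \<noteq> {A, B}"
      using assms(4) proj_contracted' by auto
    then show ?thesis
      using w edge edge_point_eq_vertex_point[of "cv u" "cv v" t "Some w"] contract_edge_inj[of u v]
      by (auto simp: proj_edge)
  qed
next
  case (edge u v t)
  then have ne: "{u, v} \<noteq> {A, B}"
    using assms(3,4) proj_contracted' by auto
  obtain u' v' where x: "{u', v'} \<in> E" "{u', v'} \<noteq> {A, B}" "cv u' = cv u" "cv v' = cv v" "x = edge_point u' v' t"
    using lift_edge_point[OF assms(1,4) contract_edge[OF edge(1) ne], of t] assms(3) edge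
    by (metis proj_edge[OF edge(1) ne])
  consider "u' = u" "v' = v" | "u' = u" "{v', v} = {A, B}" | "v' = v" "{u', u} = {A, B}"
    using x(3,4) ne edgeD(1)[OF edge(1)] by (auto simp: contract_vertex_eq_iff)
  then show ?thesis
  proof cases
    case 2
    then have "twins x y" unfolding x(5) edge(4) using edge x by (auto intro: twinsI)
    then show ?thesis ..
  next
    case 3
    have "twins (edge_point v u' (1 - t)) (edge_point v u (1 - t))"
      using 3 edge(2,3) edgeD(4)[OF edge(1)] edgeD(4)[OF x(1)] by (intro twinsI) auto
    then have "twins x y"
      using x(5) edge(4) 3(1) edge_point_swap[OF edgeD(1)[OF x(1)], of t]
        edge_point_swap[OF edgeD(1)[OF edge(1)], of t] by simp
    then show ?thesis ..
  qed (use x edge in auto)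
qed

lemma twins_on_edge:
  assumes "twins x y" "x = edge_point u v t" "{u, v} \<in> E"
  shows "\<exists>w C D b. {C, D} = {A, B} \<and> {w, C} \<in> E \<and> {w, D} \<in> E \<and> 0 < b \<and> b < 1 \<and>
    y = edge_point w D b \<and> 0 < t \<and> t < 1 \<and> (u = w \<and> v = C \<or> u = C \<and> v = w)"
proof -
  obtain w C D a b where *: "{C, D} = {A, B}" "{w, C} \<in> E" "{w, D} \<in> E"
     "0 < a" "a < 1" "0 < b" "b < 1" "x = edge_point w C a" "y = edge_point w D b"
    using assms(1) unfolding twins_def by blast
  have eq: "edge_point w C a = edge_point u v t" using *(8) assms(2) by simp
  have "u = w \<and> v = C \<and> t = a \<or> u = C \<and> v = w \<and> t = 1 - a"
    using edge_point_eq_edge_point[OF eq edgeD(1)[OF *(2)] edgeD(1)[OF assms(3)] *(4,5)] .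
  then have "u = w \<and> v = C \<or> u = C \<and> v = w" "0 < t \<and> t < 1" using *(4,5) by auto
  then show ?thesis using *(1-3,6,7,9) by blast
qed

text \<open>A shortest path between the images is lifted from \<open>x\<close> on. If it meets
  \<open>V\<close>, its length bounds the sum of the radii; otherwise the lift ends above
  \<open>proj y\<close>, at \<open>y\<close> or at a twin of it. The induction shows this as
  inequalities for arbitrary paths. They become equalities because the projection is 1-Lipschitz and
  by the triangle inequality through \<open>V\<close>.\<close>

lemma contracted_distance_cases:
  assumes "x \<in> X" "y \<in> X"
  obtains "gdist x y = H.gdist (proj x) (proj y)"
    | "radius x + radius y = H.gdist (proj x) (proj y)"
    | "twins x y"
proof -
  have "gdist x y \<le> l \<or> radius x + radius y \<le> l \<or> twins x y"
    if "H.gpath P Q l" "x \<in> X" "proj x = P" "proj y = Q" for P Q l x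
    using that
  proof (induction arbitrary: x rule: path_length.induct)
    case (trivial P)
    show ?case
    proof (cases "P = V")
      case True
      then show ?thesis using trivial V_in by (simp add: radius_def)
    next
      case False
      then have "x = y \<or> twins x y" using same_proj trivial assms by auto
      then show ?thesis using assms by auto
    qed
  next
    case (segment p q s t Q l)
    have P: "H.gpath (edge_point p q s) Q (\<bar>s - t\<bar> + l)"
      by (rule path_length.segment[OF segment.hyps])
    have st: "0 \<le> s" "s \<le> 1" "0 \<le> t" "t \<le> 1" using segment.hyps by auto
    consider (P) "edge_point p q s = V" | (Q) "Q = V" | (P') "edge_point p q t = V"
      | (none) "edge_point p q s \<noteq> V" "Q \<noteq> V" "edge_point p q t \<noteq> V" by blast
    then show ?case
    proof cases
      case P
      then show ?thesis
        using H.gdist_le[OF \<open>H.gpath (edge_point p q s) Q (\<bar>s - t\<bar> + l)\<close>] segment.prems V_in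
        by (simp add: radius_def H.gdist_sym)
    next
      case Q
      then show ?thesis using H.gdist_le[OF P] segment.prems V_in by (simp add: radius_def)
    next
      case P'
      then have "radius x = \<bar>s - t\<bar>"
        using H.gdist_edge[OF segment.hyps(1) st] segment.prems by (simp add: radius_def)
      moreover have "radius y \<le> l"
        using H.gdist_le[OF segment.hyps(4)] P' segment.prems by (simp add: radius_def H.gdist_sym)
      ultimately show ?thesis by simp
    next
      case none
      obtain u v where uv: "{u, v} \<in> E" "{u, v} \<noteq> {A, B}" "cv u = p" "cv v = q" "x = edge_point u v s"
        using lift_edge_point[OF segment.prems(1) _ segment.hyps(1)] segment.prems none(1) by metis
      let ?x' = "edge_point u v t"
      have x': "?x' \<in> X" "proj ?x' = edge_point p q t"
        using uv st by (auto simp: proj_edge intro: edge_point_in)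
      have xx': "gdist x ?x' = \<bar>s - t\<bar>" using gdist_edge[OF uv(1) st] uv(5) by simp
      consider "gdist ?x' y \<le> l" | "radius ?x' + radius y \<le> l" | "twins ?x' y"
        using segment.IH[OF x' segment.prems(3)] by blast
      then show ?thesis
      proof cases
        case 1
        then show ?thesis using gdist_triangle[OF segment.prems(1) x'(1) assms(2)] xx' by linarith
      next
        case 2
        then show ?thesis using radius_lipschitz[OF segment.prems(1) x'(1)] xx' by linarith
      next
        case 3
        \<comment> \<open>The next point of the lift is a twin of \<open>y\<close>, and
          \<open>x\<close> lies on the same edge \<open>[w,C]\<close>. If \<open>x\<close> is inside
          this edge, it is a twin of \<open>y\<close> too. \<open>x = w\<close> falls under the
          first alternative, because \<open>w\<close> has distance \<open>b\<close> from
          \<open>y\<close> in both graphs, and \<open>x = C\<close> would project to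
          \<open>V\<close>.\<close>
        obtain w C D b where w: "{C, D} = {A, B}" "{w, C} \<in> E" "{w, D} \<in> E" "0 < b" "b < 1"
            "y = edge_point w D b" and uv_cases: "u = w \<and> v = C \<or> u = C \<and> v = w"
          using twins_on_edge[OF 3 refl uv(1)] by blast
        have "\<exists>s'. 0 \<le> s' \<and> s' \<le> 1 \<and> x = edge_point w C s'"
          using uv_cases
        proof
          assume "u = w \<and> v = C" then show ?thesis using uv(5) st by blast
        next
          assume "u = C \<and> v = w" then show ?thesis
            using uv(5) st edge_point_swap[of C w s] edgeD(1)[OF w(2)] by (intro exI[of _ "1 - s"]) auto
        qed
        then obtain s' where s': "0 \<le> s'" "s' \<le> 1" "x = edge_point w C s'" by blast
        consider "s' = 0" | "s' = 1" | "0 < s'" "s' < 1" using s' by linarith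
        then show ?thesis
        proof cases
          case 1
          then have x: "x = vertex_point w" using s' edgeD(1)[OF w(2)] by (simp add: edge_point_0)
          have wD: "{w, D} \<noteq> {A, B}" "C \<in> {A, B}" "D \<in> {A, B}"
            using w(1,2) edgeD(1)[OF w(2)] A_neq_B by (auto simp: doubleton_eq_iff)
          have "H.gdist (proj x) (proj y) = b"
            using H.gdist_edge_ends(2)[OF contract_edge[OF w(3) wD(1)], of b] w(4,5)
            unfolding x w(6) proj_vertex proj_edge[OF w(3) wD(1)] by simp
          then have "b \<le> \<bar>s - t\<bar> + l" using H.gdist_le[OF P] segment.prems by simp
          then show ?thesis unfolding x w(6) using gdist_edge_ends(2)[OF w(3), of b] w(4,5) by simp
        next
          case 2
          then have "x = vertex_point C" using s' by (simp add: edge_point_1)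
          then have "proj x = V" using w(1) by (auto simp: proj_vertex)
          then show ?thesis using none segment.prems by simp
        next
          case 3
          then have "twins x y" unfolding s'(3) w(6) using w by (intro twinsI)
          then show ?thesis by blast
        qed
      qed
    qed
  qed
  from this[OF H.path_dist[OF proj_in[OF assms(1)] proj_in[OF assms(2)]] assms(1) refl refl]
  consider "gdist x y \<le> H.gdist (proj x) (proj y)" | "radius x + radius y \<le> H.gdist (proj x) (proj y)"
    | "twins x y" by blast
  then show thesis
  proof cases
    case 1
    then show ?thesis using that(1) proj_lipschitz[OF assms] by linarith
  next
    case 2
    then show ?thesis
      using that(2) H.gdist_triangle[OF proj_in[OF assms(1)] V_in proj_in[OF assms(2)]]
      unfolding radius_def by (simp add: H.gdist_sym)
  qed (rule that(3))
qed

text \<open>The route through \<open>v\<close> has length \<open>a + b\<close> and the route across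
  \<open>e\<close> has length \<open>3 - (a + b)\<close>; one of them is at most 3/2.\<close>

lemma twins_dist_le:
  assumes "twins x y"
  shows "gdist x y \<le> 3/2"
proof -
  obtain v C D a b where *: "{C, D} = {A, B}" "{v, C} \<in> E" "{v, D} \<in> E"
     "0 < a" "a < 1" "0 < b" "b < 1" "x = edge_point v C a" "y = edge_point v D b"
    using assms unfolding twins_def by blast
  have X: "x \<in> X" "y \<in> X" "vertex_point v \<in> X" "vertex_point C \<in> X" "vertex_point D \<in> X"
    unfolding *(8,9) using *(2-7) edgeD(2,3)[OF *(2)] edgeD(2,3)[OF *(3)]
    by (simp_all add: edge_point_in vertex_point_in)
  have "gdist x y \<le> a + b"
    using gdist_triangle[OF X(1,3,2)] gdist_edge_ends[OF *(2), of a] gdist_edge_ends[OF *(3), of b] *(4-) by simp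
  moreover have "gdist x y \<le> (1 - a) + 1 + (1 - b)"
    using gdist_triangle[OF X(1,4,2)] gdist_triangle[OF X(4,5,2)] gdist_adjacent[of C D] AB
      gdist_edge_ends[OF *(2), of a] gdist_edge_ends[OF *(3), of b] * by simp
  ultimately show ?thesis by linarith
qed

lemma gdist_le_contracted:
  assumes "x \<in> X" "y \<in> X"
  shows "gdist x y \<le> max (H.gdist (proj x) (proj y) + 1) (3/2)"
  using assms
proof (cases rule: contracted_distance_cases)
  case 2
  then show ?thesis using gdist_le_radius_add[OF assms] by simp
next
  case 3
  then show ?thesis using twins_dist_le by fastforce
qed simp

text \<open>Both ends of \<open>e\<close> are at distance 1 from \<open>v\<close>, so collapsing
  \<open>e\<close> creates no shortcut from \<open>v\<close>. The condition on \<open>y\<close>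
  excludes interior points of \<open>e\<close>, which are farther than 1 from \<open>v\<close>
  although their image \<open>V\<close> is at distance 1.\<close>

lemma gdist_common_neighbour:
  assumes "{v, A} \<in> E" "{v, B} \<in> E" "y \<in> X" "on_contracted y \<Longrightarrow> y \<in> vertex_point ` {A, B}"
  shows "H.gdist (proj (vertex_point v)) (proj y) = gdist (vertex_point v) y"
proof -
  have v: "vertex_point v \<in> X" using edgeD[OF assms(1)] by (auto intro: vertex_point_in)
  have one: "gdist (vertex_point v) (vertex_point C) = 1" if "C \<in> {A, B}" for C
    using that gdist_adjacent assms(1,2) by auto
  show ?thesis
    using v assms(3)
  proof (cases rule: contracted_distance_cases)
    case 2
    have "v \<notin> {A, B}" using edgeD(1)[OF assms(1)] edgeD(1)[OF assms(2)] by auto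
    then have "\<not> on_contracted (vertex_point v)" using proj_eq_V_iff[OF v] by (auto simp: proj_vertex)
    then have "1 \<le> radius (vertex_point v)" using gdist_end_le_radius[OF v] one by auto
    moreover have "gdist (vertex_point v) y \<le> 1 + radius y"
    proof (cases "on_contracted y")
      case True
      then show ?thesis using assms(4) one radius_nonneg[OF assms(3)] by auto
    next
      case False
      then obtain C where C: "C \<in> {A, B}" "gdist y (vertex_point C) \<le> radius y"
        using gdist_end_le_radius assms(3) by blast
      then show ?thesis
        using gdist_triangle[OF v ends_in[OF C(1)] assms(3)] one[OF C(1)] gdist_sym[of y] by simp
    qed
    ultimately show ?thesis using 2 proj_lipschitz[OF v assms(3)] by linarith
  next
    case 3
    then obtain w C a where "{w, C} \<in> E" "0 < a" "a < 1" "vertex_point v = edge_point w C a"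
      unfolding twins_def by blast
    then show ?thesis using edge_point_eq_vertex_point[of w C a v] edgeD(1) by force
  qed simp
qed

text \<open>A right inverse of \<open>proj\<close>. The midpoint chosen over \<open>V\<close> treats
  both ends of \<open>e\<close> alike, so that all lifted geodesics from \<open>V\<close> start at
  one point. Where two identified edges lie above, the side condition forbids the interior of the
  one at \<open>B\<close>; hence no two lifts are twins.\<close>

definition lift :: "('a option \<Rightarrow> real) \<Rightarrow> 'a \<Rightarrow> real" where
  "lift P = (if P = V then edge_point A B (1/2)
     else (SOME x. x \<in> X \<and> proj x = P \<and>
       (\<forall>v b. {v, A} \<in> E \<longrightarrow> {v, B} \<in> E \<longrightarrow> 0 < b \<longrightarrow> b < 1 \<longrightarrow> x \<noteq> edge_point v B b)))"

lemma lift_V: "lift V = edge_point A B (1/2)"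
  by (simp add: lift_def)

lemma lift_props:
  assumes "P \<in> H.X" "P \<noteq> V"
  shows "lift P \<in> X \<and> proj (lift P) = P \<and>
    (\<forall>v b. {v, A} \<in> E \<longrightarrow> {v, B} \<in> E \<longrightarrow> 0 < b \<longrightarrow> b < 1 \<longrightarrow> lift P \<noteq> edge_point v B b)"
proof -
  have "\<exists>x. x \<in> X \<and> proj x = P \<and>
       (\<forall>v b. {v, A} \<in> E \<longrightarrow> {v, B} \<in> E \<longrightarrow> 0 < b \<longrightarrow> b < 1 \<longrightarrow> x \<noteq> edge_point v B b)"
    using assms(1)
  proof (cases rule: H.point_cases)
    case (vertex p)
    then obtain u where "u \<in> verts G" "p = cv u" unfolding contract_def by auto
    moreover have "vertex_point u \<noteq> edge_point v B b" if "{v, A} \<in> E" "{v, B} \<in> E" "0 < b" "b < 1" for v b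
      using that edge_point_eq_vertex_point[of v B b u] edgeD(1) by force
    ultimately show ?thesis
      using vertex by (intro exI[of _ "vertex_point u"]) (auto simp: proj_vertex intro: vertex_point_in)
  next
    case (edge p q t)
    obtain u v where uv: "{u, v} \<in> E" "{u, v} \<noteq> {A, B}" "p = cv u" "q = cv v"
      using contract_edgeE[OF edge(1)] .
    show ?thesis
    proof (cases "\<exists>w b. {w, A} \<in> E \<and> {w, B} \<in> E \<and> 0 < b \<and> b < 1 \<and> edge_point u v t = edge_point w B b")
      case False
      then show ?thesis
        using edge uv by (intro exI[of _ "edge_point u v t"]) (auto simp: proj_edge intro: edge_point_in)
    next
      case True
      then obtain w b where w: "{w, A} \<in> E" "{w, B} \<in> E" "0 < b" "b < 1" "edge_point u v t = edge_point w B b"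
        by blast
      have ne: "{w, A} \<noteq> {A, B}" "{w, B} \<noteq> {A, B}"
        using edgeD(1)[OF w(1)] edgeD(1)[OF w(2)] by (auto simp: doubleton_eq_iff)
      have "proj (edge_point w A b) = P"
        using proj_edge[OF w(1) ne(1), of b] proj_edge[OF w(2) ne(2), of b] w(5) proj_edge[OF uv(1,2), of t] edge uv
        by (simp add: contract_vertex_def)
      moreover have "edge_point w A b \<noteq> edge_point v' B b'" if "{v', A} \<in> E" "{v', B} \<in> E" for v' b'
        using edge_point_eq_edge_point[of w A b v' B b'] w edgeD(1)[OF w(1)] edgeD(1)[OF w(2)]
          edgeD(1)[OF that(2)] A_neq_B by auto
      ultimately show ?thesis
        using w by (intro exI[of _ "edge_point w A b"]) (auto intro: edge_point_in)
    qed
  qed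
  from someI_ex[OF this] show ?thesis using assms(2) unfolding lift_def by simp
qed

lemma lift_in: "P \<in> H.X \<Longrightarrow> lift P \<in> X"
  using lift_props[of P] edge_point_in[OF AB, of "1/2"] by (cases "P = V") (auto simp: lift_V)

lemma proj_lift: "P \<in> H.X \<Longrightarrow> proj (lift P) = P"
  using lift_props[of P] proj_contracted by (cases "P = V") (auto simp: lift_V)

lemma lift_not_twins:
  assumes "P \<in> H.X" "Q \<in> H.X"
  shows "\<not> twins (lift P) (lift Q)"
proof
  assume "twins (lift P) (lift Q)"
  then obtain v C D a b where *: "{C, D} = {A, B}" "{v, C} \<in> E" "{v, D} \<in> E"
     "0 < a" "a < 1" "0 < b" "b < 1" "lift P = edge_point v C a" "lift Q = edge_point v D b"
    unfolding twins_def by blast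
  have v: "v \<notin> {A, B}" using *(1-3) edgeD(1)[OF *(2)] edgeD(1)[OF *(3)] by (auto simp: doubleton_eq_iff)
  have "lift V \<noteq> edge_point v C a" if "{v, C} \<in> E" for C a
    using edge_point_eq_edge_point[of A B "1/2" v C a] A_neq_B edgeD(1)[OF that] v by (auto simp: lift_V)
  then have "P \<noteq> V" "Q \<noteq> V" using *(2,3,8,9) by metis+
  then show False
    using lift_props[OF assms(1)] lift_props[OF assms(2)] *(1-7) unfolding *(8,9) by (auto simp: doubleton_eq_iff)
qed

lemma lift_dist_cases:
  assumes "P \<in> H.X" "Q \<in> H.X"
  shows "gdist (lift P) (lift Q) = H.gdist P Q \<or> H.gdist P V + H.gdist V Q = H.gdist P Q"
proof -
  consider "gdist (lift P) (lift Q) = H.gdist P Q" | "radius (lift P) + radius (lift Q) = H.gdist P Q"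
    using contracted_distance_cases[OF lift_in lift_in] lift_not_twins assms proj_lift by metis
  then show ?thesis by cases (use assms in \<open>auto simp: radius_def proj_lift H.gdist_sym\<close>)
qed

end

section \<open>The lower bound\<close>

context carrier_metric
begin

lemma geodesic_path_dist_lipschitz:
  assumes "geodesic_path M d \<gamma> a b" "z \<in> M" "s \<in> {a..b}" "t \<in> {a..b}"
  shows "\<bar>d (\<gamma> s) z - d (\<gamma> t) z\<bar> \<le> \<bar>s - t\<bar>"
proof -
  have "\<gamma> s \<in> M" "\<gamma> t \<in> M" "d (\<gamma> s) (\<gamma> t) = \<bar>s - t\<bar>" "d (\<gamma> t) (\<gamma> s) = \<bar>s - t\<bar>"
    using geodesic_pathD(2,3)[OF assms(1)] assms by auto
  then show ?thesis
    using d_triangle[of "\<gamma> s" "\<gamma> t" z] d_triangle[of "\<gamma> t" "\<gamma> s" z] assms(2) by linarith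
qed

lemma continuous_on_geodesic_path_dist:
  assumes "geodesic_path M d \<gamma> a b" "z \<in> M"
  shows "continuous_on {a..b} (\<lambda>s. d (\<gamma> s) z)"
proof (rule lipschitz_on_continuous_on)
  show "1-lipschitz_on {a..b} (\<lambda>s. d (\<gamma> s) z)"
    using geodesic_path_dist_lipschitz[OF assms] by (intro lipschitz_onI) (auto simp: dist_real_def)
qed

lemma geodesic_split:
  assumes "geodesic M d x y S" "p \<in> S"
  obtains S1 S2 where "geodesic M d x p S1" "geodesic M d p y S2" "S = S1 \<union> S2"
proof -
  obtain \<gamma> L where g: "geodesic_path M d \<gamma> 0 L" "\<gamma> 0 = x" "\<gamma> L = y" "S = \<gamma> ` {0..L}"
    by (rule geodesicE[OF assms(1)])
  obtain c where c: "p = \<gamma> c" "0 \<le> c" "c \<le> L" using assms(2) g(4) by auto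
  have "geodesic M d x p (\<gamma> ` {0..c})" "geodesic M d p y (\<gamma> ` {c..L})"
    unfolding c(1) g(2,3)[symmetric]
    using c by (auto intro!: geodesic_path_geodesic geodesic_path_subset[OF g(1)])
  moreover have "S = \<gamma> ` {0..c} \<union> \<gamma> ` {c..L}"
    unfolding g(4) image_Un[symmetric] using c by (simp add: ivl_disj_un_two_touch)
  ultimately show thesis using that by blast
qed

end

context contraction
begin

text \<open>\<open>lift_dist_cases\<close> leaves open that a route through \<open>V\<close> is
  equally short, although \<open>\<gamma>\<close> avoids \<open>V\<close>. By compactness
  \<open>\<gamma>\<close> stays at some distance \<open>\<epsilon> > 0\<close> from
  \<open>V\<close>, and for points at most \<open>\<epsilon>\<close> apart a route through
  \<open>V\<close> would cost \<open>2 * \<epsilon>\<close>. So short steps keep their length.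
  Summing them bounds lifted distances from above, the projection from below.\<close>

lemma geodesic_path_lift:
  assumes g: "geodesic_path H.X H.gdist \<gamma> a b" and V: "\<And>s. s \<in> {a..b} \<Longrightarrow> \<gamma> s \<noteq> V"
  shows "geodesic_path X gdist (\<lambda>s. lift (\<gamma> s)) a b"
proof -
  note gD = geodesic_pathD[OF g]
  have \<gamma>X: "\<gamma> s \<in> H.X" if "s \<in> {a..b}" for s using that gD(2) by simp
  obtain m where m: "m \<in> {a..b}" "\<And>s. s \<in> {a..b} \<Longrightarrow> H.gdist (\<gamma> m) V \<le> H.gdist (\<gamma> s) V"
    using continuous_attains_inf[OF compact_Icc _ H.continuous_on_geodesic_path_dist[OF g V_in]] gD(1)
    by auto
  define \<epsilon> where "\<epsilon> = H.gdist (\<gamma> m) V"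
  have \<epsilon>: "0 < \<epsilon>"
    using H.d_nonneg[OF \<gamma>X[OF m(1)] V_in] H.d_zero[OF \<gamma>X[OF m(1)] V_in] V[OF m(1)]
    unfolding \<epsilon>_def by fastforce
  have local: "gdist (lift (\<gamma> s)) (lift (\<gamma> t)) \<le> t - s" if st: "s \<in> {a..b}" "t \<in> {a..b}" "s \<le> t" "t - s \<le> \<epsilon>" for s t
  proof -
    have "H.gdist (\<gamma> s) (\<gamma> t) = t - s" using gD(3)[of s t] st by simp
    moreover have "\<epsilon> \<le> H.gdist (\<gamma> s) V" "\<epsilon> \<le> H.gdist V (\<gamma> t)"
      using m(2) st unfolding \<epsilon>_def by (auto simp: H.gdist_sym)
    ultimately show ?thesis using lift_dist_cases[OF \<gamma>X[OF st(1)] \<gamma>X[OF st(2)]] st \<epsilon> by linarith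
  qed
  have le: "gdist (lift (\<gamma> s)) (lift (\<gamma> t)) \<le> t - s"
    if "s \<in> {a..b}" "t \<in> {a..b}" "s \<le> t" "t - s \<le> real n * \<epsilon>" for s t n
    using that
  proof (induction n arbitrary: t)
    case 0
    then have "t = s" by simp
    then show ?case using lift_in[OF \<gamma>X[OF 0(1)]] by simp
  next
    case (Suc n)
    define t' where "t' = max s (t - \<epsilon>)"
    have t': "t' \<in> {a..b}" "s \<le> t'" "t' \<le> t" "t - t' \<le> \<epsilon>" "t' - s \<le> real n * \<epsilon>"
      using Suc.prems \<epsilon> by (auto simp: t'_def algebra_simps)
    then show ?case
      using Suc.IH[OF Suc.prems(1) t'(1,2,5)] local[OF t'(1) Suc.prems(2) t'(3,4)]
        gdist_triangle[of "lift (\<gamma> s)" "lift (\<gamma> t')" "lift (\<gamma> t)"] lift_in \<gamma>X Suc.prems by force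
  qed
  have eq: "gdist (lift (\<gamma> s)) (lift (\<gamma> t)) = t - s" if st: "s \<in> {a..b}" "t \<in> {a..b}" "s \<le> t" for s t
  proof -
    obtain n where "t - s \<le> real n * \<epsilon>" using reals_Archimedean3[OF \<epsilon>, rule_format, of "t - s"] less_imp_le by blast
    then have "gdist (lift (\<gamma> s)) (lift (\<gamma> t)) \<le> t - s" using le st by blast
    moreover have "t - s \<le> gdist (lift (\<gamma> s)) (lift (\<gamma> t))"
      using proj_lipschitz[OF lift_in lift_in, of "\<gamma> s" "\<gamma> t"] proj_lift \<gamma>X gD(3)[of s t] st by simp
    ultimately show ?thesis by simp
  qed
  have "gdist (lift (\<gamma> s)) (lift (\<gamma> t)) = \<bar>s - t\<bar>" if st: "s \<in> {a..b}" "t \<in> {a..b}" for s t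
    using eq[OF st] eq[OF st(2,1)] gdist_sym[of "lift (\<gamma> s)" "lift (\<gamma> t)"] by (cases "s \<le> t") simp_all
  then show ?thesis unfolding geodesic_path_def using gD(1) lift_in \<gamma>X by auto
qed

text \<open>A geodesic starting at \<open>V\<close> lifts to one starting at the midpoint of the contracted edge:
  whichever end of the edge it leaves through, the other end is no shortcut.\<close>

lemma geodesic_path_lift_from_V:
  assumes g: "geodesic_path H.X H.gdist \<gamma> 0 l" and "\<gamma> 0 = V"
  obtains \<kappa> h where "0 \<le> h" "geodesic_path X gdist \<kappa> 0 (l + h)" "\<kappa> 0 = lift V"
    "\<kappa> (l + h) = lift (\<gamma> l)" "\<And>\<tau>. \<tau> \<in> {0..l + h} \<Longrightarrow> proj (\<kappa> \<tau>) = \<gamma> (max 0 (\<tau> - h))"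
proof (cases "l = 0")
  case True
  \<comment> \<open>The lift of a one-point geodesic must end at \<open>lift V\<close>, so it does
    not run along \<open>e\<close>: \<open>h = 0\<close> here, against \<open>h = 1/2\<close> in the
    other case.\<close>
  show thesis
  proof (rule that)
    show "geodesic_path X gdist (\<lambda>_. lift V) 0 (l + 0)"
      using True lift_in[OF V_in] by (simp add: geodesic_path_def)
    show "lift V = lift (\<gamma> l)" using True \<open>\<gamma> 0 = V\<close> by simp
    show "proj (lift V) = \<gamma> (max 0 (\<tau> - 0))" if "\<tau> \<in> {0..l + 0}" for \<tau>
      using that True \<open>\<gamma> 0 = V\<close> proj_lift[OF V_in] by (simp add: max_def)
  qed simp_all
next
  case False
  note gD = geodesic_pathD[OF g]
  have l: "0 < l" using False gD(1) by simp
  define \<beta> where "\<beta> = (\<lambda>t. lift (\<gamma> t))"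
  have \<gamma>X: "\<gamma> t \<in> H.X" if "t \<in> {0..l}" for t using that gD(2) by simp
  have \<beta>X: "\<beta> t \<in> X" "proj (\<beta> t) = \<gamma> t" if "t \<in> {0..l}" for t
    using that \<gamma>X lift_in proj_lift by (auto simp: \<beta>_def)
  have rad: "radius (\<beta> t) = t" if "t \<in> {0..l}" for t
    using that gD(3)[of t 0] l \<open>\<gamma> 0 = V\<close> \<beta>X(2)[OF that] by (simp add: radius_def)
  have off: "\<not> on_contracted (\<beta> t)" if "t \<in> {0<..l}" for t
    using that rad[of t] radius_0_iff[OF \<beta>X(1)[of t]] by auto
  have \<beta>: "gdist (\<beta> s) (\<beta> t) = \<bar>s - t\<bar>" if st: "s \<in> {0<..l}" "t \<in> {0<..l}" for s t
  proof -
    have "geodesic_path X gdist \<beta> (min s t) l" unfolding \<beta>_def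
    proof (intro geodesic_path_lift)
      show "geodesic_path H.X H.gdist \<gamma> (min s t) l"
        by (intro geodesic_path_subset[OF g]) (use st in auto)
      fix t' assume "t' \<in> {min s t..l}"
      then have "H.gdist (\<gamma> t') V > 0" using gD(3)[of t' 0] \<open>\<gamma> 0 = V\<close> st by auto
      then show "\<gamma> t' \<noteq> V" using H.d_refl[OF V_in] by auto
    qed
    from geodesic_pathD(3)[OF this] show ?thesis using st by simp
  qed
  have end': "\<exists>C\<in>{A, B}. gdist (\<beta> t) (vertex_point C) \<le> t" if "t \<in> {0<..l}" for t
    using gdist_end_le_radius[OF \<beta>X(1) off, of t] rad[of t] that by auto
  \<comment> \<open>If points of \<open>\<beta>\<close> at parameters up to \<open>t0\<close> were
    near different ends of \<open>e\<close>, these ends would be at most \<open>2 * t0\<close>,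
    hence at most 1/2, apart, but their distance is 1. So one end \<open>C\<close> serves for all
    parameters.\<close>
  define t0 where "t0 = min l (1/4)"
  have t0: "t0 \<in> {0<..l}" "t0 \<le> 1/4" using l by (auto simp: t0_def)
  obtain C where C: "C \<in> {A, B}" "gdist (\<beta> t0) (vertex_point C) \<le> t0" using end'[OF t0(1)] by blast
  have \<beta>C: "gdist (\<beta> t) (vertex_point C) = t" if t: "t \<in> {0<..l}" for t
  proof (rule antisym)
    have X: "\<beta> t \<in> X" "\<beta> t0 \<in> X" using \<beta>X(1) t t0 by auto
    show "gdist (\<beta> t) (vertex_point C) \<le> t"
    proof (cases "t0 \<le> t")
      case True
      then show ?thesis using gdist_triangle[OF X ends_in[OF C(1)]] C(2) \<beta>[OF t t0(1)] by simp
    next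
      case False
      obtain D where D: "D \<in> {A, B}" "gdist (\<beta> t) (vertex_point D) \<le> t" using end'[OF t] by blast
      have "D = C"
      proof (rule ccontr)
        assume "D \<noteq> C"
        then have "{C, D} \<in> E" using C(1) D(1) AB by (auto simp: insert_commute)
        then have "1 = gdist (vertex_point C) (vertex_point D)" by (simp add: gdist_adjacent)
        also have "\<dots> \<le> gdist (\<beta> t0) (vertex_point C) + (gdist (\<beta> t0) (\<beta> t) + gdist (\<beta> t) (vertex_point D))"
          using gdist_triangle[OF ends_in[OF C(1)] X(2) ends_in[OF D(1)]]
            gdist_triangle[OF X(2,1) ends_in[OF D(1)]] gdist_sym[of "vertex_point C" "\<beta> t0"] by simp
        also have "\<dots> \<le> 2 * t0" using C(2) D(2) \<beta>[OF t0(1) t] False by simp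
        finally show False using t0(2) by simp
      qed
      then show ?thesis using D(2) by simp
    qed
    show "t \<le> gdist (\<beta> t) (vertex_point C)"
      using radius_lipschitz[OF X(1) ends_in[OF C(1)]] rad[of t] t C(1) radius_0_iff[OF ends_in[OF C(1)]] by auto
  qed
  \<comment> \<open>The sign of the motion from the midpoint towards \<open>C\<close>, with
    \<open>e\<close> parametrized from \<open>A\<close> to \<open>B\<close>.\<close>
  define s1 :: real where "s1 = (if C = B then 1 else -1)"
  define \<kappa> where "\<kappa> = (\<lambda>\<tau>. if \<tau> \<le> 1/2 then edge_point A B (1/2 + s1 * \<tau>) else \<beta> (\<tau> - 1/2))"
  have half: "\<kappa> (1/2) = vertex_point C"
    using C(1) edge_point_0[OF A_neq_B] edge_point_1[of A B] by (auto simp: \<kappa>_def s1_def)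
  have half': "\<kappa> \<tau> = vertex_point C" if "\<tau> = 1/2" for \<tau> using that half by (simp only:)
  have k1: "\<kappa> \<tau> = edge_point A B (1/2 + s1 * \<tau>)" if "\<tau> \<le> 1/2" for \<tau> using that by (simp add: \<kappa>_def)
  have k2: "\<kappa> \<tau> = \<beta> (\<tau> - 1/2)" if "1/2 < \<tau>" for \<tau> using that by (simp add: \<kappa>_def)
  have s1: "0 \<le> 1/2 + s1 * \<tau>" "1/2 + s1 * \<tau> \<le> 1" "\<bar>1/2 + s1 * \<tau> - (1/2 + s1 * \<tau>')\<bar> = \<bar>\<tau> - \<tau>'\<bar>"
    if "0 \<le> \<tau>" "\<tau> \<le> 1/2" for \<tau> \<tau>' using that by (auto simp: s1_def)
  have p1: "geodesic_path X gdist \<kappa> 0 (1/2)"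
    unfolding geodesic_path_def
    using s1 by (auto simp: k1 gdist_edge[OF AB] intro: edge_point_in[OF AB])
  have p2: "geodesic_path X gdist \<kappa> (1/2) (1/2 + l)"
  proof -
    have "gdist (\<kappa> s) (\<kappa> t) = \<bar>s - t\<bar>" if st: "s \<in> {1/2..1/2 + l}" "t \<in> {1/2..1/2 + l}" for s t
    proof -
      consider "s = 1/2" "t = 1/2" | "s = 1/2" "1/2 < t" | "1/2 < s" "t = 1/2" | "1/2 < s" "1/2 < t"
        using st by fastforce
      then show ?thesis
      proof cases
        case 1
        then show ?thesis unfolding 1 half using ends_in[OF C(1)] by simp
      next
        case 2
        then show ?thesis
          using \<beta>C[of "t - 1/2"] st gdist_sym[of "vertex_point C"] unfolding half'[OF 2(1)] k2[OF 2(2)] by simp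
      next
        case 3
        then show ?thesis using \<beta>C[of "s - 1/2"] st unfolding half'[OF 3(2)] k2[OF 3(1)] by simp
      next
        case 4
        then show ?thesis using \<beta>[of "s - 1/2" "t - 1/2"] st k2 by simp
      qed
    qed
    moreover have "\<kappa> s \<in> X" if "s \<in> {1/2..1/2 + l}" for s
    proof (cases "s = 1/2")
      case True
      then show ?thesis unfolding half'[OF True] using ends_in[OF C(1)] by simp
    next
      case False
      then show ?thesis using that \<beta>X(1)[of "s - 1/2"] k2[of s] by auto
    qed
    ultimately show ?thesis using l unfolding geodesic_path_def by auto
  qed
  have k0: "\<kappa> 0 = lift V" using k1[of 0] by (simp add: lift_V)
  have kl: "\<kappa> (1/2 + l) = \<beta> l" using k2[of "1/2 + l"] l by simp
  have "gdist (\<kappa> 0) (\<kappa> (1/2 + l)) = 1/2 + l - 0"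
  proof -
    have X: "\<beta> l \<in> X" using \<beta>X l by simp
    \<comment> \<open>Either end costs 1/2 from the midpoint, and either end is at distance at least
      \<open>l\<close> from \<open>\<beta> l\<close>, since its radius is 0.\<close>
    have "gdist (edge_point A B (1/2)) (\<beta> l) =
        min (1/2 + gdist (vertex_point A) (\<beta> l)) (1 - 1/2 + gdist (vertex_point B) (\<beta> l))"
      using off[of l] l by (intro gdist_leave_edge AB X) (auto simp: on_contracted_def)
    moreover have "l \<le> gdist (vertex_point D) (\<beta> l)" if "D \<in> {A, B}" for D
      using radius_lipschitz[OF X ends_in[OF that]] rad[of l] l that radius_0_iff[OF ends_in[OF that]]
        gdist_sym[of "\<beta> l"] by auto
    then have "l \<le> gdist (vertex_point A) (\<beta> l)" "l \<le> gdist (vertex_point B) (\<beta> l)" by auto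
    moreover have "gdist (vertex_point C) (\<beta> l) = l" using \<beta>C[of l] l gdist_sym[of "\<beta> l"] by simp
    ultimately show ?thesis using C(1) unfolding k0 kl lift_V by (auto simp: min_def)
  qed
  then have "geodesic_path X gdist \<kappa> 0 (1/2 + l)" by (rule geodesic_path_concat[OF p1 p2])
  moreover have "proj (\<kappa> \<tau>) = \<gamma> (max 0 (\<tau> - 1/2))" if "\<tau> \<in> {0..l + 1/2}" for \<tau>
    using that \<beta>X(2)[of "\<tau> - 1/2"] proj_contracted \<open>\<gamma> 0 = V\<close> by (auto simp: \<kappa>_def)
  ultimately show thesis using that[of "1/2" \<kappa>] k0 kl by (simp add: \<beta>_def add.commute)
qed

lemma lift_geodesic_from_V:
  assumes "geodesic H.X H.gdist V Q T"
  obtains S where "geodesic X gdist (lift V) (lift Q) S" "proj ` S = T"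
proof -
  obtain \<gamma> l where g: "geodesic_path H.X H.gdist \<gamma> 0 l" "\<gamma> 0 = V" "\<gamma> l = Q" "T = \<gamma> ` {0..l}"
    by (rule geodesicE[OF assms])
  obtain \<kappa> h where k: "0 \<le> h" "geodesic_path X gdist \<kappa> 0 (l + h)" "\<kappa> 0 = lift V"
    "\<kappa> (l + h) = lift (\<gamma> l)" "\<And>\<tau>. \<tau> \<in> {0..l + h} \<Longrightarrow> proj (\<kappa> \<tau>) = \<gamma> (max 0 (\<tau> - h))"
    by (rule geodesic_path_lift_from_V[OF g(1,2)], rule that)
  have l: "0 \<le> l" using geodesic_pathD(1)[OF g(1)] .
  have "proj ` \<kappa> ` {0..l + h} = T"
  proof (intro equalityI subsetI)
    fix P assume "P \<in> proj ` \<kappa> ` {0..l + h}"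
    then show "P \<in> T" using k(5) l unfolding g(4) by (auto intro!: imageI)
  next
    fix P assume "P \<in> T"
    then obtain t where t: "P = \<gamma> t" "0 \<le> t" "t \<le> l" using g(4) by auto
    then have "P = proj (\<kappa> (t + h))" using k(5)[of "t + h"] k(1) by simp
    then show "P \<in> proj ` \<kappa> ` {0..l + h}" using t k(1) by auto
  qed
  then show thesis
    using that geodesic_path_geodesic[OF k(2)] k(3,4) g(3) by simp
qed

lemma lift_geodesic_avoiding_V:
  assumes "geodesic H.X H.gdist P Q T" "V \<notin> T"
  obtains S where "geodesic X gdist (lift P) (lift Q) S" "proj ` S = T"
proof -
  obtain \<gamma> l where g: "geodesic_path H.X H.gdist \<gamma> 0 l" "\<gamma> 0 = P" "\<gamma> l = Q" "T = \<gamma> ` {0..l}"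
    by (rule geodesicE[OF assms(1)])
  have "geodesic_path X gdist (\<lambda>s. lift (\<gamma> s)) 0 l"
    using assms(2) unfolding g(4) by (intro geodesic_path_lift[OF g(1)]) (metis imageI)
  from geodesic_path_geodesic[OF this]
  have "geodesic X gdist (lift P) (lift Q) (lift ` T)" using g(2-4) by (simp add: image_image)
  moreover have "proj ` lift ` T = T"
    using proj_lift H.geodesic_in(1)[OF assms(1)] by (force simp: image_image)
  ultimately show thesis using that by blast
qed

text \<open>If \<open>T\<close> passes through \<open>V\<close>, its halves lift to geodesics that
  meet at the midpoint of \<open>e\<close>, and \<open>two_piece\<close> compares this broken path
  with \<open>S\<close>. The gap left by \<open>two_piece\<close> is measured in \<open>H\<close>,
  where \<open>T\<close> is a geodesic: two of its points within \<open>r\<close> of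
  \<open>proj u\<close> bound an arc of length at most \<open>2 * r\<close>. Thus the length of
  \<open>e\<close> does not enter the estimate.\<close>

lemma lifted_geodesic_near:
  assumes thin: "thin_space X gdist r0" and r: "0 \<le> r0" "r0 < r"
    and T: "geodesic H.X H.gdist P Q T"
  obtains S where "geodesic X gdist (lift P) (lift Q) S"
    "\<And>z. z \<in> S \<Longrightarrow> \<exists>q\<in>T. H.gdist (proj z) q \<le> r"
    "\<And>p. p \<in> T \<Longrightarrow> \<exists>z\<in>S. H.gdist p (proj z) \<le> 2 * r"
proof (cases "V \<in> T")
  case False
  obtain S where S: "geodesic X gdist (lift P) (lift Q) S" "proj ` S = T"
    by (rule lift_geodesic_avoiding_V[OF T False])
  have "H.gdist q q = 0" if "q \<in> T" for q using that H.geodesic_in(1)[OF T] by auto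
  then show thesis using that[OF S(1)] S(2) r by (smt (verit) imageE imageI)
next
  case True
  obtain \<gamma> L where g: "geodesic_path H.X H.gdist \<gamma> 0 L" "\<gamma> 0 = P" "\<gamma> L = Q" "T = \<gamma> ` {0..L}"
    by (rule geodesicE[OF T])
  obtain c where c: "\<gamma> c = V" "0 \<le> c" "c \<le> L" using True g(4) by auto
  have g1: "geodesic_path H.X H.gdist (\<lambda>t. \<gamma> (c - t)) 0 c" "\<gamma> (c - 0) = V"
    using c geodesic_path_reverse[OF geodesic_path_subset[OF g(1), of 0 c], of c] by simp_all
  obtain \<kappa>1 h1 where k1: "0 \<le> h1" "geodesic_path X gdist \<kappa>1 0 (c + h1)" "\<kappa>1 0 = lift V"
    "\<kappa>1 (c + h1) = lift (\<gamma> (c - c))" "\<And>\<tau>. \<tau> \<in> {0..c + h1} \<Longrightarrow> proj (\<kappa>1 \<tau>) = \<gamma> (c - max 0 (\<tau> - h1))"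
    by (rule geodesic_path_lift_from_V[OF g1], rule that)
  have g2: "geodesic_path H.X H.gdist (\<lambda>t. \<gamma> (t + c)) 0 (L - c)" "\<gamma> (0 + c) = V"
    unfolding geodesic_path_shift using geodesic_path_subset[OF g(1), of c L] c by simp_all
  obtain \<kappa>2 h2 where k2: "0 \<le> h2" "geodesic_path X gdist \<kappa>2 0 (L - c + h2)" "\<kappa>2 0 = lift V"
    "\<kappa>2 (L - c + h2) = lift (\<gamma> (L - c + c))"
    "\<And>\<tau>. \<tau> \<in> {0..L - c + h2} \<Longrightarrow> proj (\<kappa>2 \<tau>) = \<gamma> (max 0 (\<tau> - h2) + c)"
    by (rule geodesic_path_lift_from_V[OF g2], rule that)
  define \<eta> where "\<eta> = (\<lambda>t. \<kappa>1 (c + h1 - t))"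
  have \<eta>: "geodesic_path X gdist \<eta> 0 (c + h1)"
    using geodesic_path_reverse[OF k1(2), of "c + h1"] by (simp add: \<eta>_def)
  have proj_\<eta>: "proj (\<eta> \<tau>) = \<gamma> (min c \<tau>)" if "\<tau> \<in> {0..c + h1}" for \<tau>
    using k1(5)[of "c + h1 - \<tau>"] that by (auto simp: \<eta>_def min_def max_def algebra_simps)
  have ends: "\<eta> 0 = lift P" "\<eta> (c + h1) = \<kappa>2 0" "\<kappa>2 (L - c + h2) = lift Q"
    using k1(3,4) k2(3,4) g(2,3) by (auto simp: \<eta>_def)
  have Xs: "lift P \<in> X" "lift Q \<in> X" using H.geodesic_ends[OF T] lift_in by auto
  obtain S where S: "geodesic X gdist (lift P) (lift Q) S" using ex_geodesic[OF Xs] by blast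
  have SX: "S \<subseteq> X" using geodesic_in(1)[OF S] .
  have \<eta>X: "\<eta> \<tau> \<in> X" if "\<tau> \<in> {0..c + h1}" for \<tau> using that geodesic_pathD(2)[OF \<eta>] by auto
  have \<kappa>X: "\<kappa>2 \<tau> \<in> X" if "\<tau> \<in> {0..L - c + h2}" for \<tau> using that geodesic_pathD(2)[OF k2(2)] by auto
  have 1: "\<exists>q\<in>T. H.gdist (proj z) q \<le> r" if z: "z \<in> S" for z
  proof -
    have "geodesic X gdist (lift Q) (\<kappa>2 0) (\<kappa>2 ` {0..L - c + h2})"
      "geodesic X gdist (\<kappa>2 0) (lift P) (\<eta> ` {0..c + h1})"
      using geodesic_path_geodesic[OF k2(2)] geodesic_path_geodesic[OF \<eta>] unfolding ends
      by (simp_all add: geodesic_commute)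
    then obtain w where w: "w \<in> \<kappa>2 ` {0..L - c + h2} \<union> \<eta> ` {0..c + h1}" "gdist z w \<le> r0"
      by (rule thin_spaceD[OF thin S _ _ z])
    have "proj w \<in> T"
      using w(1) proj_\<eta> k2(5) c unfolding g(4) by (auto intro!: imageI)
    moreover have "w \<in> X" using w(1) \<eta>X \<kappa>X by auto
    then have "H.gdist (proj z) (proj w) \<le> r" using proj_lipschitz[of z w] z SX w(2) r by force
    ultimately show ?thesis by blast
  qed
  obtain u s t where u: "u \<in> S" "s \<in> {0..c + h1}" "t \<in> {0..L - c + h2}" "gdist u (\<eta> s) \<le> r" "gdist u (\<kappa>2 t) \<le> r"
    and before: "\<And>s'. s' \<in> {0..s} \<Longrightarrow> \<exists>q\<in>S. gdist (\<eta> s') q \<le> 2 * r"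
    and after: "\<And>t'. t' \<in> {t..L - c + h2} \<Longrightarrow> \<exists>q\<in>S. gdist (\<kappa>2 t') q \<le> 2 * r"
    using two_piece[OF thin r(2) \<eta> k2(2) ends(2)] S unfolding ends by metis
  \<comment> \<open>Parameters on \<open>T\<close> of the images of \<open>\<eta> s\<close> and
    \<open>\<kappa>2 t\<close>. The truncations reflect the times \<open>h1\<close> and
    \<open>h2\<close> that the lifts spend on \<open>e\<close>, while the image rests at
    \<open>V\<close>.\<close>
  define a where "a = min c s"
  define b where "b = max 0 (t - h2) + c"
  have ab: "proj (\<eta> s) = \<gamma> a" "proj (\<kappa>2 t) = \<gamma> b" "0 \<le> a" "a \<le> b" "b \<le> L"
    using proj_\<eta>[OF u(2)] k2(5)[OF u(3)] u c by (auto simp: a_def b_def)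
  have uX: "u \<in> X" using u(1) SX by auto
  have ua: "H.gdist (\<gamma> a) (proj u) \<le> r" "H.gdist (\<gamma> b) (proj u) \<le> r"
    using proj_lipschitz[OF uX \<eta>X[OF u(2)]] proj_lipschitz[OF uX \<kappa>X[OF u(3)]] u ab(1,2)
    by (auto simp: H.gdist_sym)
  have \<gamma>X: "\<gamma> \<tau> \<in> H.X" if "\<tau> \<in> {0..L}" for \<tau> using that geodesic_pathD(2)[OF g(1)] by auto
  have near_S: "\<exists>z\<in>S. H.gdist (proj y) (proj z) \<le> 2 * r" if "y \<in> X" "\<exists>q\<in>S. gdist y q \<le> 2 * r" for y
    using that proj_lipschitz SX by (meson order_trans subsetD)
  have 2: "\<exists>z\<in>S. H.gdist p (proj z) \<le> 2 * r" if p: "p \<in> T" for p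
  proof -
    obtain \<tau> where \<tau>: "p = \<gamma> \<tau>" "0 \<le> \<tau>" "\<tau> \<le> L" using p g(4) by auto
    consider "\<tau> \<le> a" | "b \<le> \<tau>" | "a \<le> \<tau>" "\<tau> \<le> b" by linarith
    then show ?thesis
    proof cases
      case 1
      then have "\<tau> \<in> {0..c + h1}" "\<tau> \<in> {0..s}" "min c \<tau> = \<tau>" using \<tau> k1(1) c by (auto simp: a_def)
      then show ?thesis using near_S[OF \<eta>X before] proj_\<eta> \<tau>(1) by metis
    next
      case 2
      define \<tau>' where "\<tau>' = \<tau> - c + h2"
      have \<tau>': "\<tau>' \<in> {0..L - c + h2}" "\<tau>' \<in> {t..L - c + h2}" "max 0 (\<tau>' - h2) + c = \<tau>"
        using 2 \<tau> k2(1) u(3) by (auto simp: b_def \<tau>'_def)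
      then show ?thesis using near_S[OF \<kappa>X[OF \<tau>'(1)] after[OF \<tau>'(2)]] k2(5)[OF \<tau>'(1)] \<tau>(1) by simp
    next
      case 3
      have X: "\<gamma> a \<in> H.X" "\<gamma> b \<in> H.X" "\<gamma> \<tau> \<in> H.X" "proj u \<in> H.X" using \<gamma>X ab \<tau> proj_in[OF uX] by auto
      have "H.gdist (\<gamma> a) (\<gamma> b) = b - a" "H.gdist (\<gamma> \<tau>) (\<gamma> a) = \<tau> - a" "H.gdist (\<gamma> \<tau>) (\<gamma> b) = b - \<tau>"
        using geodesic_pathD(3)[OF g(1)] ab 3 \<tau> by auto
      then have "H.gdist (\<gamma> \<tau>) (proj u) \<le> 2 * r"
        using H.gdist_triangle[OF X(1,4,2)] H.gdist_triangle[OF X(3,1,4)] H.gdist_triangle[OF X(3,2,4)] ua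
          H.gdist_sym[of "proj u" "\<gamma> b"] by linarith
      then show ?thesis using u(1) \<tau>(1) by blast
    qed
  qed
  show thesis using that[OF S 1 2] .
qed

text \<open>Both sides are cut at their common point \<open>V\<close>, and pieces issuing from
  \<open>V\<close> have geodesic lifts that project exactly onto them. A point between
  \<open>P\<close> and \<open>V\<close> is handled in a triangle over \<open>P\<close>,
  \<open>V\<close>, \<open>Z\<close>, where only \<open>T3\<close> is approximated, at the cost of a
  further \<open>r\<close>. A point between \<open>V\<close> and \<open>Q\<close> is handled in a
  bigon.\<close>

lemma thin_two_sides_through_V:
  assumes thin: "thin_space X gdist r0" and r: "0 \<le> r0" "r0 < r"
    and T1: "geodesic H.X H.gdist P Q T1" and T2: "geodesic H.X H.gdist Q Z T2"
    and T3: "geodesic H.X H.gdist Z P T3" and V: "V \<in> T1" "V \<in> T2" and p: "p \<in> T1"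
  shows "\<exists>q\<in>T2 \<union> T3. H.gdist p q \<le> 2 * r"
proof -
  obtain T1a T1b where s1: "geodesic H.X H.gdist P V T1a" "geodesic H.X H.gdist V Q T1b" "T1 = T1a \<union> T1b"
    by (rule H.geodesic_split[OF T1 V(1)])
  obtain T2a T2b where s2: "geodesic H.X H.gdist Q V T2a" "geodesic H.X H.gdist V Z T2b" "T2 = T2a \<union> T2b"
    by (rule H.geodesic_split[OF T2 V(2)])
  show ?thesis
  proof (cases "p \<in> T1a")
    case True
    obtain Sa where Sa: "geodesic X gdist (lift V) (lift P) Sa" "proj ` Sa = T1a"
      by (rule lift_geodesic_from_V[OF geodesic_commute[THEN iffD1, OF s1(1)]])
    obtain Sb where Sb: "geodesic X gdist (lift V) (lift Z) Sb" "proj ` Sb = T2b"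
      by (rule lift_geodesic_from_V[OF s2(2)])
    obtain S3 where S3: "geodesic X gdist (lift Z) (lift P) S3"
      "\<And>z. z \<in> S3 \<Longrightarrow> \<exists>q\<in>T3. H.gdist (proj z) q \<le> r"
      using lifted_geodesic_near[OF thin r T3] by metis
    obtain z where z: "z \<in> Sa" "p = proj z" using True Sa(2) by blast
    obtain w where w: "w \<in> S3 \<union> Sb" "gdist z w \<le> r0"
      by (rule thin_spaceD[OF thin Sa(1) geodesic_commute[THEN iffD1, OF S3(1)]
            geodesic_commute[THEN iffD1, OF Sb(1)] z(1)])
    have X: "z \<in> X" "w \<in> X" using z w(1) geodesic_in(1)[OF Sa(1)] geodesic_in(1)[OF Sb(1)] geodesic_in(1)[OF S3(1)] by auto
    have zw: "H.gdist p (proj w) \<le> r0" using proj_lipschitz[OF X] w(2) z(2) by simp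
    show ?thesis
    proof (cases "w \<in> Sb")
      case True
      then have "proj w \<in> T2" using Sb(2) s2(3) by blast
      then show ?thesis using zw r by (intro bexI[of _ "proj w"]) auto
    next
      case False
      then obtain q where q: "q \<in> T3" "H.gdist (proj w) q \<le> r" using w(1) S3(2) by blast
      then have "H.gdist p q \<le> 2 * r"
        using H.gdist_triangle[OF proj_in[OF X(1)] proj_in[OF X(2)], of q] H.geodesic_in(1)[OF T3] zw z(2) r
        by fastforce
      then show ?thesis using q(1) by blast
    qed
  next
    case False
    obtain Sa where Sa: "geodesic X gdist (lift V) (lift Q) Sa" "proj ` Sa = T1b"
      by (rule lift_geodesic_from_V[OF s1(2)])
    obtain Sb where Sb: "geodesic X gdist (lift V) (lift Q) Sb" "proj ` Sb = T2a"
      by (rule lift_geodesic_from_V[OF geodesic_commute[THEN iffD1, OF s2(1)]])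
    obtain z where z: "z \<in> Sa" "p = proj z" using False p s1(3) Sa(2) by blast
    \<comment> \<open>The bigon is a triangle whose third side is the single point
      \<open>lift V\<close>.\<close>
    obtain w where w: "w \<in> Sb \<union> {lift V}" "gdist z w \<le> r0"
      by (rule thin_spaceD[OF thin Sa(1) geodesic_commute[THEN iffD1, OF Sb(1)]
            geodesic_singleton[OF lift_in[OF V_in]] z(1)])
    have X: "z \<in> X" "w \<in> X" using z w(1) geodesic_in(1)[OF Sa(1)] geodesic_in(1)[OF Sb(1)] lift_in[OF V_in] by auto
    have "H.gdist p (proj w) \<le> 2 * r" using proj_lipschitz[OF X] w(2) z(2) r by simp
    moreover have "proj w \<in> T2" using w(1) Sb(2) s2(3) proj_lift[OF V_in] V(2) by auto
    ultimately show ?thesis by blast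
  qed
qed

text \<open>The approximation by a lifted geodesic costs \<open>r\<close> from the lift to the side
  and \<open>2 * r\<close> from the side to the lift. The second price is paid only if the side of
  \<open>p\<close> is the only one through \<open>V\<close>, and then the other two sides lift
  exactly. Adding thinness in \<open>G\<close> gives \<open>3 * r\<close> in that case and at most
  \<open>2 * r\<close> in the others.\<close>

lemma thin_contraction:
  assumes thin: "thin_space X gdist r0" and r: "0 \<le> r0" "r0 < r"
  shows "thin_space H.X H.gdist (3 * r)"
proof (rule thin_spaceI)
  fix P Q Z T1 T2 T3 p
  assume T: "geodesic H.X H.gdist P Q T1" "geodesic H.X H.gdist Q Z T2" "geodesic H.X H.gdist Z P T3" "p \<in> T1"
  have r': "2 * r \<le> 3 * r" using r by simp
  have in_X: "T1 \<subseteq> H.X" "T2 \<subseteq> H.X" "T3 \<subseteq> H.X" using H.geodesic_in(1) T by blast+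
  consider "V \<notin> T1" | "V \<in> T1" "V \<in> T2" | "V \<in> T1" "V \<in> T3" | "V \<in> T1" "V \<notin> T2" "V \<notin> T3" by blast
  then show "\<exists>q\<in>T2 \<union> T3. H.gdist p q \<le> 3 * r"
  proof cases
    case 1
    obtain S1 where S1: "geodesic X gdist (lift P) (lift Q) S1" "proj ` S1 = T1"
      by (rule lift_geodesic_avoiding_V[OF T(1) 1])
    obtain S2 where S2: "geodesic X gdist (lift Q) (lift Z) S2" "\<And>z. z \<in> S2 \<Longrightarrow> \<exists>q\<in>T2. H.gdist (proj z) q \<le> r"
      using lifted_geodesic_near[OF thin r T(2)] by metis
    obtain S3 where S3: "geodesic X gdist (lift Z) (lift P) S3" "\<And>z. z \<in> S3 \<Longrightarrow> \<exists>q\<in>T3. H.gdist (proj z) q \<le> r"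
      using lifted_geodesic_near[OF thin r T(3)] by metis
    obtain z where z: "z \<in> S1" "p = proj z" using T(4) S1(2) by blast
    obtain w where w: "w \<in> S2 \<union> S3" "gdist z w \<le> r0"
      by (rule thin_spaceD[OF thin S1(1) S2(1) S3(1) z(1)])
    then obtain q where q: "q \<in> T2 \<union> T3" "H.gdist (proj w) q \<le> r" using S2(2) S3(2) by blast
    have X: "z \<in> X" "w \<in> X" "q \<in> H.X"
      using z(1) w(1) q(1) in_X geodesic_in(1)[OF S1(1)] geodesic_in(1)[OF S2(1)] geodesic_in(1)[OF S3(1)] by auto
    have "H.gdist p q \<le> 3 * r"
      using H.gdist_triangle[OF proj_in[OF X(1)] proj_in[OF X(2)] X(3)] proj_lipschitz[OF X(1,2)] w(2) q(2) z(2) r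
      by simp
    then show ?thesis using q(1) by blast
  next
    case 2
    then show ?thesis using thin_two_sides_through_V[OF thin r T(1-3) _ _ T(4)] r' by (meson order_trans)
  next
    case 3
    have "\<exists>q\<in>T3 \<union> T2. H.gdist p q \<le> 2 * r"
      using thin_two_sides_through_V[OF thin r T(1,3,2)[THEN geodesic_commute[THEN iffD1]] 3 T(4)] .
    then show ?thesis using r' by (meson Un_iff order_trans)
  next
    case 4
    obtain S1 where S1: "geodesic X gdist (lift P) (lift Q) S1" "\<And>p. p \<in> T1 \<Longrightarrow> \<exists>z\<in>S1. H.gdist p (proj z) \<le> 2 * r"
      using lifted_geodesic_near[OF thin r T(1)] by metis
    obtain S2 where S2: "geodesic X gdist (lift Q) (lift Z) S2" "proj ` S2 = T2"
      by (rule lift_geodesic_avoiding_V[OF T(2) 4(2)])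
    obtain S3 where S3: "geodesic X gdist (lift Z) (lift P) S3" "proj ` S3 = T3"
      by (rule lift_geodesic_avoiding_V[OF T(3) 4(3)])
    obtain z where z: "z \<in> S1" "H.gdist p (proj z) \<le> 2 * r" using S1(2) T(4) by blast
    obtain w where w: "w \<in> S2 \<union> S3" "gdist z w \<le> r0"
      by (rule thin_spaceD[OF thin S1(1) S2(1) S3(1) z(1)])
    have X: "z \<in> X" "w \<in> X" "p \<in> H.X"
      using z(1) w(1) T(4) in_X geodesic_in(1)[OF S1(1)] geodesic_in(1)[OF S2(1)] geodesic_in(1)[OF S3(1)] by auto
    have "H.gdist p (proj w) \<le> 3 * r"
      using H.gdist_triangle[OF X(3) proj_in[OF X(1)] proj_in[OF X(2)]] proj_lipschitz[OF X(1,2)] w(2) z(2) r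
      by simp
    moreover have "proj w \<in> T2 \<union> T3" using w(1) S2(2) S3(2) by blast
    ultimately show ?thesis by blast
  qed
qed

end

section \<open>The upper bound for small constants\<close>

lemma (in carrier_metric) sign_constant_on_geodesic:
  fixes F :: "'p \<Rightarrow> real"
  assumes lip: "\<And>w w'. w \<in> M \<Longrightarrow> w' \<in> M \<Longrightarrow> \<bar>F w - F w'\<bar> \<le> K * d w w'" and "0 \<le> K"
    and S: "geodesic M d x y S" and nz: "\<And>w. w \<in> S \<Longrightarrow> F w \<noteq> 0"
  shows "0 < F x \<longleftrightarrow> 0 < F y"
proof -
  obtain \<gamma> L where g: "geodesic_path M d \<gamma> 0 L" "\<gamma> 0 = x" "\<gamma> L = y" "S = \<gamma> ` {0..L}"
    by (rule geodesicE[OF S])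
  note gD = geodesic_pathD[OF g(1)]
  have "K-lipschitz_on {0..L} (\<lambda>s. F (\<gamma> s))"
  proof (intro lipschitz_onI \<open>0 \<le> K\<close>)
    fix s t assume "s \<in> {0..L}" "t \<in> {0..L}"
    then show "Real_Vector_Spaces.dist (F (\<gamma> s)) (F (\<gamma> t)) \<le> K * Real_Vector_Spaces.dist s t"
      using lip[of "\<gamma> s" "\<gamma> t"] gD(2) gD(3)[of s t] by (simp add: dist_real_def)
  qed
  then have cont: "continuous_on {0..L} (\<lambda>s. F (\<gamma> s))" by (rule lipschitz_on_continuous_on)
  have nz': "F (\<gamma> s) \<noteq> 0" if "0 \<le> s" "s \<le> L" for s using nz g(4) that by auto
  show ?thesis
  proof (rule ccontr)
    assume "\<not> ?thesis"
    then consider "0 \<le> F (\<gamma> 0)" "F (\<gamma> L) \<le> 0" | "F (\<gamma> 0) \<le> 0" "0 \<le> F (\<gamma> L)"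
      unfolding g(2,3) by linarith
    then have "\<exists>s\<ge>0. s \<le> L \<and> F (\<gamma> s) = 0"
      using IVT'[of "\<lambda>s. F (\<gamma> s)" 0 0 L, OF _ _ gD(1) cont]
        IVT2'[of "\<lambda>s. F (\<gamma> s)" L 0 0, OF _ _ gD(1) cont] by cases auto
    then show False using nz' by blast
  qed
qed

context graph
begin

text \<open>Otherwise the midpoint of the edge is at distance at least \<open>1/2\<close> from the other two sides of
  a triangle with corners \<open>a\<close>, \<open>b\<close>, \<open>x\<close>.\<close>

lemma on_edge_if_thin:
  assumes thin: "thin_space X gdist r" and r: "r < 1/2" and ab: "{a, b} \<in> E" and x: "x \<in> X"
    and diff: "\<bar>gdist x (vertex_point a) - gdist x (vertex_point b)\<bar> < 1"
  shows "\<exists>t. 0 \<le> t \<and> t \<le> 1 \<and> x = edge_point a b t"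
proof (rule ccontr)
  assume off: "\<nexists>t. 0 \<le> t \<and> t \<le> 1 \<and> x = edge_point a b t"
  have in_X: "vertex_point a \<in> X" "vertex_point b \<in> X" using edgeD[OF ab] vertex_point_in by auto
  obtain S T where S: "geodesic X gdist x (vertex_point a) S" and T: "geodesic X gdist (vertex_point b) x T"
    using ex_geodesic in_X x by meson
  have "geodesic X gdist (vertex_point a) (vertex_point b) (edge_point a b ` {0..1})"
    using geodesic_path_geodesic[OF geodesic_edge[OF ab, of 0 1]] edgeD(1)[OF ab]
    by (simp add: edge_point_0 edge_point_1)
  then obtain q where q: "q \<in> T \<union> S" "gdist (edge_point a b (1/2)) q \<le> r"
    by (rule thin_spaceD[OF thin _ T S, of _ "edge_point a b (1/2)"]) auto
  have qX: "q \<in> X" using q(1) geodesic_in(1)[OF S] geodesic_in(1)[OF T] by auto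
  let ?\<delta> = "gdist (edge_point a b (1/2)) q"
  have \<delta>: "?\<delta> < 1/2" "0 \<le> ?\<delta>" using q(2) r d_nonneg[OF edge_point_in[OF ab, of "1/2"] qX] by auto
  then have "q = edge_point a b (1/2 + ?\<delta>) \<or> q = edge_point a b (1/2 - ?\<delta>)"
    using near_interior_point[OF ab, of "1/2" q] qX by simp
  then obtain t where t: "0 < t" "t < 1" "q = edge_point a b t"
  proof (elim disjE)
    assume "q = edge_point a b (1/2 + ?\<delta>)" then show thesis by (rule that[rotated 2]) (use \<delta> in auto)
  next
    assume "q = edge_point a b (1/2 - ?\<delta>)" then show thesis by (rule that[rotated 2]) (use \<delta> in auto)
  qed
  have "gdist q x = min (t + gdist (vertex_point a) x) (1 - t + gdist (vertex_point b) x)"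
    unfolding t(3) using off t by (intro gdist_leave_edge ab x) auto
  \<comment> \<open>The point \<open>q\<close> is inside the edge and \<open>x\<close> is off it. If
    \<open>q\<close> lies on the geodesic from \<open>x\<close> to \<open>a\<close>, that geodesic
    arrives through \<open>b\<close>, so \<open>a\<close> is exactly 1 farther from \<open>x\<close>
    than \<open>b\<close>. The other alternative is symmetric.\<close>
  moreover have "gdist x q + t = gdist x (vertex_point a) \<or> (1 - t) + gdist q x = gdist (vertex_point b) x"
    using q(1) geodesic_dist_add[OF S, of q] geodesic_dist_add[OF T, of q] gdist_edge_ends[OF ab, of t] t by auto
  ultimately show False
    using diff t gdist_sym[of x q] gdist_sym[of x "vertex_point a"] gdist_sym[of x "vertex_point b"]
    by (auto simp: min_def split: if_splits)
qed

end

section \<open>A bounded region containing all points where the projection is not injective\<close>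

context contraction
begin

text \<open>Equivalently, the distances to \<open>A\<close> and \<open>B\<close> add up to at most
  2. The witness \<open>s\<close> is there for the diameter bound: core points with witnesses
  \<open>s\<close> and \<open>t\<close> are joined through \<open>A\<close> within
  \<open>s + t\<close> and through \<open>B\<close> within \<open>4 - (s + t)\<close>, and one of
  these is at most 2.\<close>

definition core :: "('a \<Rightarrow> real) \<Rightarrow> bool" where
  "core x \<longleftrightarrow> x \<in> X \<and> (\<exists>s. gdist x (vertex_point A) \<le> s \<and> gdist x (vertex_point B) \<le> 2 - s)"

lemma core_dist_le:
  assumes "core x" "core y"
  shows "gdist x y \<le> 2"
proof -
  obtain s t where s: "gdist x (vertex_point A) \<le> s" "gdist x (vertex_point B) \<le> 2 - s"
    and t: "gdist y (vertex_point A) \<le> t" "gdist y (vertex_point B) \<le> 2 - t"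
    using assms unfolding core_def by blast
  have X: "x \<in> X" "y \<in> X" using assms unfolding core_def by auto
  have "gdist x y \<le> s + t" "gdist x y \<le> (2 - s) + (2 - t)"
    using gdist_triangle[OF X(1) ends_in X(2), of A] gdist_triangle[OF X(1) ends_in X(2), of B] s t
      gdist_sym[of y] by auto
  then show ?thesis by linarith
qed

lemma core_contracted:
  assumes "on_contracted x"
  shows "core x"
  using assms gdist_edge_ends[OF AB] on_contracted_in[OF assms]
  unfolding on_contracted_def core_def by (auto intro!: exI[of _ "gdist x (vertex_point A)"])

text \<open>A point of a triangle over \<open>e\<close> at distance \<open>1 - b\<close> from one
  end of \<open>e\<close> is at most \<open>1 + b\<close> from the other end, by way of
  \<open>v\<close>.\<close>

lemma core_twins:
  assumes "x \<in> X" "twins y x"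
  shows "core x"
proof -
  obtain v C D b where *: "{C, D} = {A, B}" "{v, C} \<in> E" "{v, D} \<in> E" "0 < b" "b < 1" "x = edge_point v D b"
    using assms(2) unfolding twins_def by blast
  have v: "vertex_point v \<in> X" using edgeD[OF *(2)] vertex_point_in by auto
  have CD: "C \<in> {A, B}" "D \<in> {A, B}" using *(1) by auto
  have D: "gdist x (vertex_point D) \<le> 1 - b" using gdist_edge_ends(3)[OF *(3), of b] *(4-6) by simp
  have C: "gdist x (vertex_point C) \<le> 1 + b"
    using gdist_triangle[OF assms(1) v ends_in[OF CD(1)]] gdist_adjacent[OF *(2)]
      gdist_edge_ends(1)[OF *(3), of b] *(4-6) by simp
  consider "C = A" "D = B" | "C = B" "D = A" using *(1) by (auto simp: doubleton_eq_iff)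
  then show ?thesis
  proof cases
    case 1
    then show ?thesis using C D assms(1) unfolding core_def by (intro conjI exI[of _ "1 + b"]) auto
  next
    case 2
    then show ?thesis using C D assms(1) unfolding core_def by (intro conjI exI[of _ "1 - b"]) auto
  qed
qed

lemma not_core_unique:
  assumes "x \<in> X" "\<not> core x" "y \<in> X" "proj y = proj x"
  shows "y = x"
  using same_proj[OF assms(3,1,4)] core_contracted core_twins proj_eq_V_iff assms by metis

text \<open>Off the core, \<open>\<gamma> \<tau>\<close> is the only point above its image, and this
  image separates \<open>H\<close>. The function \<open>F\<close> expresses the separation: it
  vanishes only at \<open>\<gamma> \<tau>\<close> and changes sign there along the edge. If the
  other two sides missed \<open>\<gamma> \<tau>\<close>, the ends of the first side would carry
  equal signs, whereas the side itself passes from one sign to the other.\<close>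

lemma cut_point_on_other_sides:
  assumes thin: "thin_space H.X H.gdist r" and r: "r < 1/2"
    and g: "geodesic_path X gdist \<gamma> 0 L" and \<tau>: "0 < \<tau>" "\<tau> < L"
    and uv: "{u, v} \<in> E" "0 < s" "s < 1" "\<gamma> \<tau> = edge_point u v s" and core: "\<not> core (\<gamma> \<tau>)"
    and S2: "geodesic X gdist (\<gamma> L) z S2" and S3: "geodesic X gdist z (\<gamma> 0) S3"
  shows "\<gamma> \<tau> \<in> S2 \<union> S3"
proof (rule ccontr)
  assume notin: "\<gamma> \<tau> \<notin> S2 \<union> S3"
  note gD = geodesic_pathD[OF g]
  have \<gamma>X: "\<gamma> \<tau> \<in> X" using gD(2) \<tau> by simp
  have ne: "{u, v} \<noteq> {A, B}"
  proof
    assume "{u, v} = {A, B}"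
    then have "on_contracted (\<gamma> \<tau>)"
      using proj_eq_V_iff[OF \<gamma>X] proj_contracted' uv(4) by simp
    then show False using core core_contracted by blast
  qed
  define a b where "a = vertex_point (cv u)" and "b = vertex_point (cv v)"
  have H_edge: "{cv u, cv v} \<in> edges H" using contract_edge uv(1) ne by blast
  have ab: "a \<in> H.X" "b \<in> H.X" using H.edgeD[OF H_edge] H.vertex_point_in by (auto simp: a_def b_def)
  \<comment> \<open>At parameter \<open>t\<close> of the edge this equals
    \<open>2 * (t - s)\<close>. At a zero the two distances differ by
    \<open>|2 * s - 1| < 1\<close>, so \<open>on_edge_if_thin\<close> forces the image onto the
    edge.\<close>
  define F where "F = (\<lambda>w. H.gdist (proj w) a - H.gdist (proj w) b - (2 * s - 1))"
  have F_edge: "F w = 2 * (t - s)" if "proj w = edge_point (cv u) (cv v) t" "0 \<le> t" "t \<le> 1" for w t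
    using H.gdist_edge_ends(1,3)[OF H_edge that(2,3)] unfolding F_def a_def b_def that(1) by simp
  have F_zero: "w = \<gamma> \<tau>" if w: "w \<in> X" "F w = 0" for w
  proof -
    have "\<bar>H.gdist (proj w) a - H.gdist (proj w) b\<bar> < 1" using w(2) uv unfolding F_def by auto
    then obtain t where t: "0 \<le> t" "t \<le> 1" "proj w = edge_point (cv u) (cv v) t"
      using H.on_edge_if_thin[OF thin r H_edge proj_in[OF w(1)]] unfolding a_def b_def by blast
    then have "t = s" using F_edge[of w t] w(2) by simp
    then have "proj w = proj (\<gamma> \<tau>)" using t(3) uv(4) proj_edge[OF uv(1) ne] by simp
    then show ?thesis using not_core_unique[OF \<gamma>X core w(1)] by blast
  qed
  have F_lip: "\<bar>F w - F w'\<bar> \<le> 2 * gdist w w'" if "w \<in> X" "w' \<in> X" for w w'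
  proof -
    have "\<bar>H.gdist (proj w) c - H.gdist (proj w') c\<bar> \<le> gdist w w'" if "c \<in> H.X" for c
      using H.gdist_triangle[of "proj w" "proj w'" c] H.gdist_triangle[of "proj w'" "proj w" c]
        proj_in \<open>w \<in> X\<close> \<open>w' \<in> X\<close> that proj_lipschitz[of w w'] H.gdist_sym[of "proj w" "proj w'"] by auto
    from this[OF ab(1)] this[OF ab(2)] show ?thesis unfolding F_def by linarith
  qed
  have sign: "0 < F x \<longleftrightarrow> 0 < F y" if S: "geodesic X gdist x y S" "\<gamma> \<tau> \<notin> S" for x y S
  proof (rule sign_constant_on_geodesic[OF F_lip _ S(1)])
    fix w assume "w \<in> S"
    then show "F w \<noteq> 0" using F_zero S(2) geodesic_in(1)[OF S(1)] by blast
  qed auto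
  \<comment> \<open>Small enough for \<open>\<tau> - \<epsilon>\<close> and
    \<open>\<tau> + \<epsilon>\<close> to be inner parameters of the side and for the points there
    to lie inside the edge; halving makes these inequalities strict.\<close>
  define \<epsilon> where "\<epsilon> = min (min \<tau> (L - \<tau>)) (min s (1 - s)) / 2"
  have \<epsilon>: "0 < \<epsilon>" "\<epsilon> < \<tau>" "\<epsilon> < L - \<tau>" "\<epsilon> < s" "\<epsilon> < 1 - s" using \<tau> uv(2,3) by (auto simp: \<epsilon>_def)
  have notin': "\<gamma> \<tau> \<notin> \<gamma> ` T" if "T \<subseteq> {0..L} - {\<tau>}" for T
  proof
    assume "\<gamma> \<tau> \<in> \<gamma> ` T"
    then obtain t where t: "t \<in> T" "\<gamma> \<tau> = \<gamma> t" by blast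
    then have "gdist (\<gamma> \<tau>) (\<gamma> t) = \<bar>\<tau> - t\<bar>" using gD(3)[of \<tau> t] that \<tau> by auto
    then show False using t that d_refl[OF \<gamma>X] by auto
  qed
  have left: "0 < F (\<gamma> 0) \<longleftrightarrow> 0 < F (\<gamma> (\<tau> - \<epsilon>))"
    by (intro sign[OF geodesic_path_geodesic[OF geodesic_path_subset[OF g]]] notin') (use \<epsilon> \<tau> in auto)
  have right: "0 < F (\<gamma> (\<tau> + \<epsilon>)) \<longleftrightarrow> 0 < F (\<gamma> L)"
    by (intro sign[OF geodesic_path_geodesic[OF geodesic_path_subset[OF g]]] notin') (use \<epsilon> \<tau> in auto)
  have "0 < F (\<gamma> L) \<longleftrightarrow> 0 < F (\<gamma> 0)" using sign[OF S2] sign[OF S3] notin by auto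
  moreover have near: "\<gamma> t = edge_point u v (s + \<epsilon>) \<or> \<gamma> t = edge_point u v (s - \<epsilon>)"
    if t: "0 \<le> t" "t \<le> L" "\<bar>\<tau> - t\<bar> = \<epsilon>" for t
  proof -
    have "gdist (edge_point u v s) (\<gamma> t) = \<epsilon>" using gD(3)[of \<tau> t] t \<tau> uv(4) by simp
    then show ?thesis using near_interior_point[OF uv(1-3), of "\<gamma> t"] gD(2) t \<epsilon> by simp
  qed
  have F_near: "F (edge_point u v (s + \<epsilon>)) = 2 * \<epsilon>" "F (edge_point u v (s - \<epsilon>)) = - 2 * \<epsilon>"
    using F_edge[OF proj_edge[OF uv(1) ne], of "s + \<epsilon>"] F_edge[OF proj_edge[OF uv(1) ne], of "s - \<epsilon>"]
      \<epsilon> uv(2,3) by auto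
  have "\<gamma> (\<tau> - \<epsilon>) \<noteq> \<gamma> (\<tau> + \<epsilon>)"
  proof
    assume *: "\<gamma> (\<tau> - \<epsilon>) = \<gamma> (\<tau> + \<epsilon>)"
    have "gdist (\<gamma> (\<tau> - \<epsilon>)) (\<gamma> (\<tau> + \<epsilon>)) = 2 * \<epsilon>" using gD(3)[of "\<tau> - \<epsilon>" "\<tau> + \<epsilon>"] \<epsilon> \<tau> by simp
    then show False using * d_refl[of "\<gamma> (\<tau> + \<epsilon>)"] gD(2)[of "\<tau> + \<epsilon>"] \<epsilon> \<tau> by simp
  qed
  then have "(0 < F (\<gamma> (\<tau> - \<epsilon>))) \<noteq> (0 < F (\<gamma> (\<tau> + \<epsilon>)))"
    using near[of "\<tau> - \<epsilon>"] near[of "\<tau> + \<epsilon>"] F_near \<epsilon> \<tau> by auto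
  ultimately show False using left right by blast
qed

text \<open>If \<open>p\<close> is farther than \<open>1 + \<theta>\<close> from the other sides,
  then every non-vertex of its side within \<open>1 + \<theta>\<close> of \<open>p\<close> is in the
  core. Two such points, one in each direction and at least \<open>1 + \<theta>/2\<close> from
  \<open>p\<close>, would be more than 2 apart.\<close>

lemma thin_if_contraction_thin_small:
  assumes thin: "thin_space H.X H.gdist r" and r: "r < 1/2" and "0 < \<eta>"
  shows "thin_space X gdist (1 + \<eta>)"
proof -
  \<comment> \<open>The cap keeps the two candidate points in each direction, which are
    \<open>\<theta>/2\<close> apart, at distance less than 1.\<close>
  define \<theta> where "\<theta> = min \<eta> (1/2)"
  have \<theta>: "0 < \<theta>" "\<theta> \<le> 1/2" "\<theta> \<le> \<eta>" using \<open>0 < \<eta>\<close> by (auto simp: \<theta>_def)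
  have "thin_space X gdist (1 + \<theta>)"
  proof (rule thin_spaceI, rule ccontr)
    fix x y z S1 S2 S3 p
    assume S: "geodesic X gdist x y S1" "geodesic X gdist y z S2" "geodesic X gdist z x S3" "p \<in> S1"
      and "\<not> (\<exists>q\<in>S2 \<union> S3. gdist p q \<le> 1 + \<theta>)"
    then have far: "1 + \<theta> < gdist p q" if "q \<in> S2 \<union> S3" for q using that by force
    obtain \<gamma> L where g: "geodesic_path X gdist \<gamma> 0 L" "\<gamma> 0 = x" "\<gamma> L = y" "S1 = \<gamma> ` {0..L}"
      by (rule geodesicE[OF S(1)])
    note gD = geodesic_pathD[OF g(1)]
    obtain t0 where t0: "p = \<gamma> t0" "0 \<le> t0" "t0 \<le> L" using S(4) g(4) by auto
    have "1 + \<theta> < gdist p (\<gamma> 0)" "1 + \<theta> < gdist p (\<gamma> L)"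
      using far geodesic_in(2)[OF S(2)] geodesic_in(3)[OF S(3)] g(2,3) by auto
    then have t0': "1 + \<theta> < t0" "1 + \<theta> < L - t0"
      using gD(3)[of t0 0] gD(3)[of t0 L] t0 gD(1) by auto
    have core: "core (\<gamma> t)" if t: "\<bar>t - t0\<bar> \<le> 1 + \<theta>" and nv: "\<gamma> t \<notin> vertex_point ` verts G" for t
    proof (rule ccontr)
      assume nc: "\<not> core (\<gamma> t)"
      have t': "0 < t" "t < L" using t t0' by auto
      have "\<gamma> t \<in> X" using gD(2) t' by simp
      then obtain u v s where uv: "{u, v} \<in> E" "0 < s" "s < 1" "\<gamma> t = edge_point u v s"
        using nv by (cases rule: point_cases) auto
      have "\<gamma> t \<in> S2 \<union> S3"
        using cut_point_on_other_sides[OF thin r g(1) t' uv nc] S(2,3) g(2,3) by blast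
      then show False using far gD(3)[of t0 t] t t' t0 by fastforce
    qed
    \<comment> \<open>\<open>cut_point_on_other_sides\<close> concerns interior points of edges, so
      a vertex has to be dodged: distinct vertices are at least 1 apart.\<close>
    have nonvertex: "\<exists>t\<in>{t1, t2}. \<gamma> t \<notin> vertex_point ` verts G"
      if "0 \<le> t1" "t1 < t2" "t2 \<le> L" "t2 - t1 < 1" for t1 t2
    proof (rule ccontr)
      assume "\<not> ?thesis"
      then obtain u v where uv: "u \<in> verts G" "v \<in> verts G" "\<gamma> t1 = vertex_point u" "\<gamma> t2 = vertex_point v" by auto
      have "gdist (\<gamma> t1) (\<gamma> t2) = t2 - t1" using gD(3)[of t1 t2] that by simp
      then show False
        using gdist_vertices_ge[OF uv(1,2)] uv that d_refl[OF vertex_point_in[OF uv(1)]] by (cases "u = v") auto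
    qed
    obtain t1 where t1: "t1 \<in> {t0 - (1 + \<theta>), t0 - (1 + \<theta>/2)}" "\<gamma> t1 \<notin> vertex_point ` verts G"
      using nonvertex[of "t0 - (1 + \<theta>)" "t0 - (1 + \<theta>/2)"] t0 t0' \<theta> by auto
    obtain t2 where t2: "t2 \<in> {t0 + (1 + \<theta>/2), t0 + (1 + \<theta>)}" "\<gamma> t2 \<notin> vertex_point ` verts G"
      using nonvertex[of "t0 + (1 + \<theta>/2)" "t0 + (1 + \<theta>)"] t0 t0' \<theta> by auto
    have "gdist (\<gamma> t1) (\<gamma> t2) \<le> 2"
      using t1 t2 \<theta> by (intro core_dist_le core) auto
    moreover have "gdist (\<gamma> t1) (\<gamma> t2) = t2 - t1" using gD(3)[of t1 t2] t1 t2 t0 t0' \<theta> by auto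
    ultimately show False using t1(1) t2(1) \<theta> by auto
  qed
  then show ?thesis using \<theta>(3) by (auto intro: thin_space_mono)
qed

end

section \<open>The upper bound for large constants\<close>

context graph
begin

lemma point_on_edge:
  assumes "{u, v} \<in> E" "x \<in> X" "x u * x v \<noteq> 0"
  shows "\<exists>t. 0 \<le> t \<and> t \<le> 1 \<and> x = edge_point u v t"
  using assms(2)
proof (cases rule: point_cases)
  case (vertex w)
  then show ?thesis using assms(3) edgeD(1)[OF assms(1)] by (auto simp: vertex_point_apply split: if_splits)
next
  case (edge p q t)
  then have "u = p \<and> v = q \<or> u = q \<and> v = p"
    using assms(3) edgeD(1)[OF assms(1)] by (auto simp: edge_point_apply split: if_splits)
  then show ?thesis
  proof
    assume "u = p \<and> v = q" then show ?thesis using edge by (intro exI[of _ t]) auto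
  next
    assume "u = q \<and> v = p" then show ?thesis
      using edge edge_point_swap[of p q t] edgeD(1)[OF edge(1)] by (intro exI[of _ "1 - t"]) auto
  qed
qed

lemma point_eq_vertex:
  assumes "x \<in> X" "x u = 1"
  shows "x = vertex_point u"
  using assms(1)
proof (cases rule: point_cases)
  case (vertex w)
  then show ?thesis using assms(2) by (auto simp: vertex_point_apply split: if_splits)
next
  case (edge p q t)
  then show ?thesis using assms(2) by (auto simp: edge_point_apply split: if_splits)
qed

lemma continuous_on_coord:
  assumes g: "geodesic_path X gdist \<gamma> a b"
  shows "continuous_on {a..b} (\<lambda>s. \<gamma> s w)"
proof (rule lipschitz_on_continuous_on)
  show "1-lipschitz_on {a..b} (\<lambda>s. \<gamma> s w)"
  proof (rule lipschitz_onI)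
    fix s t assume st: "s \<in> {a..b}" "t \<in> {a..b}"
    then have "\<gamma> s \<in> X" "\<gamma> t \<in> X" "gdist (\<gamma> s) (\<gamma> t) = \<bar>s - t\<bar>"
      using geodesic_pathD(2,3)[OF g] by auto
    then show "Real_Vector_Spaces.dist (\<gamma> s w) (\<gamma> t w) \<le> 1 * Real_Vector_Spaces.dist s t"
      using coord_lipschitz[of "\<gamma> s" "\<gamma> t" w] by (simp add: dist_real_def)
  qed simp
qed

text \<open>The product of the coordinates at \<open>u\<close> and \<open>v\<close> is nonzero
  exactly inside the edge. At its first zero the sum of both coordinates is still 1 by continuity,
  so one of them is 1 and the geodesic is at that vertex.\<close>

lemma geodesic_leaves_edge_through_end:
  assumes g: "geodesic_path X gdist \<gamma> a b" and uv: "{u, v} \<in> E"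
    and st: "a \<le> s" "s < t" "t \<le> b"
    and \<gamma>s: "\<gamma> s = edge_point u v \<sigma>" "0 < \<sigma>" "\<sigma> < 1"
    and \<gamma>t: "\<And>\<tau>. 0 \<le> \<tau> \<Longrightarrow> \<tau> \<le> 1 \<Longrightarrow> \<gamma> t \<noteq> edge_point u v \<tau>"
  obtains \<tau> w where "s < \<tau>" "\<tau> < t" "w \<in> {u, v}" "\<gamma> \<tau> = vertex_point w"
proof -
  note gD = geodesic_pathD[OF g] and u_neq_v = edgeD(1)[OF uv]
  have \<gamma>X: "\<gamma> \<tau> \<in> X" if "\<tau> \<in> {s..t}" for \<tau> using gD(2)[of \<tau>] that st by auto
  have g': "geodesic_path X gdist \<gamma> s t" using geodesic_path_subset[OF g] st by simp
  define Z where "Z = {\<tau>\<in>{s..t}. \<gamma> \<tau> u * \<gamma> \<tau> v = 0}"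
  have "compact Z"
  proof -
    have "closed Z" unfolding Z_def
      by (intro continuous_closed_preimage_constant continuous_on_mult continuous_on_coord[OF g']) auto
    moreover have "bounded Z" by (rule bounded_subset[of "{s..t}"]) (auto simp: Z_def)
    ultimately show ?thesis by (simp add: compact_eq_bounded_closed)
  qed
  moreover have "t \<in> Z" using point_on_edge[OF uv \<gamma>X[of t]] \<gamma>t st unfolding Z_def by force
  ultimately obtain \<tau> where \<tau>: "\<tau> \<in> Z" "\<And>\<tau>'. \<tau>' \<in> Z \<Longrightarrow> \<tau> \<le> \<tau>'"
    using compact_attains_inf[of Z] by blast
  have \<tau>_in: "\<tau> \<in> {s..t}" using \<tau>(1) by (simp add: Z_def)
  have "\<tau> \<noteq> s" using \<tau>(1) \<gamma>s u_neq_v unfolding Z_def by (auto simp: edge_point_apply)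
  then have "s < \<tau>" using \<tau>_in by auto
  have sum: "\<gamma> \<tau>' u + \<gamma> \<tau>' v = 1" if \<tau>': "\<tau>' \<in> {s..<\<tau>}" for \<tau>'
  proof -
    have "\<gamma> \<tau>' u * \<gamma> \<tau>' v \<noteq> 0" "\<tau>' \<in> {s..t}" using \<tau>(2)[of \<tau>'] \<tau>' \<tau>_in unfolding Z_def by auto
    then obtain k where "\<gamma> \<tau>' = edge_point u v k" using point_on_edge[OF uv \<gamma>X] by blast
    then show ?thesis using u_neq_v by (simp add: edge_point_apply)
  qed
  have "\<gamma> \<tau> u + \<gamma> \<tau> v = 1"
  proof (rule ccontr)
    assume neq: "\<gamma> \<tau> u + \<gamma> \<tau> v \<noteq> 1"
    define e where "e = \<bar>\<gamma> \<tau> u + \<gamma> \<tau> v - 1\<bar>"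
    have e: "0 < e" using neq by (simp add: e_def)
    define \<tau>' where "\<tau>' = max s (\<tau> - e/4)"
    have \<tau>': "\<tau>' \<in> {s..<\<tau>}" "\<tau> - \<tau>' \<le> e/4"
      using e \<open>s < \<tau>\<close> by (auto simp: \<tau>'_def max_def field_simps)
    have "gdist (\<gamma> \<tau>) (\<gamma> \<tau>') = \<tau> - \<tau>'" using geodesic_pathD(3)[OF g', of \<tau> \<tau>'] \<tau>' \<tau>_in by auto
    then have "\<bar>\<gamma> \<tau> w - \<gamma> \<tau>' w\<bar> \<le> e/4" for w
      using coord_lipschitz[of "\<gamma> \<tau>" "\<gamma> \<tau>'" w] \<gamma>X[of \<tau>] \<gamma>X[of \<tau>'] \<tau>' \<tau>_in by auto
    from this[of u] this[of v]
    have "\<bar>(\<gamma> \<tau> u - \<gamma> \<tau>' u) + (\<gamma> \<tau> v - \<gamma> \<tau>' v)\<bar> \<le> e/4 + e/4"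
      by (intro order_trans[OF abs_triangle_ineq] add_mono)
    moreover have "(\<gamma> \<tau> u - \<gamma> \<tau>' u) + (\<gamma> \<tau> v - \<gamma> \<tau>' v) = \<gamma> \<tau> u + \<gamma> \<tau> v - 1"
      using sum[OF \<tau>'(1)] by simp
    ultimately show False using e by (simp add: e_def)
  qed
  moreover have "\<gamma> \<tau> u * \<gamma> \<tau> v = 0" using \<tau>(1) by (simp add: Z_def)
  ultimately have "\<gamma> \<tau> u = 1 \<or> \<gamma> \<tau> v = 1" by auto
  then obtain w where w: "w \<in> {u, v}" "\<gamma> \<tau> w = 1" by blast
  then have \<gamma>\<tau>: "\<gamma> \<tau> = vertex_point w" using point_eq_vertex[OF \<gamma>X[OF \<tau>_in]] by simp
  have "\<tau> \<noteq> t"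
    using \<gamma>\<tau> w(1) \<gamma>t[of 0] \<gamma>t[of 1] u_neq_v by (auto simp: edge_point_0 edge_point_1)
  then show thesis using that[of \<tau> w] \<open>s < \<tau>\<close> \<tau>_in w(1) \<gamma>\<tau> by auto
qed

end

section \<open>Projected geodesics stay near geodesics of the contracted graph\<close>

context contraction
begin

text \<open>The projection is 1-Lipschitz; if the ends keep their distance, no part in between can
  have been shortened.\<close>

lemma geodesic_path_proj:
  assumes g: "geodesic_path X gdist \<gamma> a b" and eq: "H.gdist (proj (\<gamma> a)) (proj (\<gamma> b)) = b - a"
  shows "geodesic_path H.X H.gdist (\<lambda>s. proj (\<gamma> s)) a b"
proof -
  note gD = geodesic_pathD[OF g]
  have le: "H.gdist (proj (\<gamma> s)) (proj (\<gamma> t)) \<le> \<bar>s - t\<bar>" if "s \<in> {a..b}" "t \<in> {a..b}" for s t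
    using proj_lipschitz[of "\<gamma> s" "\<gamma> t"] gD(2) gD(3)[of s t] that by simp
  have X: "proj (\<gamma> s) \<in> H.X" if "s \<in> {a..b}" for s using gD(2) that by (simp add: proj_in)
  have eq': "H.gdist (proj (\<gamma> s)) (proj (\<gamma> t)) = t - s" if st: "s \<in> {a..b}" "t \<in> {a..b}" "s \<le> t" for s t
  proof -
    have ab: "a \<in> {a..b}" "b \<in> {a..b}" using gD(1) by auto
    have "b - a \<le> (s - a) + H.gdist (proj (\<gamma> s)) (proj (\<gamma> t)) + (b - t)"
      using H.gdist_triangle[OF X[OF ab(1)] X[OF st(1)] X[OF ab(2)]]
        H.gdist_triangle[OF X[OF st(1)] X[OF st(2)] X[OF ab(2)]]
        le[OF ab(1) st(1)] le[OF st(2) ab(2)] st eq by auto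
    then show ?thesis using le[OF st(1,2)] st(3) by auto
  qed
  have "H.gdist (proj (\<gamma> s)) (proj (\<gamma> t)) = \<bar>s - t\<bar>" if "s \<in> {a..b}" "t \<in> {a..b}" for s t
    using eq'[of s t] eq'[of t s] that H.gdist_sym[of "proj (\<gamma> s)" "proj (\<gamma> t)"] by (cases "s \<le> t") auto
  then show ?thesis unfolding geodesic_path_def using gD(1) X by auto
qed

lemma contracted_interior:
  assumes "on_contracted z" "z \<notin> vertex_point ` {A, B}"
  obtains \<epsilon> where "0 < \<epsilon>" "\<And>w. w \<in> X \<Longrightarrow> gdist z w < \<epsilon> \<Longrightarrow> on_contracted w"
proof -
  obtain t where t: "0 \<le> t" "t \<le> 1" "z = edge_point A B t" using assms(1) unfolding on_contracted_def by blast
  have "t \<noteq> 0" "t \<noteq> 1" using assms(2) t(3) edge_point_0[OF A_neq_B] edge_point_1[of A B] by auto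
  then have t': "0 < t" "t < 1" using t by auto
  have "on_contracted w" if w: "w \<in> X" "gdist z w < min t (1 - t)" for w
  proof -
    have "0 \<le> gdist z w" using d_nonneg on_contracted_in assms(1) w(1) by auto
    moreover have "w = edge_point A B (t + gdist z w) \<or> w = edge_point A B (t - gdist z w)"
      using near_interior_point[OF AB t' w(1)] w(2) t(3) by simp
    ultimately show ?thesis using w(2) unfolding on_contracted_def
      by (elim disjE) (intro exI conjI; (assumption | simp))+
  qed
  then show thesis using that[of "min t (1 - t)"] t' by auto
qed

lemma near_end_edge:
  assumes "q \<in> X" "\<not> on_contracted q" "C \<in> {A, B}" "gdist q (vertex_point C) < 1"
  obtains w \<delta> where "{C, w} \<in> E" "0 < \<delta>" "\<delta> < 1" "q = edge_point C w \<delta>" "\<delta> = gdist q (vertex_point C)"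
  using assms(1)
proof (cases rule: point_cases)
  case (vertex v)
  then have "v = C" using coord_lipschitz[OF assms(1) ends_in[OF assms(3)], of C] assms(4)
    by (auto simp: vertex_point_apply split: if_splits)
  then show ?thesis using assms(2,3) vertex by auto
next
  case (edge u v t)
  have "C = u \<or> C = v" using coord_lipschitz[OF assms(1) ends_in[OF assms(3)], of C] assms(4) edge
    by (auto simp: vertex_point_apply edge_point_apply split: if_splits)
  then show ?thesis
  proof
    assume C: "C = u"
    have "t = gdist q (vertex_point C)"
      using gdist_edge_ends(1)[OF edge(1), of t] edge(2,3) C unfolding edge(4) by simp
    from that[OF _ edge(2,3) _ this] show ?thesis using edge(1,4) C by blast
  next
    assume C: "C = v"
    have d: "1 - t = gdist q (vertex_point C)"
      using gdist_edge_ends(3)[OF edge(1), of t] edge(2,3) C unfolding edge(4) by simp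
    have "q = edge_point C u (1 - t)"
      unfolding edge(4) C by (rule edge_point_swap[OF edgeD(1)[OF edge(1)]])
    moreover have "{C, u} \<in> E" "0 < 1 - t" "1 - t < 1" using C edgeD(4)[OF edge(1)] edge(2,3) by auto
    ultimately show ?thesis using that[OF _ _ _ _ d] by blast
  qed
qed

text \<open>The break point is a common neighbour of \<open>A\<close> and \<open>B\<close> if the geodesic visits one. Otherwise the
  excess of its length over that of a shortest path through \<open>V\<close> is split evenly.\<close>

lemma geodesic_proj_break:
  assumes g: "geodesic_path X gdist \<gamma> a b"
    and inner: "\<forall>s. a < s \<longrightarrow> s < b \<longrightarrow> \<not> on_contracted (\<gamma> s)"
    and outer: "a < b \<longrightarrow> (\<forall>s\<in>{a, b}. on_contracted (\<gamma> s) \<longrightarrow> \<gamma> s \<in> vertex_point ` {A, B})"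
  obtains c where "c \<in> {a..b}" "geodesic_path H.X H.gdist (\<lambda>s. proj (\<gamma> s)) a c"
    "geodesic_path H.X H.gdist (\<lambda>s. proj (\<gamma> s)) c b"
proof -
  note inner = inner[rule_format] and outer = outer[rule_format]
  note gD = geodesic_pathD[OF g]
  have \<gamma>X: "\<gamma> s \<in> X" if "s \<in> {a..b}" for s using gD(2) that by simp
  note found = that
  have break: thesis if c: "c \<in> {a..b}" "H.gdist (proj (\<gamma> a)) (proj (\<gamma> c)) = c - a"
    "H.gdist (proj (\<gamma> c)) (proj (\<gamma> b)) = b - c" for c
    using found[OF c(1)] geodesic_path_proj[OF geodesic_path_subset[OF g] c(2)]
      geodesic_path_proj[OF geodesic_path_subset[OF g] c(3)] c(1) by auto
  consider (trivial) "a = b"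
    | (visit) c v where "a < b" "c \<in> {a..b}" "\<gamma> c = vertex_point v" "{v, A} \<in> E" "{v, B} \<in> E"
    | (avoid) "a < b" "\<And>c v. c \<in> {a..b} \<Longrightarrow> {v, A} \<in> E \<Longrightarrow> {v, B} \<in> E \<Longrightarrow> \<gamma> c \<noteq> vertex_point v"
    using gD(1) by fastforce
  then show thesis
  proof cases
    case trivial
    then show ?thesis using break[of a] \<gamma>X[of a] H.d_refl[OF proj_in] by auto
  next
    case (visit c v)
    have "H.gdist (proj (\<gamma> c)) (proj (\<gamma> s)) = \<bar>c - s\<bar>" if "s \<in> {a, b}" for s
    proof -
      have s: "s \<in> {a..b}" using that visit(1) by auto
      show ?thesis
        using gdist_common_neighbour[OF visit(4,5) \<gamma>X[OF s]] outer[OF visit(1) that] visit(2,3) s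
          gD(3)[of c s] by auto
    qed
    from this[of a] this[of b] show ?thesis
      using break[OF visit(2)] visit(2) H.gdist_sym[of "proj (\<gamma> a)"] by auto
  next
    case avoid
    \<comment> \<open>The way from inside \<open>[v,C]\<close> to inside \<open>[v,D]\<close> leads
      through \<open>v\<close> or \<open>C\<close>. Here \<open>C\<close> is an end of
      \<open>e\<close>, excluded by \<open>inner\<close>, and \<open>v\<close> is a common
      neighbour, excluded in this case.\<close>
    have no_twins: "\<not> twins (\<gamma> s) (\<gamma> t)" if st: "a \<le> s" "s < t" "t \<le> b" for s t
    proof
      assume "twins (\<gamma> s) (\<gamma> t)"
      then obtain v C D k l where *: "{C, D} = {A, B}" "{v, C} \<in> E" "{v, D} \<in> E"
          "0 < k" "k < 1" "0 < l" "l < 1" "\<gamma> s = edge_point v C k" "\<gamma> t = edge_point v D l"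
        unfolding twins_def by blast
      have "edge_point v D l \<noteq> edge_point v C \<tau>" for \<tau>
      proof
        assume "edge_point v D l = edge_point v C \<tau>"
        from edge_point_eq_edge_point[OF this edgeD(1)[OF *(3)] edgeD(1)[OF *(2)] *(6,7)]
        show False using *(1) A_neq_B edgeD(1)[OF *(2)] by (auto simp: doubleton_eq_iff)
      qed
      then obtain \<tau> w where \<tau>: "s < \<tau>" "\<tau> < t" "w \<in> {v, C}" "\<gamma> \<tau> = vertex_point w"
        using geodesic_leaves_edge_through_end[OF g *(2) st *(8,4,5)] unfolding *(9) by metis
      have \<tau>': "a < \<tau>" "\<tau> < b" using \<tau> st by auto
      have "{v, A} \<in> E" "{v, B} \<in> E" "C \<in> {A, B}" using *(1-3) by (auto simp: doubleton_eq_iff)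
      moreover have "w \<noteq> C" using inner[OF \<tau>'] \<tau>(4) \<open>C \<in> {A, B}\<close> by auto
      ultimately show False using avoid(2)[of \<tau> v] \<tau> \<tau>' by auto
    qed
    let ?x = "\<gamma> a" and ?y = "\<gamma> b"
    have xy: "?x \<in> X" "?y \<in> X" using \<gamma>X avoid(1) by auto
    have dist_xy: "gdist ?x ?y = b - a" using gD(3)[of a b] avoid(1) by simp
    consider (direct) "H.gdist (proj ?x) (proj ?y) = b - a"
      | (detour) "H.gdist (proj ?x) (proj ?y) = radius ?x + radius ?y" "radius ?x + radius ?y < b - a"
      using contracted_distance_cases[OF xy] no_twins[of a b] avoid(1) proj_lipschitz[OF xy] dist_xy
      by (metis order_refl not_less_iff_gr_or_eq linorder_not_less)
    then show ?thesis
    proof cases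
      case direct
      then show ?thesis using break[of b] avoid(1) H.d_refl[OF proj_in[OF xy(2)]] by simp
    next
      case detour
      \<comment> \<open>The excess over the route through \<open>V\<close>, at most 1 by
        \<open>gdist_le_radius_add\<close>. With \<open>c\<close> as below, each half of the
        geodesic is longer than the radius of its outer end by \<open>\<epsilon>/2\<close>.\<close>
      define \<epsilon> where "\<epsilon> = (b - a) - (radius ?x + radius ?y)"
      have \<epsilon>: "0 < \<epsilon>" "\<epsilon> \<le> 1" using detour(2) gdist_le_radius_add[OF xy] dist_xy by (auto simp: \<epsilon>_def)
      define c where "c = a + radius ?x + \<epsilon>/2"
      have c: "c - a = radius ?x + \<epsilon>/2" "b - c = radius ?y + \<epsilon>/2"
        unfolding c_def \<epsilon>_def by (simp_all add: field_simps)
      have rad: "0 \<le> radius ?x" "0 \<le> radius ?y" using radius_nonneg xy by auto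
      have cab: "a < c" "c < b" "c \<in> {a..b}" using c rad \<epsilon> by auto
      let ?q = "\<gamma> c"
      have q: "?q \<in> X" "\<not> on_contracted ?q" using \<gamma>X inner cab by auto
      \<comment> \<open>With this radius at the break point, the route through \<open>V\<close> is
        no shorter than either half, so both halves keep their lengths. Otherwise the break point
        would lie on an edge at some end \<open>C\<close> of \<open>e\<close>, closer to
        \<open>C\<close> than to either end of the geodesic, and one direction of the geodesic would
        run into \<open>C\<close>, against \<open>inner\<close>.\<close>
      have far: "\<epsilon>/2 \<le> radius ?q"
      proof (rule ccontr)
        assume "\<not> ?thesis"
        then obtain C where C: "C \<in> {A, B}" "gdist ?q (vertex_point C) < \<epsilon>/2"
          using gdist_end_le_radius[OF q] by force
        have lt: "gdist ?q (vertex_point C) < 1" using C(2) \<epsilon>(2) by simp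
        obtain w \<delta> where \<delta>: "{C, w} \<in> E" "0 < \<delta>" "\<delta> < 1" "?q = edge_point C w \<delta>"
            "\<delta> = gdist ?q (vertex_point C)"
          by (rule near_end_edge[OF q C(1) lt], rule that)
        have \<delta>': "\<delta> < c - a" "\<delta> < b - c" "\<delta> < 1/2" using C(2) \<delta>(5) c rad \<epsilon> by auto
        have pos: "0 < gdist (\<gamma> s) (vertex_point C)" if "a < s" "s < b" for s
        proof -
          have "\<gamma> s \<noteq> vertex_point C" using inner[OF that] C(1) by auto
          then show ?thesis
            using d_zero[of "\<gamma> s" "vertex_point C"] d_nonneg[of "\<gamma> s" "vertex_point C"] \<gamma>X[of s] that ends_in[OF C(1)]
            by fastforce
        qed
        \<comment> \<open>The approach stops at distance \<open>\<mu>\<close> from \<open>C\<close>,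
          because \<open>near_interior_point\<close> covers only distances below
          \<open>\<delta>\<close>. One of the points \<open>\<gamma> (c - \<delta>)\<close>,
          \<open>\<gamma> (c + \<delta>)\<close> is then within \<open>2 * \<mu>\<close> of
          \<open>C\<close>; taking a third of the smaller of their distances to \<open>C\<close>
          makes this a contradiction.\<close>
        define \<mu> where "\<mu> = min (\<delta>/2) (min (gdist (\<gamma> (c - \<delta>)) (vertex_point C)) (gdist (\<gamma> (c + \<delta>)) (vertex_point C)) / 3)"
        have \<mu>: "0 < \<mu>" "\<mu> < \<delta>" "3 * \<mu> \<le> gdist (\<gamma> (c - \<delta>)) (vertex_point C)"
          "3 * \<mu> \<le> gdist (\<gamma> (c + \<delta>)) (vertex_point C)"
          using pos[of "c - \<delta>"] pos[of "c + \<delta>"] \<delta>(2) \<delta>'(1,2) cab(1,2) unfolding \<mu>_def by linarith+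
        define \<kappa> where "\<kappa> = \<delta> - \<mu>"
        have \<kappa>: "0 < \<kappa>" "\<kappa> < \<delta>" using \<mu> by (auto simp: \<kappa>_def)
        have near: "\<gamma> s = edge_point C w (\<delta> + \<kappa>) \<or> \<gamma> s = edge_point C w (\<delta> - \<kappa>)" if s: "\<bar>c - s\<bar> = \<kappa>" for s
        proof -
          have "s \<in> {a..b}" using s \<kappa> \<delta>' cab by auto
          then have "gdist (edge_point C w \<delta>) (\<gamma> s) = \<kappa>" using gD(3)[of c s] cab s \<delta>(4) by simp
          then show ?thesis using near_interior_point[OF \<delta>(1-3) \<gamma>X[OF \<open>s \<in> {a..b}\<close>]] \<kappa> \<delta>' by simp
        qed
        have "\<gamma> (c - \<kappa>) \<noteq> \<gamma> (c + \<kappa>)"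
        proof
          assume *: "\<gamma> (c - \<kappa>) = \<gamma> (c + \<kappa>)"
          have "gdist (\<gamma> (c - \<kappa>)) (\<gamma> (c + \<kappa>)) = 2 * \<kappa>" using gD(3)[of "c - \<kappa>" "c + \<kappa>"] \<kappa> \<delta>' cab by simp
          then show False using * d_refl[OF \<gamma>X[of "c + \<kappa>"]] \<kappa> \<delta>' cab by auto
        qed
        then have "\<gamma> (c - \<kappa>) = edge_point C w \<mu> \<or> \<gamma> (c + \<kappa>) = edge_point C w \<mu>"
          using near[of "c - \<kappa>"] near[of "c + \<kappa>"] \<kappa>(1) by (auto simp: \<kappa>_def)
        then have "gdist (\<gamma> (c - \<kappa>)) (vertex_point C) = \<mu> \<or> gdist (\<gamma> (c + \<kappa>)) (vertex_point C) = \<mu>"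
          using gdist_edge_ends(1)[OF \<delta>(1), of \<mu>] \<mu> \<delta>' by auto
        moreover have "gdist (\<gamma> (c - \<delta>)) (vertex_point C) \<le> \<mu> + gdist (\<gamma> (c - \<kappa>)) (vertex_point C)"
          "gdist (\<gamma> (c + \<delta>)) (vertex_point C) \<le> \<mu> + gdist (\<gamma> (c + \<kappa>)) (vertex_point C)"
          using gdist_triangle[OF \<gamma>X[of "c - \<delta>"] \<gamma>X[of "c - \<kappa>"] ends_in[OF C(1)]] gD(3)[of "c - \<delta>" "c - \<kappa>"]
            gdist_triangle[OF \<gamma>X[of "c + \<delta>"] \<gamma>X[of "c + \<kappa>"] ends_in[OF C(1)]] gD(3)[of "c + \<delta>" "c + \<kappa>"]
            \<mu> \<delta>' \<kappa> cab by (auto simp: \<kappa>_def)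
        ultimately show False using \<mu> by linarith
      qed
      have "H.gdist (proj ?x) (proj ?q) = c - a"
        using contracted_distance_cases[OF xy(1) q(1)]
      proof cases
        case 1
        then show ?thesis using gD(3)[of a c] cab by simp
      next
        case 2
        then show ?thesis using far c(1) proj_lipschitz[OF xy(1) q(1)] gD(3)[of a c] cab by simp
      qed (use no_twins[of a c] cab in auto)
      moreover have "H.gdist (proj ?q) (proj ?y) = b - c"
        using contracted_distance_cases[OF q(1) xy(2)]
      proof cases
        case 1
        then show ?thesis using gD(3)[of c b] cab by simp
      next
        case 2
        then show ?thesis using far c(2) proj_lipschitz[OF q(1) xy(2)] gD(3)[of c b] cab by simp
      qed (use no_twins[of c b] cab in auto)
      ultimately show ?thesis using break[OF cab(3)] by blast
    qed
  qed
qed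

text \<open>The guard \<open>a < b\<close> in \<open>outer\<close> admits a single point in the
  interior of \<open>e\<close>. Such a piece arises when a geodesic of \<open>G\<close> begins or
  ends inside \<open>e\<close>.\<close>

lemma geodesic_proj_near_off_contracted:
  assumes thin: "thin_space H.X H.gdist r0" and r: "r0 < r" "1/2 \<le> r"
    and g: "geodesic_path X gdist \<gamma> a b"
    and inner: "\<forall>s. a < s \<longrightarrow> s < b \<longrightarrow> \<not> on_contracted (\<gamma> s)"
    and outer: "a < b \<longrightarrow> (\<forall>s\<in>{a, b}. on_contracted (\<gamma> s) \<longrightarrow> \<gamma> s \<in> vertex_point ` {A, B})"
    and T: "geodesic H.X H.gdist (proj (\<gamma> a)) (proj (\<gamma> b)) T"
  shows "P \<in> T \<Longrightarrow> \<exists>s\<in>{a..b}. H.gdist P (proj (\<gamma> s)) \<le> r"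
    and "s \<in> {a..b} \<Longrightarrow> \<exists>Q\<in>T. H.gdist (proj (\<gamma> s)) Q \<le> 2 * r + 1/2"
proof -
  obtain c where c: "c \<in> {a..b}" "geodesic_path H.X H.gdist (\<lambda>s. proj (\<gamma> s)) a c"
    "geodesic_path H.X H.gdist (\<lambda>s. proj (\<gamma> s)) c b"
    by (rule geodesic_proj_break[OF g inner outer], rule that)
  have quasi: "t - s \<le> max (H.gdist (proj (\<gamma> s)) (proj (\<gamma> t)) + 1) (3/2)" if "s \<in> {a..c}" "t \<in> {c..b}" for s t
    using gdist_le_contracted[of "\<gamma> s" "\<gamma> t"] geodesic_pathD(2,3)[OF g] that c(1) by simp
  show "P \<in> T \<Longrightarrow> \<exists>s\<in>{a..b}. H.gdist P (proj (\<gamma> s)) \<le> r"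
    using H.broken_geodesic_near_geodesic(1)[OF thin r c(2,3) quasi T] .
  show "s \<in> {a..b} \<Longrightarrow> \<exists>Q\<in>T. H.gdist (proj (\<gamma> s)) Q \<le> 2 * r + 1/2"
    using H.broken_geodesic_near_geodesic(2)[OF thin r c(2,3) quasi T] .
qed

lemma twins_proj_dist_le:
  assumes "twins x y"
  shows "H.gdist (proj x) (proj y) \<le> 1"
proof -
  obtain v C D a b where *: "{C, D} = {A, B}" "{v, C} \<in> E" "{v, D} \<in> E"
     "0 < a" "a < 1" "0 < b" "b < 1" "x = edge_point v C a" "y = edge_point v D b"
    using assms unfolding twins_def by blast
  have ne: "{v, C} \<noteq> {A, B}" "{v, D} \<noteq> {A, B}" and cv: "cv D = cv C"
    using *(1) edgeD(1)[OF *(2)] edgeD(1)[OF *(3)] by (auto simp: doubleton_eq_iff contract_vertex_eq_iff)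
  have "H.gdist (proj x) (proj y) = \<bar>a - b\<bar>"
    unfolding *(8,9) proj_edge[OF *(2) ne(1)] proj_edge[OF *(3) ne(2)] cv
    using *(4-7) by (intro H.gdist_edge contract_edge[OF *(2) ne(1)]) auto
  then show ?thesis using *(4-7) by auto
qed

text \<open>If \<open>S\<close> meets \<open>e\<close>, it is cut at its first and last moments on
  \<open>e\<close>, and \<open>T\<close> is routed through \<open>V\<close>. This route may fail to
  be shortest when the ends are twins. In that case \<open>T\<close> and \<open>S\<close> have
  lengths at most 1 and 3/2, so their ends alone suffice: 1/2 is at most \<open>r\<close>, and 3/4
  is at most \<open>2 * r + 1/2\<close>.\<close>

lemma geodesic_proj_near:
  assumes thin: "thin_space H.X H.gdist r0" and r: "r0 < r" "1/2 \<le> r"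
    and S: "geodesic X gdist x y S"
  obtains T where "geodesic H.X H.gdist (proj x) (proj y) T"
    "\<And>P. P \<in> T \<Longrightarrow> \<exists>z\<in>S. H.gdist P (proj z) \<le> r"
    "\<And>z. z \<in> S \<Longrightarrow> \<exists>Q\<in>T. H.gdist (proj z) Q \<le> 2 * r + 1/2"
proof -
  obtain \<gamma> L where g: "geodesic_path X gdist \<gamma> 0 L" "\<gamma> 0 = x" "\<gamma> L = y" "S = \<gamma> ` {0..L}" "gdist x y = L"
    by (rule geodesicE[OF S])
  note gD = geodesic_pathD[OF g(1)]
  have xy: "x \<in> X" "y \<in> X" using geodesic_ends[OF S] by auto
  have \<gamma>X: "\<gamma> s \<in> X" if "s \<in> {0..L}" for s using gD(2) that by simp
  define Z where "Z = {s\<in>{0..L}. on_contracted (\<gamma> s)}"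
  consider (avoid) "Z = {}" | (twins) "twins x y" | (meet) "Z \<noteq> {}" "\<not> twins x y" by blast
  then show thesis
  proof cases
    case avoid
    obtain T where T: "geodesic H.X H.gdist (proj x) (proj y) T" using H.ex_geodesic proj_in xy by blast
    have off: "\<not> on_contracted (\<gamma> s)" if "0 \<le> s" "s \<le> L" for s using avoid that unfolding Z_def by auto
    have inner: "\<forall>s. 0 < s \<longrightarrow> s < L \<longrightarrow> \<not> on_contracted (\<gamma> s)" using off by simp
    have outer: "0 < L \<longrightarrow> (\<forall>s\<in>{0, L}. on_contracted (\<gamma> s) \<longrightarrow> \<gamma> s \<in> vertex_point ` {A, B})"
      using off by auto
    have "geodesic H.X H.gdist (proj (\<gamma> 0)) (proj (\<gamma> L)) T" using T g(2,3) by simp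
    note near = geodesic_proj_near_off_contracted[OF thin r g(1) inner outer this]
    show thesis
    proof (rule that[OF T])
      show "\<exists>z\<in>S. H.gdist P (proj z) \<le> r" if "P \<in> T" for P
        using near(1)[OF that] unfolding g(4) by auto
      show "\<exists>Q\<in>T. H.gdist (proj z) Q \<le> 2 * r + 1/2" if "z \<in> S" for z
        using near(2) that unfolding g(4) by auto
    qed
  next
    case twins
    obtain T where T: "geodesic H.X H.gdist (proj x) (proj y) T" using H.ex_geodesic proj_in xy by blast
    show thesis
    proof (rule that[OF T])
      show "\<exists>z\<in>S. H.gdist P (proj z) \<le> r" if "P \<in> T" for P
        using H.geodesic_near_ends[OF T that] twins_proj_dist_le[OF twins] r(2)
          geodesic_in(2,3)[OF S] by force
      show "\<exists>Q\<in>T. H.gdist (proj z) Q \<le> 2 * r + 1/2" if z: "z \<in> S" for z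
      proof -
        have "z \<in> X" using z geodesic_in(1)[OF S] by auto
        then show ?thesis
          using geodesic_near_ends[OF S z] twins_dist_le[OF twins] r(2) H.geodesic_in(2,3)[OF T]
            proj_lipschitz[OF _ xy(1), of z] proj_lipschitz[OF _ xy(2), of z] by force
      qed
    qed
  next
    case meet
    have Z_eq: "Z = {s\<in>{0..L}. radius (\<gamma> s) = 0}" unfolding Z_def using radius_0_iff \<gamma>X by blast
    have "1-lipschitz_on {0..L} (\<lambda>s. radius (\<gamma> s))"
    proof (rule lipschitz_onI)
      fix s t assume st: "s \<in> {0..L}" "t \<in> {0..L}"
      show "Real_Vector_Spaces.dist (radius (\<gamma> s)) (radius (\<gamma> t)) \<le> 1 * Real_Vector_Spaces.dist s t"
        using radius_lipschitz[OF \<gamma>X[OF st(1)] \<gamma>X[OF st(2)]] radius_lipschitz[OF \<gamma>X[OF st(2)] \<gamma>X[OF st(1)]]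
          gD(3)[of s t] gD(3)[of t s] st by (auto simp: dist_real_def)
    qed simp
    then have "closed Z" unfolding Z_eq
      by (intro continuous_closed_preimage_constant lipschitz_on_continuous_on) auto
    moreover have "bounded Z" by (rule bounded_subset[of "{0..L}"]) (auto simp: Z_def)
    ultimately have "compact Z" by (simp add: compact_eq_bounded_closed)
    then obtain s1 s2 where s1: "s1 \<in> Z" "\<And>s. s \<in> Z \<Longrightarrow> s1 \<le> s" and s2: "s2 \<in> Z" "\<And>s. s \<in> Z \<Longrightarrow> s \<le> s2"
      using compact_attains_inf[of Z] compact_attains_sup[of Z] meet(1) by metis
    have s12: "0 \<le> s1" "s1 \<le> s2" "s2 \<le> L" using s1 s2(1) by (auto simp: Z_def)
    have contr: "on_contracted (\<gamma> s1)" "on_contracted (\<gamma> s2)" using s1(1) s2(1) by (auto simp: Z_def)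
    then have projV: "proj (\<gamma> s1) = V" "proj (\<gamma> s2) = V" using proj_eq_V_iff on_contracted_in by auto
    have off: "\<not> on_contracted (\<gamma> s)" if "0 \<le> s" "s \<le> L" "s < s1 \<or> s2 < s" for s
      using s1(2)[of s] s2(2)[of s] that unfolding Z_def by auto
    \<comment> \<open>Interior points of \<open>e\<close> have a neighbourhood inside
      \<open>e\<close>, so a moment on \<open>e\<close> next to an interval off \<open>e\<close> is
      spent at an end.\<close>
    have end_point: "\<gamma> s \<in> vertex_point ` {A, B}"
      if s: "0 \<le> s" "s \<le> L" "on_contracted (\<gamma> s)"
        and t: "0 \<le> t" "t \<le> L" "t \<noteq> s" "\<And>t'. t' \<noteq> s \<Longrightarrow> min s t \<le> t' \<Longrightarrow> t' \<le> max s t \<Longrightarrow> \<not> on_contracted (\<gamma> t')" for s t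
    proof (rule ccontr)
      assume "\<not> ?thesis"
      then obtain \<epsilon> where \<epsilon>: "0 < \<epsilon>" "\<And>w. w \<in> X \<Longrightarrow> gdist (\<gamma> s) w < \<epsilon> \<Longrightarrow> on_contracted w"
        using contracted_interior[OF s(3)] by metis
      define t' where "t' = (if s < t then min t (s + \<epsilon>/2) else max t (s - \<epsilon>/2))"
      have t': "t' \<noteq> s" "min s t \<le> t'" "t' \<le> max s t" "\<bar>s - t'\<bar> < \<epsilon>" using \<epsilon>(1) t(3) by (auto simp: t'_def)
      have "gdist (\<gamma> s) (\<gamma> t') = \<bar>s - t'\<bar>" "\<gamma> t' \<in> X" using gD(2,3) s t t' by auto
      then show False using \<epsilon>(2)[of "\<gamma> t'"] t(4)[OF t'(1-3)] t'(4) by simp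
    qed
    \<comment> \<open>If the projection keeps the distance \<open>L\<close>, the visit to
      \<open>e\<close> at time \<open>s1\<close> bounds the radii by \<open>s1\<close> and
      \<open>L - s1\<close>, so the route through \<open>V\<close> is no longer than
      \<open>L\<close>.\<close>
    have eq: "H.gdist (proj x) (proj y) = radius x + radius y"
      using contracted_distance_cases[OF xy]
    proof cases
      case 1
      have "radius x \<le> s1" "radius y \<le> L - s1"
        using radius_lipschitz[OF xy(1) \<gamma>X[of s1]] radius_lipschitz[OF xy(2) \<gamma>X[of s1]] s12
          radius_0_iff[OF \<gamma>X[of s1]] contr gD(3)[of 0 s1] gD(3)[of L s1] gD(1) g(2,3) by auto
      then show ?thesis using 1 g(5) H.gdist_triangle[OF proj_in[OF xy(1)] V_in proj_in[OF xy(2)]]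
        unfolding radius_def by (simp add: H.gdist_sym)
    qed (use meet(2) in auto)
    obtain T1 where T1: "geodesic H.X H.gdist (proj x) V T1" using H.ex_geodesic proj_in[OF xy(1)] V_in by blast
    obtain T2 where T2: "geodesic H.X H.gdist V (proj y) T2" using H.ex_geodesic proj_in[OF xy(2)] V_in by blast
    have T: "geodesic H.X H.gdist (proj x) (proj y) (T1 \<union> T2)"
      using eq by (intro H.geodesic_concat[OF T1 T2]) (simp add: radius_def H.gdist_sym)
    have g1: "geodesic_path X gdist \<gamma> 0 s1" and g2: "geodesic_path X gdist \<gamma> s2 L"
      using geodesic_path_subset[OF g(1)] s12 by auto
    have outer1: "0 < s1 \<longrightarrow> (\<forall>s\<in>{0, s1}. on_contracted (\<gamma> s) \<longrightarrow> \<gamma> s \<in> vertex_point ` {A, B})"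
    proof (intro impI ballI)
      fix s assume that: "0 < s1" "s \<in> {0, s1}" "on_contracted (\<gamma> s)"
      have "s = s1" using that off[of 0] s12 by auto
      then show "\<gamma> s \<in> vertex_point ` {A, B}" using that s12 by (intro end_point[of s 0] off) auto
    qed
    have outer2: "s2 < L \<longrightarrow> (\<forall>s\<in>{s2, L}. on_contracted (\<gamma> s) \<longrightarrow> \<gamma> s \<in> vertex_point ` {A, B})"
    proof (intro impI ballI)
      fix s assume that: "s2 < L" "s \<in> {s2, L}" "on_contracted (\<gamma> s)"
      have "s = s2" using that off[of L] s12 by auto
      then show "\<gamma> s \<in> vertex_point ` {A, B}" using that s12 by (intro end_point[of s L] off) auto
    qed
    have inner1: "\<forall>s. 0 < s \<longrightarrow> s < s1 \<longrightarrow> \<not> on_contracted (\<gamma> s)" using off s12 by simp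
    have inner2: "\<forall>s. s2 < s \<longrightarrow> s < L \<longrightarrow> \<not> on_contracted (\<gamma> s)" using off s12 by simp
    have "geodesic H.X H.gdist (proj (\<gamma> 0)) (proj (\<gamma> s1)) T1" using T1 g(2) projV by simp
    note near1 = geodesic_proj_near_off_contracted[OF thin r g1 inner1 outer1 this]
    have "geodesic H.X H.gdist (proj (\<gamma> s2)) (proj (\<gamma> L)) T2" using T2 g(3) projV by simp
    note near2 = geodesic_proj_near_off_contracted[OF thin r g2 inner2 outer2 this]
    show thesis
    proof (rule that[OF T])
      fix P assume "P \<in> T1 \<union> T2"
      then have "\<exists>s\<in>{0..s1} \<union> {s2..L}. H.gdist P (proj (\<gamma> s)) \<le> r"
        using near1(1)[of P] near2(1)[of P] by blast
      then show "\<exists>z\<in>S. H.gdist P (proj z) \<le> r" using s12 unfolding g(4) by auto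
    next
      fix z assume "z \<in> S"
      then obtain s where s: "z = \<gamma> s" "0 \<le> s" "s \<le> L" using g(4) by auto
      consider "s \<le> s1" | "s2 \<le> s" | "s1 < s" "s < s2" by linarith
      then show "\<exists>Q\<in>T1 \<union> T2. H.gdist (proj z) Q \<le> 2 * r + 1/2"
      proof cases
        case 1
        then show ?thesis using near1(2)[of s] s by auto
      next
        case 2
        then show ?thesis using near2(2)[of s] s by auto
      next
        case 3
        \<comment> \<open>The middle part joins two points of \<open>e\<close>, so it is at most 1
          long and each of its points is within 1/2 of a point projecting to
          \<open>V\<close>.\<close>
        have "s2 - s1 \<le> 1" using gdist_contracted_le[OF contr] gD(3)[of s1 s2] s12 by simp
        then consider "s - s1 \<le> 1/2" | "s2 - s \<le> 1/2" by linarith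
        then have "H.gdist (proj z) V \<le> 1/2"
        proof cases
          case 1
          then show ?thesis using proj_lipschitz[OF \<gamma>X[of s] \<gamma>X[of s1]] gD(3)[of s s1] 3 s s12 projV by simp
        next
          case 2
          then show ?thesis using proj_lipschitz[OF \<gamma>X[of s] \<gamma>X[of s2]] gD(3)[of s s2] 3 s s12 projV by simp
        qed
        then show ?thesis using H.geodesic_in(3)[OF T1] r(2) by (intro bexI[of _ V]) auto
      qed
    qed
  qed
qed

text \<open>The constant is the sum of \<open>2 * r + 1/2\<close> from \<open>S1\<close> to
  \<open>T1\<close>, \<open>r\<close> for the triangle in \<open>H\<close>, \<open>r\<close> from
  its other sides to \<open>S2\<close> or \<open>S3\<close>, and 1 for returning to \<open>G\<close>
  by \<open>gdist_le_contracted\<close>.\<close>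

lemma thin_if_contraction_thin:
  assumes thin: "thin_space H.X H.gdist r0" and r: "r0 < r" "1/2 \<le> r"
  shows "thin_space X gdist (4 * r + 3/2)"
proof (rule thin_spaceI)
  fix x y z S1 S2 S3 p
  assume S: "geodesic X gdist x y S1" "geodesic X gdist y z S2" "geodesic X gdist z x S3" "p \<in> S1"
  obtain T1 where T1: "geodesic H.X H.gdist (proj x) (proj y) T1"
    "\<And>z. z \<in> S1 \<Longrightarrow> \<exists>Q\<in>T1. H.gdist (proj z) Q \<le> 2 * r + 1/2"
    using geodesic_proj_near[OF thin r S(1)] by metis
  obtain T2 where T2: "geodesic H.X H.gdist (proj y) (proj z) T2"
    "\<And>P. P \<in> T2 \<Longrightarrow> \<exists>z\<in>S2. H.gdist P (proj z) \<le> r"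
    using geodesic_proj_near[OF thin r S(2)] by metis
  obtain T3 where T3: "geodesic H.X H.gdist (proj z) (proj x) T3"
    "\<And>P. P \<in> T3 \<Longrightarrow> \<exists>z\<in>S3. H.gdist P (proj z) \<le> r"
    using geodesic_proj_near[OF thin r S(3)] by metis
  obtain Q where Q: "Q \<in> T1" "H.gdist (proj p) Q \<le> 2 * r + 1/2" using T1(2) S(4) by blast
  obtain Q' where Q': "Q' \<in> T2 \<union> T3" "H.gdist Q Q' \<le> r0"
    by (rule thin_spaceD[OF thin T1(1) T2(1) T3(1) Q(1)])
  obtain q where q: "q \<in> S2 \<union> S3" "H.gdist Q' (proj q) \<le> r" using Q'(1) T2(2) T3(2) by blast
  have X: "p \<in> X" "q \<in> X" "Q \<in> H.X" "Q' \<in> H.X"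
    using S(4) q(1) Q(1) Q'(1) geodesic_in(1)[OF S(1)] geodesic_in(1)[OF S(2)] geodesic_in(1)[OF S(3)]
      H.geodesic_in(1)[OF T1(1)] H.geodesic_in(1)[OF T2(1)] H.geodesic_in(1)[OF T3(1)] by auto
  have "H.gdist (proj p) (proj q) \<le> 4 * r + 1/2"
    using H.gdist_triangle[OF proj_in[OF X(1)] X(3) proj_in[OF X(2)]]
      H.gdist_triangle[OF X(3,4) proj_in[OF X(2)]] Q(2) Q'(2) q(2) r(1) by linarith
  then have "gdist p q \<le> 4 * r + 3/2" using gdist_le_contracted[OF X(1,2)] r(2) by linarith
  then show "\<exists>q\<in>S2 \<union> S3. gdist p q \<le> 4 * r + 3/2" using q(1) by blast
qed

section \<open>Passage to the hyperbolicity constants\<close>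

lemma graph_delta_contract_le: "graph_delta H \<le> 3 * graph_delta G"
proof (cases "graph_delta G = top")
  case False
  then obtain g where g: "graph_delta G = ennreal g" "0 \<le> g" by (cases "graph_delta G") auto
  have *: "graph_delta H \<le> ennreal (3 * g) + ennreal \<epsilon>" if "0 < \<epsilon>" for \<epsilon>
  proof -
    \<comment> \<open>\<open>\<epsilon>/6 < \<epsilon>/3\<close> is the slack for
      \<open>thin_contraction\<close>, and three times \<open>\<epsilon>/3\<close> is the permitted
      error.\<close>
    have "graph_delta G < ennreal (g + \<epsilon>/6)" using g that by (simp add: ennreal_less_iff)
    then have "thin_space X gdist (g + \<epsilon>/6)"
      unfolding graph_delta_def by (rule thin_space_if_hyperbolicity_less)
    then have "thin_space H.X H.gdist (3 * (g + \<epsilon>/3))"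
      using g(2) that by (intro thin_contraction[of "g + \<epsilon>/6"]) auto
    then have "graph_delta H \<le> ennreal (3 * (g + \<epsilon>/3))"
      unfolding graph_delta_def using g(2) that by (intro hyperbolicity_constant_le) auto
    also have "\<dots> = ennreal (3 * g) + ennreal \<epsilon>" using g(2) that by (simp flip: ennreal_plus)
    finally show ?thesis .
  qed
  have "graph_delta H \<le> ennreal (3 * g)" by (rule ennreal_le_epsilon, rule *)
  then show ?thesis using g by (simp add: ennreal_mult)
qed simp

lemma graph_delta_le_contract: "graph_delta G \<le> 16 / 3 * graph_delta H + 1"
proof (cases "graph_delta H = top")
  case False
  then obtain g where g: "graph_delta H = ennreal g" "0 \<le> g" by (cases "graph_delta H") auto
  have "graph_delta G \<le> ennreal (16/3 * g + 1)"
  proof (cases "g < 1/2")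
    case True
    \<comment> \<open>The mean of \<open>g\<close> and 1/2 is above \<open>g\<close>, as needed to
      extract thinness, and below 1/2, as needed for the separation argument.\<close>
    then have "graph_delta H < ennreal ((g + 1/2) / 2)" using g by (simp add: ennreal_less_iff)
    then have thin: "thin_space H.X H.gdist ((g + 1/2) / 2)"
      unfolding graph_delta_def by (rule thin_space_if_hyperbolicity_less)
    have *: "graph_delta G \<le> ennreal 1 + ennreal \<epsilon>" if "0 < \<epsilon>" for \<epsilon>
    proof -
      have "graph_delta G \<le> ennreal (1 + \<epsilon>)"
        unfolding graph_delta_def using True that
        by (intro hyperbolicity_constant_le thin_if_contraction_thin_small[OF thin]) auto
      then show ?thesis using that by simp
    qed
    have "graph_delta G \<le> ennreal 1" by (rule ennreal_le_epsilon, rule *)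
    also have "\<dots> \<le> ennreal (16/3 * g + 1)" using g(2) by (intro ennreal_leI) simp
    finally show ?thesis .
  next
    case False
    have *: "graph_delta G \<le> ennreal (4 * g + 3/2) + ennreal \<epsilon>" if "0 < \<epsilon>" for \<epsilon>
    proof -
      have "graph_delta H < ennreal (g + \<epsilon>/8)" using g that by (simp add: ennreal_less_iff)
      then have "thin_space H.X H.gdist (g + \<epsilon>/8)"
        unfolding graph_delta_def by (rule thin_space_if_hyperbolicity_less)
      then have "thin_space X gdist (4 * (g + \<epsilon>/4) + 3/2)"
        using False that by (intro thin_if_contraction_thin[of "g + \<epsilon>/8"]) auto
      then have "graph_delta G \<le> ennreal (4 * (g + \<epsilon>/4) + 3/2)"
        unfolding graph_delta_def using g(2) that by (intro hyperbolicity_constant_le) auto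
      also have "\<dots> = ennreal (4 * g + 3/2) + ennreal \<epsilon>"
        using g(2) that by (simp add: algebra_simps flip: ennreal_plus)
      finally show ?thesis .
    qed
    have "graph_delta G \<le> ennreal (4 * g + 3/2)" by (rule ennreal_le_epsilon, rule *)
    \<comment> \<open>The comparison amounts to \<open>3/8 \<le> g\<close>, and in this case
      \<open>1/2 \<le> g\<close>.\<close>
    also have "\<dots> \<le> ennreal (16/3 * g + 1)" using False by (intro ennreal_leI) simp
    finally show ?thesis .
  qed
  also have "\<dots> = 16/3 * ennreal g + 1"
  proof -
    have "ennreal (16/3) = 16/3" by (simp flip: divide_ennreal)
    moreover have "ennreal (16/3 * g) = ennreal (16/3) * ennreal g"
      using g(2) by (intro ennreal_mult) auto
    moreover have "ennreal (16/3 * g + 1) = ennreal (16/3 * g) + ennreal 1"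
      using g(2) by (intro ennreal_plus) auto
    ultimately show ?thesis by (simp only: ennreal_1)
  qed
  finally show ?thesis unfolding g(1) .
qed (simp add: ennreal_mult_eq_top_iff)

end

theorem theorem2p12:
  fixes G :: "'a ugraph" and e :: "'a set"
  assumes "simple_graph G" and "connected_graph G" and "e \<in> edges G"
  shows "1 / 3 * graph_delta (contract G e) \<le> graph_delta G \<and>
         graph_delta G \<le> 16 / 3 * graph_delta (contract G e) + 1"
proof -
  obtain A B where e: "e = {A, B}"
    using assms(1,3) unfolding simple_graph_def card_2_iff by metis
  interpret contraction G A B
    using assms e by unfold_locales auto
  have "1 / 3 * graph_delta (contract G e) \<le> 1 / 3 * (3 * graph_delta G)"
    unfolding e by (intro mult_left_mono graph_delta_contract_le) simp
  also have "\<dots> = graph_delta G"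
  proof -
    have "1 / 3 * (3::ennreal) = ennreal (1/3) * ennreal 3" using divide_ennreal[of 1 3] by simp
    also have "\<dots> = 1" by (subst ennreal_mult[symmetric]) simp_all
    finally have "1 / 3 * (3::ennreal) = 1" .
    then show ?thesis by (simp flip: mult.assoc)
  qed
  finally show ?thesis using graph_delta_le_contract unfolding e by blast
qed

end
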